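(* The metric space $(\mathcal D_K,\Box)$ is complete and separable.
   Context: A geometric data set is a triple $(X,F_X,\mu_X)$ where $F_X$ is a nonempty family of real-valued functions (features) on $X$ such that $d_X(x,x'):=\sup_{f\in F_X}|f(x)-f(x')|$ is a (finite) complete separable metric on $X$, and $\mu_X$ is a Borel probability measure on $(X,d_X)$ with full support. $\overline{F_X}$ denotes the closure of $F_X$ in the set of real-valued functions on $X$ under pointwise convergence. $X$ and $Y$ are isomorphic if there is a Borel map $\phi:X\to Y$ with $\phi_*\mu_X=\mu_Y$ and $\overline{F_Y}\circ\phi=\overline{F_X}$. Isomorphic geometric data sets are identified; $\mathcal D$ is the set of isomorphism classes. $K=[-1/2,1/2]$ and $\mathcal D_K\subset\mathcal D$ is the set of classes whose features all take values in $K$. $\mathcal T(\mu,\nu)$ is the set of couplings of $\mu,\nu$ (Borel probability measures on the product with marginals $\mu,\nu$); $\mathrm{pr}_1,\mathrm{pr}_2$ are the coordinate projections; $(d)_H$ is the Hausdorff distance induced by $d$. Box distance. For a closed set $S\subset X\times Y$, $d_{\infty,S}(u,v):=\sup_{z\in S}|u(z)-v(z)|$ if $S\ne\varnothing$ and $d_{\infty,\varnothing}:=0$. Then \[\Box(X,Y):=\inf_{\pi\in\mathcal T(\mu_X,\mu_Y),\ S\subset X\times Y\text{ closed}}\max\{1-\pi(S),\,2(d_{\infty,S})_H(F_X\circ\mathrm{pr}_1,F_Y\circ\mathrm{pr}_2)\},\] which is a metric on $\mathcal D$. *)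

theory Defs
  imports "HOL-Analysis.Analysis" "HOL-Probability.Probability"
begin

section \<open>Geometric data sets\<close>

definition borel_of :: "'a topology \<Rightarrow> 'a measure" where
  "borel_of T = sigma (topspace T) {U. openin T U}"

text \<open>Functions on the point set are represented by extensional functions, so that a
  feature family is a set of functions on the point set in the usual sense.\<close>

record 'a gds_data =
  pts :: "'a set"
  feats :: "('a \<Rightarrow> real) set"
  msr :: "'a measure"

text \<open>The value 0 off the point set is a convention required by \<^locale>\<open>Metric_space\<close>, whose
  distance functions are nonnegative and symmetric on the whole type.\<close>

definition gds_dist :: "'a gds_data \<Rightarrow> 'a \<Rightarrow> 'a \<Rightarrow> real" where
  "gds_dist X x y =
     (if x \<in> pts X \<and> y \<in> pts X then (SUP f\<in>feats X. \<bar>f x - f y\<bar>) else 0)"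

definition gds_topology :: "'a gds_data \<Rightarrow> 'a topology" where
  "gds_topology X = Metric_space.mtopology (pts X) (gds_dist X)"

text \<open>The \<^const>\<open>bdd_above\<close> condition says that the supremum in \<^const>\<open>gds_dist\<close> is finite.\<close>

definition geometric_data_set :: "'a gds_data \<Rightarrow> bool" where
  "geometric_data_set X \<longleftrightarrow>
     feats X \<noteq> {} \<and> feats X \<subseteq> extensional (pts X) \<and>
     (\<forall>x\<in>pts X. \<forall>y\<in>pts X. bdd_above ((\<lambda>f. \<bar>f x - f y\<bar>) ` feats X)) \<and>
     Metric_space (pts X) (gds_dist X) \<and>
     Metric_space.mcomplete (pts X) (gds_dist X) \<and>
     separable_space (gds_topology X) \<and>
     sets (msr X) = sets (borel_of (gds_topology X)) \<and>
     prob_space (msr X) \<and>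
     (\<forall>U. openin (gds_topology X) U \<and> U \<noteq> {} \<longrightarrow> emeasure (msr X) U > 0)"

text \<open>The product topology over the index set \<^term>\<open>pts X\<close> lives on the extensional functions and
  is the topology of pointwise convergence.\<close>

definition feats_closure :: "'a gds_data \<Rightarrow> ('a \<Rightarrow> real) set" where
  "feats_closure X = product_topology (\<lambda>_. euclideanreal) (pts X) closure_of feats X"

definition gds_iso :: "'a gds_data \<Rightarrow> 'b gds_data \<Rightarrow> bool" where
  "gds_iso X Y \<longleftrightarrow>
     (\<exists>\<phi>. \<phi> \<in> msr X \<rightarrow>\<^sub>M msr Y \<and> distr (msr X) (msr Y) \<phi> = msr Y \<and>
          (\<lambda>g. compose (pts X) g \<phi>) ` feats_closure Y = feats_closure X)"

section \<open>Box distance\<close>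

definition couplings :: "'a gds_data \<Rightarrow> 'b gds_data \<Rightarrow> ('a \<times> 'b) measure set" where
  "couplings X Y =
     {\<pi>. sets \<pi> = sets (borel_of (prod_topology (gds_topology X) (gds_topology Y))) \<and>
         prob_space \<pi> \<and> distr \<pi> (msr X) fst = msr X \<and> distr \<pi> (msr Y) snd = msr Y}"

text \<open>Features may be unbounded, so this distance is \<^typ>\<open>ennreal\<close>-valued; as the supremum of the
  empty set in \<^typ>\<open>ennreal\<close> is 0, it vanishes for empty \<^term>\<open>S\<close>.\<close>

definition dist_sup_on :: "'a set \<Rightarrow> ('a \<Rightarrow> real) \<Rightarrow> ('a \<Rightarrow> real) \<Rightarrow> ennreal" where
  "dist_sup_on S u v = (SUP z\<in>S. ennreal \<bar>u z - v z\<bar>)"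

definition hausdorff_of :: "('a \<Rightarrow> 'a \<Rightarrow> ennreal) \<Rightarrow> 'a set \<Rightarrow> 'a set \<Rightarrow> ennreal" where
  "hausdorff_of d A B = max (SUP a\<in>A. INF b\<in>B. d a b) (SUP b\<in>B. INF a\<in>A. d a b)"

text \<open>The infimum is at most 1 for geometric data sets (take \<^term>\<open>S = {}\<close>), so the conversion to
  a real number loses nothing.\<close>

definition box_dist :: "'a gds_data \<Rightarrow> 'b gds_data \<Rightarrow> real" where
  "box_dist X Y = enn2real
     (INF (\<pi>, S) \<in> couplings X Y \<times>
         {S. closedin (prod_topology (gds_topology X) (gds_topology Y)) S}.
       max (1 - emeasure \<pi> S)
           (2 * hausdorff_of (dist_sup_on S) ((\<lambda>f. f \<circ> fst) ` feats X) ((\<lambda>g. g \<circ> snd) ` feats Y)))"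

section \<open>The space of isomorphism classes\<close>

text \<open>A separable metric space has at most continuum many points, so every geometric data set is
  isomorphic to one whose points are real numbers: see \<open>ex_gds_iso_real\<close> below. The isomorphism
  classes over the type \<^typ>\<open>real\<close> therefore represent all isomorphism classes.\<close>

definition gds_iso_rel :: "(real gds_data \<times> real gds_data) set" where
  "gds_iso_rel = {(X, Y). geometric_data_set X \<and> geometric_data_set Y \<and> gds_iso X Y}"

definition gds_classes :: "real gds_data set set" where
  "gds_classes = {X. geometric_data_set X} // gds_iso_rel"

definition gds_classes_K :: "real gds_data set set" where
  "gds_classes_K =
     {C \<in> gds_classes. \<forall>X\<in>C. \<forall>f\<in>feats X. \<forall>x\<in>pts X. f x \<in> {-1/2..1/2}}"

text \<open>The box distance is invariant under isomorphism, so the choice of representatives is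
  immaterial. Off \<^const>\<open>gds_classes\<close> the value is 0 for the same reason as in \<^const>\<open>gds_dist\<close>.\<close>

definition box_class :: "real gds_data set \<Rightarrow> real gds_data set \<Rightarrow> real" where
  "box_class C D =
     (if C \<in> gds_classes \<and> D \<in> gds_classes then box_dist (SOME X. X \<in> C) (SOME Y. Y \<in> D) else 0)"

subsection \<open>Every geometric data set is isomorphic to one on real numbers\<close>

lemma space_borel_of: "space (borel_of T) = topspace T"
  by (simp add: borel_of_def space_measure_of_conv)

lemma sets_borel_of: "sets (borel_of T) = sigma_sets (topspace T) {U. openin T U}"
  unfolding borel_of_def by (rule sets_measure_of) (auto dest: openin_subset)

lemma continuous_map_measurable_borel_of:
  assumes "continuous_map S T f"
  shows "f \<in> borel_of S \<rightarrow>\<^sub>M borel_of T"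
  unfolding borel_of_def[of T]
proof (rule measurable_measure_of)
  show "{U. openin T U} \<subseteq> Pow (topspace T)"
    by (auto dest: openin_subset)
  show "f \<in> space (borel_of S) \<rightarrow> topspace T"
    using assms by (auto simp: space_borel_of continuous_map_def)
  fix U assume "U \<in> {U. openin T U}"
  then have "openin S {x \<in> topspace S. f x \<in> U}"
    using assms by (auto simp: continuous_map_def)
  moreover have "f -` U \<inter> space (borel_of S) = {x \<in> topspace S. f x \<in> U}"
    by (auto simp: space_borel_of)
  ultimately show "f -` U \<inter> space (borel_of S) \<in> sets (borel_of S)"
    by (auto simp: sets_borel_of)
qed

lemma (in Metric_space) separable_inj_real:
  assumes "separable_space mtopology"
  obtains h :: "'a \<Rightarrow> real" where "inj_on h M"
proof -
  obtain Q where Q: "countable Q" "Q \<subseteq> M" "mtopology closure_of Q = M"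
    using assms by (auto simp: separable_space_def)
  define N where "N = (\<lambda>x. {(q, r :: rat). q \<in> Q \<and> d q x < of_rat r})"
  have inj: "inj_on N M"
  proof (rule inj_onI)
    fix x y assume xy: "x \<in> M" "y \<in> M" "N x = N y"
    show "x = y"
    proof (rule ccontr)
      assume "x \<noteq> y"
      then have pos: "d x y / 2 > 0" using xy by simp
      have "x \<in> mtopology closure_of Q" using Q xy by simp
      then obtain q where q: "q \<in> Q" "d x q < d x y / 2"
        using pos unfolding metric_closure_of in_mball mem_Collect_eq by blast
      obtain r where r: "d x q < of_rat r" "of_rat r < d x y / 2"
        using q(2) of_rat_dense by blast
      then have "(q, r) \<in> N x" using q by (auto simp: N_def commute)
      then have "(q, r) \<in> N y" using xy by simp
      then have "d q y < d x y / 2" using r by (auto simp: N_def)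
      moreover have "d x y \<le> d x q + d q y"
        using q Q xy by (intro triangle) auto
      ultimately show False using q by linarith
    qed
  qed
  have cnt: "countable (Q \<times> (UNIV :: rat set))"
    using Q by auto
  then obtain e :: "'a \<times> rat \<Rightarrow> nat" where e: "inj_on e (Q \<times> UNIV)"
    by (auto simp: countable_def)
  obtain g :: "nat set \<Rightarrow> real" where g: "bij g"
    using nat_sets_eqpoll_reals by (auto simp: eqpoll_def)
  have "inj_on (\<lambda>x. g (e ` N x)) M"
  proof (rule inj_onI)
    fix x y assume xy: "x \<in> M" "y \<in> M" "g (e ` N x) = g (e ` N y)"
    then have "e ` N x = e ` N y"
      using g by (meson bij_is_inj injD)
    moreover have "N x \<subseteq> Q \<times> UNIV" "N y \<subseteq> Q \<times> UNIV"
      by (auto simp: N_def)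
    ultimately have "N x = N y"
      using e by (simp add: inj_on_image_eq_iff)
    then show "x = y" using inj xy by (meson inj_onD)
  qed
  then show ?thesis using that by blast
qed

lemma gds_transport:
  fixes X :: "'a gds_data" and h :: "'a \<Rightarrow> 'b"
  assumes X: "geometric_data_set X" and h: "inj_on h (pts X)"
  shows "\<exists>Y :: 'b gds_data. geometric_data_set Y \<and> gds_iso X Y"
proof -
  define A where "A = pts X"
  define B where "B = h ` A"
  define k where "k = inv_into A h"
  define \<Phi> where "\<Phi> = (\<lambda>f :: 'a \<Rightarrow> real. compose B f k)"
  define \<Psi> where "\<Psi> = (\<lambda>g :: 'b \<Rightarrow> real. compose A g h)"
  have kh: "k (h x) = x" if "x \<in> A" for x
    using h that by (simp add: k_def A_def)
  have hk: "h (k y) = y" "k y \<in> A" if "y \<in> B" for y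
    using that by (auto simp: k_def B_def f_inv_into_f inv_into_into)
  have hB: "h x \<in> B" if "x \<in> A" for x
    using that by (auto simp: B_def)
  define Y0 where "Y0 = \<lparr>pts = B, feats = \<Phi> ` feats X, msr = undefined\<rparr>"
  define Y where "Y = \<lparr>pts = B, feats = \<Phi> ` feats X,
     msr = distr (msr X) (borel_of (gds_topology Y0)) h\<rparr>"
  have pY: "pts Y = B" and fY: "feats Y = \<Phi> ` feats X"
    by (simp_all add: Y_def)
  have dY: "gds_dist Y0 = gds_dist Y"
    by (intro ext) (simp add: gds_dist_def Y0_def Y_def)
  have tY: "gds_topology Y0 = gds_topology Y"
    by (simp add: gds_topology_def dY) (simp add: Y0_def Y_def)
  have mY: "msr Y = distr (msr X) (borel_of (gds_topology Y)) h"
    unfolding tY[symmetric] by (subst Y_def) simp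
  note X' = X[unfolded geometric_data_set_def, folded A_def]
  have dh: "gds_dist Y (h x) (h y) = gds_dist X x y" if "x \<in> A" "y \<in> A" for x y
    using that by (simp add: gds_dist_def pY fY image_image \<Phi>_def compose_def hB kh A_def[symmetric])
  have dk: "gds_dist X (k x) (k y) = gds_dist Y x y" if "x \<in> B" "y \<in> B" for x y
    using dh[of "k x" "k y"] that by (simp add: hk)
  have zY: "gds_dist Y x y = 0" if "\<not> (x \<in> B \<and> y \<in> B)" for x y
    using that by (auto simp add: gds_dist_def pY)
  interpret MX: Metric_space A "gds_dist X"
    using X' by simp
  interpret MY: Metric_space B "gds_dist Y"
  proof
    fix x y z
    show "0 \<le> gds_dist Y x y"
      using zY[of x y] dk[of x y] MX.nonneg[of "k x" "k y"] by (cases "x \<in> B \<and> y \<in> B") auto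
    show "gds_dist Y x y = gds_dist Y y x"
      by (auto simp: gds_dist_def abs_minus_commute)
    show "gds_dist Y x y = 0 \<longleftrightarrow> x = y" if "x \<in> B" "y \<in> B"
      using that hk dk[of x y, symmetric] by (metis MX.zero)
    show "gds_dist Y x z \<le> gds_dist Y x y + gds_dist Y y z" if "x \<in> B" "y \<in> B" "z \<in> B"
      using that MX.triangle[of "k x" "k y" "k z"] by (simp add: hk dk)
  qed
  have TX: "gds_topology X = MX.mtopology" and TY: "gds_topology Y = MY.mtopology"
    by (simp_all add: gds_topology_def pY A_def)
  have ch: "continuous_map MX.mtopology MY.mtopology h"
    unfolding Metric_space.metric_continuous_map[OF MX.Metric_space_axioms MY.Metric_space_axioms]
    using hB dh by fastforce
  have ck: "continuous_map MY.mtopology MX.mtopology k"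
    unfolding Metric_space.metric_continuous_map[OF MY.Metric_space_axioms MX.Metric_space_axioms]
    using hk dk by fastforce
  have cX: "MX.mcomplete" using X' by simp
  have complete: "MY.mcomplete"
    unfolding MY.mcomplete_def
  proof (intro allI impI)
    fix \<sigma> assume \<sigma>: "MY.MCauchy \<sigma>"
    then have r: "\<sigma> n \<in> B" for n
      by (auto simp: MY.MCauchy_def)
    have "MX.MCauchy (k \<circ> \<sigma>)"
      using \<sigma> r by (auto simp: MY.MCauchy_def MX.MCauchy_def hk dk)
    then obtain l where "limitin MX.mtopology (k \<circ> \<sigma>) l sequentially"
      using cX MX.mcomplete_def by blast
    then have "limitin MY.mtopology (h \<circ> (k \<circ> \<sigma>)) (h l) sequentially"
      by (rule continuous_map_limit[OF ch])
    moreover have "h \<circ> (k \<circ> \<sigma>) = \<sigma>"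
      using r hk by auto
    ultimately show "\<exists>x. limitin MY.mtopology \<sigma> x sequentially"
      by auto
  qed
  have separable: "separable_space MY.mtopology"
  proof (rule separable_space_continuous_map_image[OF _ ch])
    show "separable_space MX.mtopology" using X' TX by simp
    show "h ` topspace MX.mtopology = topspace MY.mtopology" by (simp flip: B_def)
  qed
  have hmeas: "h \<in> msr X \<rightarrow>\<^sub>M borel_of (gds_topology Y)"
    using continuous_map_measurable_borel_of[OF ch] X'
    by (simp add: TX TY cong: measurable_cong_sets)
  have setsY: "sets (msr Y) = sets (borel_of (gds_topology Y))"
    by (simp add: mY)
  interpret PX: prob_space "msr X" using X' by simp
  have prob: "prob_space (msr Y)"
    unfolding mY by (rule PX.prob_space_distr[OF hmeas])
  have support: "emeasure (msr Y) U > 0" if U: "openin MY.mtopology U" "U \<noteq> {}" for U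
  proof -
    have UB: "U \<subseteq> B" using openin_subset[OF U(1)] by simp
    have sp: "space (msr X) = A"
      using X' sets_eq_imp_space_eq[of "msr X" "borel_of (gds_topology X)"]
      by (simp add: space_borel_of TX)
    have "openin MX.mtopology {x \<in> A. h x \<in> U}"
      using ch U by (simp add: continuous_map_def)
    moreover have "{x \<in> A. h x \<in> U} \<noteq> {}"
      using U UB hk by (metis (mono_tags, lifting) empty_iff ex_in_conv mem_Collect_eq subsetD)
    ultimately have "emeasure (msr X) {x \<in> A. h x \<in> U} > 0"
      using X' by (simp add: TX)
    moreover have "emeasure (msr Y) U = emeasure (msr X) (h -` U \<inter> space (msr X))"
      unfolding mY using U by (intro emeasure_distr hmeas) (auto simp: sets_borel_of TY)
    moreover have "h -` U \<inter> space (msr X) = {x \<in> A. h x \<in> U}"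
      by (auto simp: sp)
    ultimately show ?thesis by simp
  qed
  have "bdd_above ((\<lambda>f. \<bar>f x - f y\<bar>) ` feats Y)" if "x \<in> B" "y \<in> B" for x y
    using that X' hk by (simp add: fY image_image \<Phi>_def compose_def)
  then have gY: "geometric_data_set Y"
    using X' MY.Metric_space_axioms complete separable setsY prob support
    by (auto simp: geometric_data_set_def pY fY TY \<Phi>_def)
  define PA where "PA = product_topology (\<lambda>_ :: 'a. euclideanreal) A"
  define PB where "PB = product_topology (\<lambda>_ :: 'b. euclideanreal) B"
  have c\<Phi>: "continuous_map PA PB \<Phi>"
    unfolding PA_def PB_def continuous_map_componentwise
    using hk(2) by (auto simp: \<Phi>_def compose_def intro: continuous_map_product_projection)
  have c\<Psi>: "continuous_map PB PA \<Psi>"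
    unfolding PA_def PB_def continuous_map_componentwise
    using hB by (auto simp: \<Psi>_def compose_def intro: continuous_map_product_projection)
  have \<Psi>\<Phi>: "\<Psi> (\<Phi> f) = f" if "f \<in> extensional A" for f
    using that hB kh by (auto simp: \<Psi>_def \<Phi>_def compose_def extensional_def fun_eq_iff)
  have FX: "feats X \<subseteq> extensional A" using X' by simp
  have tsA: "topspace PA = extensional A"
    by (auto simp: PA_def PiE_def)
  have clX: "feats_closure X = PA closure_of feats X" "feats_closure Y = PB closure_of feats Y"
    by (simp_all add: feats_closure_def PA_def PB_def pY A_def)
  have "\<Psi> ` feats Y = feats X"
    using FX \<Psi>\<Phi> by (force simp: fY image_image)
  then have "\<Psi> ` feats_closure Y \<subseteq> feats_closure X"
    unfolding clX using continuous_map_image_closure_subset[OF c\<Psi>, of "feats Y"] by simp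
  moreover have "feats_closure X \<subseteq> \<Psi> ` feats_closure Y"
  proof
    fix f assume f: "f \<in> feats_closure X"
    then have "f \<in> extensional A"
      unfolding clX using closure_of_subset_topspace[of PA] tsA by blast
    moreover have "\<Phi> f \<in> feats_closure Y"
      using f continuous_map_image_closure_subset[OF c\<Phi>, of "feats X"] by (auto simp: clX fY)
    ultimately show "f \<in> \<Psi> ` feats_closure Y"
      using \<Psi>\<Phi> by (metis imageI)
  qed
  ultimately have "\<Psi> ` feats_closure Y = feats_closure X" by blast
  moreover have "distr (msr X) (msr Y) h = msr Y"
    unfolding mY by (rule distr_cong) simp_all
  moreover have "h \<in> msr X \<rightarrow>\<^sub>M msr Y"
    using hmeas setsY by (simp cong: measurable_cong_sets)
  ultimately have "gds_iso X Y"
    unfolding gds_iso_def \<Psi>_def A_def by blast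
  with gY show ?thesis by blast
qed

theorem ex_gds_iso_real:
  assumes "geometric_data_set X"
  shows "\<exists>Y :: real gds_data. geometric_data_set Y \<and> gds_iso X Y"
proof -
  interpret Metric_space "pts X" "gds_dist X"
    using assms by (simp add: geometric_data_set_def)
  have "separable_space mtopology"
    using assms by (simp add: geometric_data_set_def gds_topology_def)
  then obtain h :: "'a \<Rightarrow> real" where "inj_on h (pts X)"
    by (rule separable_inj_real)
  then show ?thesis
    using gds_transport assms by blast
qed

end

theory Submission
  imports Defs
begin

text \<open>
  Everything reduces to couplings of random variables. Every data set has a countable partition into
  cells of small diameter, and two couplings that agree on the law of a cell index can be glued by
  making the points conditionally independent given that index; since features are 1-Lipschitz, this
  costs no more than the diameter of the cells. The gluing gives the triangle inequality.

  If the box distance vanishes, then the couplings match each point with points whose neighbourhoods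
  have mass bounded below. These lie in a compact set, and a cluster point of the matchings is a
  measure-preserving isometry that identifies the closures of the feature families.

  A data set with features in the compact interval is determined up to a small box distance by the
  rounded masses of finitely many cells and the rounded feature values at their centres, which gives
  separability.

  For completeness, the couplings of consecutive members of a fast Cauchy sequence are glued to a
  Markov chain of cells. Sequences of features that match along the couplings map the points of all
  data sets into one space of bounded functions with the sup norm. There the chain converges almost
  surely, and the support of the law of its limit, with the evaluations as features, is the limit.
\<close>

section \<open>Random indices and their gluing\<close>

text \<open>An exact gluing of two couplings along a shared data set would call for disintegration
  of measures. The features tolerate an error, so it is enough to share a \<open>nat\<close>-valued
  cell index, and conditioning on such an index is only division by the masses of atoms. For the
  same reason the limit process can be built from a countable product of measures on
  \<open>nat\<close>.

  No compact set of large measure is ever chosen; the finitely many cells of small index take its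
  place. Compactness enters only where vanishing distance has to produce an isomorphism, and there
  the lower bound on masses comes from full support.

  The bounded range of the features has two effects: rounded features at finitely many centres form
  a finite set, so the rounded data of a data set range over a countable set, and evaluations of
  sequences of features are bounded functions. The geometric rate along a subsequence makes both the
  exceptional masses and the jumps of the chain summable. The limit lives on a function space and is
  moved back to real points by \<open>ex_gds_iso_real\<close>.\<close>

lemma measurable_pred_eq_nat [measurable (raw)]:
  fixes f g :: "'a \<Rightarrow> nat"
  assumes [measurable]: "f \<in> M \<rightarrow>\<^sub>M count_space UNIV" "g \<in> M \<rightarrow>\<^sub>M count_space UNIV"
  shows "Measurable.pred M (\<lambda>x. f x = g x)"
proof -
  have "Measurable.pred M (\<lambda>x. \<exists>i. f x = i \<and> g x = i)" by measurable
  then show ?thesis by (simp add: eq_commute)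
qed

text \<open>Exceptional masses add: this is the form in which matching events are combined.\<close>

lemma (in prob_space) prob_Int_ge:
  assumes "A \<in> events" "B \<in> events"
  shows "prob (A \<inter> B) \<ge> prob A + prob B - 1"
proof -
  have "prob (A \<union> B) = prob A + prob B - prob (A \<inter> B)"
    using assms by (rule measure_Un3[OF fmeasurable_eq_sets[THEN equalityD2, THEN subsetD] fmeasurable_eq_sets[THEN equalityD2, THEN subsetD]])
  then show ?thesis using prob_le_1[of "A \<union> B"] by linarith
qed

text \<open>A substitute for tightness: the finitely many cells of index below \<open>k\<close> play
  the part of a compact set of almost full measure.\<close>

lemma (in prob_space) index_tail:
  fixes r :: "'a \<Rightarrow> nat"
  assumes [measurable]: "r \<in> M \<rightarrow>\<^sub>M count_space UNIV" and e: "0 < e"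
  obtains k where "prob {x \<in> space M. r x < k} > 1 - e"
proof -
  let ?A = "\<lambda>k. {x \<in> space M. r x < k}"
  have "(\<lambda>k. prob (?A k)) \<longlonglongrightarrow> prob (\<Union>k. ?A k)"
    by (rule finite_Lim_measure_incseq) (auto simp: incseq_def)
  also have "(\<Union>k. ?A k) = space M" by auto
  finally have "(\<lambda>k. prob (?A k)) \<longlonglongrightarrow> 1" by (simp add: prob_space)
  then have "\<forall>\<^sub>F k in sequentially. prob (?A k) > 1 - e"
    using e by (intro order_tendstoD) auto
  then show ?thesis using that by (auto simp: eventually_sequentially)
qed

lemma distr_pair_marginals:
  assumes "prob_space M" "prob_space N"
  shows "distr (M \<Otimes>\<^sub>M N) M fst = M" "distr (M \<Otimes>\<^sub>M N) N snd = N"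
proof -
  interpret M: prob_space M by fact
  interpret N: prob_space N by fact
  show "distr (M \<Otimes>\<^sub>M N) M fst = M" by (rule N.distr_pair_fst)
  show "distr (M \<Otimes>\<^sub>M N) N snd = N"
  proof (rule measure_eqI)
    fix A assume "A \<in> sets (distr (M \<Otimes>\<^sub>M N) N snd)"
    then have A: "A \<in> sets N" by simp
    have "emeasure (distr (M \<Otimes>\<^sub>M N) N snd) A = emeasure (M \<Otimes>\<^sub>M N) (space M \<times> A)"
      using A sets.sets_into_space[OF A]
      by (auto simp: emeasure_distr space_pair_measure intro!: arg_cong[where f = "emeasure (M \<Otimes>\<^sub>M N)"])
    also have "\<dots> = emeasure N A"
      using A by (simp add: N.emeasure_pair_measure_Times M.emeasure_space_1)
    finally show "emeasure (distr (M \<Otimes>\<^sub>M N) N snd) A = emeasure N A" .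
  qed simp
qed

text \<open>The coupling makes the two points conditionally independent given their common index.\<close>

lemma glue_index:
  fixes r :: "'a \<Rightarrow> nat" and s :: "'b \<Rightarrow> nat"
  assumes M: "prob_space M" and N: "prob_space N"
    and r[measurable]: "r \<in> M \<rightarrow>\<^sub>M count_space UNIV" and s[measurable]: "s \<in> N \<rightarrow>\<^sub>M count_space UNIV"
    and eq: "distr M (count_space UNIV) r = distr N (count_space UNIV) s"
  shows "\<exists>\<Omega>. sets \<Omega> = sets (M \<Otimes>\<^sub>M N) \<and> prob_space \<Omega> \<and> distr \<Omega> M fst = M \<and> distr \<Omega> N snd = N \<and>
    (AE z in \<Omega>. r (fst z) = s (snd z))"
proof -
  interpret M: prob_space M by fact
  interpret N: prob_space N by fact
  interpret P: pair_sigma_finite M N by unfold_locales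
  define p where "p i = emeasure (distr M (count_space UNIV) r) {i}" for i
  have pM: "p i = emeasure M {x \<in> space M. r x = i}" for i
    unfolding p_def by (subst emeasure_distr) (auto intro!: arg_cong[where f = "emeasure M"])
  have pN: "p i = emeasure N {x \<in> space N. s x = i}" for i
    unfolding p_def eq by (subst emeasure_distr) (auto intro!: arg_cong[where f = "emeasure N"])
  have p1: "p i < \<top>" for i unfolding pM by (simp add: M.emeasure_eq_measure)
  \<comment> \<open>For an index of mass 0 this is the top element of \<open>ennreal\<close>, whose
    product with 0 is 0. Such indices do not occur almost surely, by \<open>aeM\<close> and
    \<open>aeN\<close>.\<close>
  define c where "c i = 1 / p i" for i :: nat
  have cp: "c i * p i = (if p i = 0 then 0 else 1)" for i
    using p1[of i] by (auto simp: c_def ennreal_divide_times ennreal_divide_self)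
  \<comment> \<open>On the block where both indices equal \<open>i\<close> the product measure has
    mass \<open>p i * p i\<close>. Dividing by \<open>p i\<close> leaves \<open>p i\<close>, and
    integrating out one coordinate leaves the other marginal unchanged.\<close>
  define h where "h = (\<lambda>z :: 'a \<times> 'b. if r (fst z) = s (snd z) then c (r (fst z)) else 0)"
  define \<Omega> where "\<Omega> = density (M \<Otimes>\<^sub>M N) h"
  have [measurable]: "c \<in> count_space UNIV \<rightarrow>\<^sub>M borel" by simp
  have [measurable]: "h \<in> borel_measurable (M \<Otimes>\<^sub>M N)"
    unfolding h_def by measurable
  have hN: "(\<integral>\<^sup>+ y. h (x, y) \<partial>N) = (if p (r x) = 0 then 0 else 1)" for x
  proof -
    have "(\<integral>\<^sup>+ y. h (x, y) \<partial>N) = (\<integral>\<^sup>+ y. c (r x) * indicator {y \<in> space N. s y = r x} y \<partial>N)"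
      by (rule nn_integral_cong) (auto simp: h_def indicator_def)
    then show ?thesis by (simp add: nn_integral_cmult_indicator pN[symmetric] cp)
  qed
  have hM: "(\<integral>\<^sup>+ x. h (x, y) \<partial>M) = (if p (s y) = 0 then 0 else 1)" for y
  proof -
    have "(\<integral>\<^sup>+ x. h (x, y) \<partial>M) = (\<integral>\<^sup>+ x. c (s y) * indicator {x \<in> space M. r x = s y} x \<partial>M)"
      by (rule nn_integral_cong) (auto simp: h_def indicator_def)
    then show ?thesis by (simp add: nn_integral_cmult_indicator pM[symmetric] cp)
  qed
  have aeM: "AE x in M. p (r x) \<noteq> 0"
  proof -
    have "AE x in M. p i = 0 \<longrightarrow> r x \<noteq> i" for i
      by (cases "p i = 0") (auto simp: pM intro!: AE_I[where N = "{x \<in> space M. r x = i}"])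
    then have "AE x in M. \<forall>i. p i = 0 \<longrightarrow> r x \<noteq> i" unfolding AE_all_countable ..
    then show ?thesis by eventually_elim auto
  qed
  have aeN: "AE x in N. p (s x) \<noteq> 0"
  proof -
    have "AE x in N. p i = 0 \<longrightarrow> s x \<noteq> i" for i
      by (cases "p i = 0") (auto simp: pN intro!: AE_I[where N = "{x \<in> space N. s x = i}"])
    then have "AE x in N. \<forall>i. p i = 0 \<longrightarrow> s x \<noteq> i" unfolding AE_all_countable ..
    then show ?thesis by eventually_elim auto
  qed
  have sets: "sets \<Omega> = sets (M \<Otimes>\<^sub>M N)" by (simp add: \<Omega>_def)
  have mf[measurable]: "fst \<in> \<Omega> \<rightarrow>\<^sub>M M" and ms[measurable]: "snd \<in> \<Omega> \<rightarrow>\<^sub>M N"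
    by (simp_all add: \<Omega>_def)
  have d1: "distr \<Omega> M fst = M"
  proof (rule measure_eqI)
    fix A assume "A \<in> sets (distr \<Omega> M fst)"
    then have A[measurable]: "A \<in> sets M" by simp
    have "emeasure (distr \<Omega> M fst) A = (\<integral>\<^sup>+ z. indicator A z \<partial>distr \<Omega> M fst)" by simp
    also have "\<dots> = (\<integral>\<^sup>+ z. indicator A (fst z) \<partial>\<Omega>)"
      by (rule nn_integral_distr) auto
    also have "\<dots> = (\<integral>\<^sup>+ z. h z * indicator A (fst z) \<partial>(M \<Otimes>\<^sub>M N))"
      unfolding \<Omega>_def by (rule nn_integral_density) auto
    also have "\<dots> = (\<integral>\<^sup>+ x. (\<integral>\<^sup>+ y. h (x, y) * indicator A x \<partial>N) \<partial>M)"
      by (subst N.nn_integral_fst[symmetric]) auto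
    also have "\<dots> = (\<integral>\<^sup>+ x. indicator A x \<partial>M)"
    proof (rule nn_integral_cong_AE)
      show "AE x in M. (\<integral>\<^sup>+ y. h (x, y) * indicator A x \<partial>N) = indicator A x"
        using aeM AE_space
      proof eventually_elim
        case (elim x)
        then have [measurable]: "(\<lambda>y. h (x, y)) \<in> borel_measurable N" by measurable
        show ?case using elim by (simp add: nn_integral_multc hN)
      qed
    qed
    finally show "emeasure (distr \<Omega> M fst) A = emeasure M A" by simp
  qed simp
  have d2: "distr \<Omega> N snd = N"
  proof (rule measure_eqI)
    fix A assume "A \<in> sets (distr \<Omega> N snd)"
    then have A[measurable]: "A \<in> sets N" by simp
    have "emeasure (distr \<Omega> N snd) A = (\<integral>\<^sup>+ z. indicator A z \<partial>distr \<Omega> N snd)" by simp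
    also have "\<dots> = (\<integral>\<^sup>+ z. indicator A (snd z) \<partial>\<Omega>)"
      by (rule nn_integral_distr) auto
    also have "\<dots> = (\<integral>\<^sup>+ z. h z * indicator A (snd z) \<partial>(M \<Otimes>\<^sub>M N))"
      unfolding \<Omega>_def by (rule nn_integral_density) auto
    also have "\<dots> = (\<integral>\<^sup>+ y. (\<integral>\<^sup>+ x. h (x, y) * indicator A y \<partial>M) \<partial>N)"
      by (subst P.nn_integral_snd[symmetric]) auto
    also have "\<dots> = (\<integral>\<^sup>+ x. indicator A x \<partial>N)"
    proof (rule nn_integral_cong_AE)
      show "AE y in N. (\<integral>\<^sup>+ x. h (x, y) * indicator A y \<partial>M) = indicator A y"
        using aeN AE_space
      proof eventually_elim
        case (elim y)
        then have [measurable]: "(\<lambda>x. h (x, y)) \<in> borel_measurable M" by measurable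
        show ?case using elim by (simp add: nn_integral_multc hM)
      qed
    qed
    finally show "emeasure (distr \<Omega> N snd) A = emeasure N A" by simp
  qed simp
  have "prob_space (distr \<Omega> M fst)" unfolding d1 by fact
  then have "prob_space \<Omega>" by (rule prob_space_distrD[OF mf])
  moreover have "AE z in \<Omega>. r (fst z) = s (snd z)"
    unfolding \<Omega>_def by (subst AE_density) (auto simp: h_def)
  ultimately show ?thesis using sets d1 d2 by blast
qed

section \<open>Geometric data sets\<close>

locale gds =
  fixes X :: "'a gds_data"
  assumes geometric_data_set: "geometric_data_set X"
begin

sublocale met: Metric_space "pts X" "gds_dist X"
  using geometric_data_set by (simp add: geometric_data_set_def)

sublocale pr: prob_space "msr X"
  using geometric_data_set by (simp add: geometric_data_set_def)

lemma topology_eq: "gds_topology X = met.mtopology"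
  by (simp add: gds_topology_def)

lemma topspace_eq: "topspace (gds_topology X) = pts X"
  by (simp add: topology_eq)

lemma sets_msr: "sets (msr X) = sets (borel_of (gds_topology X))"
  using geometric_data_set by (simp add: geometric_data_set_def)

lemma space_msr: "space (msr X) = pts X"
  using sets_eq_imp_space_eq[OF sets_msr] by (simp add: space_borel_of topspace_eq)

lemma openin_sets: "openin (gds_topology X) U \<Longrightarrow> U \<in> sets (msr X)"
  unfolding sets_msr sets_borel_of by auto

lemma emeasure_open_pos: "openin (gds_topology X) U \<Longrightarrow> U \<noteq> {} \<Longrightarrow> emeasure (msr X) U > 0"
  using geometric_data_set by (simp add: geometric_data_set_def)

lemma feats_nonempty: "feats X \<noteq> {}"
  using geometric_data_set by (simp add: geometric_data_set_def)

lemma feats_extensional: "f \<in> feats X \<Longrightarrow> f \<in> extensional (pts X)"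
  using geometric_data_set by (auto simp add: geometric_data_set_def)

lemma mcomplete: "met.mcomplete"
  using geometric_data_set by (simp add: geometric_data_set_def)

lemma mball_sets [measurable]: "met.mball x r \<in> sets (msr X)"
  by (rule openin_sets) (simp add: topology_eq)

lemma measure_mball_pos:
  assumes "x \<in> pts X" "0 < r"
  shows "measure (msr X) (met.mball x r) > 0"
proof -
  have "x \<in> met.mball x r" using assms by simp
  then have "emeasure (msr X) (met.mball x r) > 0"
    by (metis emeasure_open_pos empty_iff met.openin_mball topology_eq)
  then show ?thesis by (simp add: pr.emeasure_eq_measure)
qed

lemma feats_lipschitz:
  assumes "f \<in> feats X" "x \<in> pts X" "y \<in> pts X"
  shows "\<bar>f x - f y\<bar> \<le> gds_dist X x y"
proof -
  have "bdd_above ((\<lambda>f. \<bar>f x - f y\<bar>) ` feats X)"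
    using geometric_data_set assms by (simp add: geometric_data_set_def)
  then show ?thesis
    unfolding gds_dist_def using assms by (auto intro: cSUP_upper)
qed

lemma gds_dist_least:
  assumes "x \<in> pts X" "y \<in> pts X" "\<And>f. f \<in> feats X \<Longrightarrow> \<bar>f x - f y\<bar> \<le> c"
  shows "gds_dist X x y \<le> c"
  unfolding gds_dist_def using assms feats_nonempty by (auto intro: cSUP_least)

lemma feats_continuous:
  assumes "f \<in> feats X"
  shows "continuous_map (gds_topology X) euclideanreal f"
proof -
  have "continuous_map met.mtopology Met_TC.mtopology f"
    unfolding Metric_space.metric_continuous_map[OF met.Metric_space_axioms Met_TC.Metric_space_axioms]
    using feats_lipschitz[OF assms] by (fastforce simp: dist_real_def)
  then show ?thesis by (simp add: topology_eq)
qed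

lemma pts_nonempty: "pts X \<noteq> {}"
  using pr.not_empty space_msr by simp

lemma dense_seq:
  obtains w :: "nat \<Rightarrow> 'a" where "range w \<subseteq> pts X"
    "\<And>x e. x \<in> pts X \<Longrightarrow> 0 < e \<Longrightarrow> \<exists>n. gds_dist X x (w n) < e"
proof -
  obtain Q where Q: "countable Q" "Q \<subseteq> pts X" "met.mtopology closure_of Q = pts X"
    using geometric_data_set by (auto simp: geometric_data_set_def separable_space_def topology_eq)
  then have ne: "Q \<noteq> {}" using pts_nonempty by auto
  have "\<exists>n. gds_dist X x (from_nat_into Q n) < e" if x: "x \<in> pts X" "0 < e" for x e
  proof -
    have "x \<in> met.mtopology closure_of Q" using x Q by simp
    then obtain q where q: "q \<in> Q" "gds_dist X x q < e"
      using x(2) unfolding met.metric_closure_of met.in_mball mem_Collect_eq by blast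
    then show ?thesis
      using from_nat_into_surj[OF Q(1)] by metis
  qed
  moreover have "range (from_nat_into Q) \<subseteq> pts X"
    using from_nat_into[OF ne] Q(2) by auto
  ultimately show ?thesis using that by blast
qed

text \<open>The index of the first ball of radius \<open>e\<close> in a dense sequence that contains
  the point. It is measurable because only countably many balls are involved, and replacing a point
  by its centre \<open>w (r x)\<close> changes every feature by less than \<open>e\<close>.\<close>

lemma net_index:
  assumes "0 < e"
  obtains r :: "'a \<Rightarrow> nat" and w :: "nat \<Rightarrow> 'a" where
    "r \<in> msr X \<rightarrow>\<^sub>M count_space UNIV" "range w \<subseteq> pts X"
    "\<And>x. x \<in> pts X \<Longrightarrow> gds_dist X x (w (r x)) < e"
proof -
  obtain w :: "nat \<Rightarrow> 'a" where w: "range w \<subseteq> pts X"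
    "\<And>x e. x \<in> pts X \<Longrightarrow> 0 < e \<Longrightarrow> \<exists>n. gds_dist X x (w n) < e"
    using dense_seq by blast
  define r where "r = (\<lambda>x. LEAST n. x \<in> met.mball (w n) e)"
  have "r \<in> msr X \<rightarrow>\<^sub>M count_space UNIV"
    unfolding r_def by measurable
  moreover have "gds_dist X x (w (r x)) < e" if x: "x \<in> pts X" for x
  proof -
    obtain n where "gds_dist X x (w n) < e" using w(2) x assms by blast
    then have "x \<in> met.mball (w n) e"
      using x w(1) by (auto simp: met.commute)
    then have "x \<in> met.mball (w (r x)) e"
      unfolding r_def by (rule LeastI)
    then show ?thesis by (simp add: met.commute)
  qed
  ultimately show ?thesis using that w(1) by blast
qed

text \<open>A basic open set of the product topology restricts finitely many coordinates, and a
  single radius, the least one among them, serves for all.\<close>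

lemma closure_approx:
  "g \<in> feats_closure X \<longleftrightarrow> g \<in> extensional (pts X) \<and>
     (\<forall>A e. finite A \<and> A \<subseteq> pts X \<and> 0 < e \<longrightarrow> (\<exists>f\<in>feats X. \<forall>x\<in>A. \<bar>f x - g x\<bar> < e))"
  (is "?L \<longleftrightarrow> ?R")
proof
  assume L: ?L
  have gE: "g \<in> extensional (pts X)"
    using L closure_of_subset_topspace[of "product_topology (\<lambda>_. euclideanreal) (pts X)" "feats X"]
    by (auto simp: feats_closure_def PiE_def)
  moreover have "\<exists>f\<in>feats X. \<forall>x\<in>A. \<bar>f x - g x\<bar> < e"
    if A: "finite A" "A \<subseteq> pts X" "0 < e" for A and e :: real
  proof -
    let ?U = "\<Pi>\<^sub>E x\<in>pts X. if x \<in> A then ball (g x) e else UNIV"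
    have "openin (product_topology (\<lambda>_. euclideanreal) (pts X)) ?U"
      unfolding openin_PiE_gen
      using A by (auto intro: finite_subset[of _ A])
    moreover have "g \<in> ?U" using gE A by (auto simp: PiE_def)
    ultimately obtain f where f: "f \<in> feats X" "f \<in> ?U"
      using L unfolding feats_closure_def in_closure_of by blast
    have "\<bar>f x - g x\<bar> < e" if "x \<in> A" for x
      using f(2) that A by (auto simp: PiE_iff dist_real_def abs_minus_commute dest!: bspec[of _ _ x])
    then show ?thesis using f by blast
  qed
  ultimately show ?R by blast
next
  assume R: ?R
  show ?L
    unfolding feats_closure_def in_closure_of
  proof (intro conjI allI impI)
    show "g \<in> topspace (product_topology (\<lambda>_. euclideanreal) (pts X))"
      using R by (auto simp: PiE_def)
    fix T assume T: "g \<in> T \<and> openin (product_topology (\<lambda>_. euclideanreal) (pts X)) T"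
    then obtain U where U: "finite {i \<in> pts X. U i \<noteq> UNIV}" "\<And>i. i \<in> pts X \<Longrightarrow> open (U i)"
      "g \<in> Pi\<^sub>E (pts X) U" "Pi\<^sub>E (pts X) U \<subseteq> T"
      unfolding openin_product_topology_alt by force
    let ?A = "{i \<in> pts X. U i \<noteq> UNIV}"
    have "\<exists>e>0. ball (g i) e \<subseteq> U i" if "i \<in> pts X" for i
      using U(2)[OF that] U(3) that by (auto simp: open_contains_ball PiE_iff)
    then obtain e where e: "\<And>i. i \<in> pts X \<Longrightarrow> e i > 0 \<and> ball (g i) (e i) \<subseteq> U i"
      by metis
    \<comment> \<open>The inserted 1 keeps the minimum meaningful when no coordinate is
      restricted.\<close>
    define d where "d = Min (insert 1 (e ` ?A))"
    have d: "d > 0" unfolding d_def using U(1) e by auto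
    have de: "d \<le> e i" if "i \<in> ?A" for i
      unfolding d_def using U(1) that by (intro Min_le) auto
    obtain f where f: "f \<in> feats X" "\<forall>x\<in>?A. \<bar>f x - g x\<bar> < d"
      using R U(1) d by (metis (no_types, lifting) mem_Collect_eq subsetI)
    have "f i \<in> U i" if i: "i \<in> pts X" for i
    proof (cases "i \<in> ?A")
      case True
      then have "f i \<in> ball (g i) (e i)"
        using f(2) de[OF True] by (auto simp: dist_real_def abs_minus_commute)
      then show ?thesis using e i by blast
    qed (use i in auto)
    then have "f \<in> Pi\<^sub>E (pts X) U"
      using feats_extensional[OF f(1)] by (auto simp: PiE_def)
    then show "\<exists>y. y \<in> feats X \<and> y \<in> T" using f(1) U(4) by blast
  qed
qed

lemma feats_closure_extensional: "g \<in> feats_closure X \<Longrightarrow> g \<in> extensional (pts X)"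
  by (simp add: closure_approx)

lemma feats_closure_approx:
  assumes "g \<in> feats_closure X" "finite A" "A \<subseteq> pts X" "0 < e"
  obtains f where "f \<in> feats X" "\<And>x. x \<in> A \<Longrightarrow> \<bar>f x - g x\<bar> < e"
proof -
  have "\<exists>f\<in>feats X. \<forall>x\<in>A. \<bar>f x - g x\<bar> < e"
    using assms by (simp add: closure_approx)
  then obtain f where "f \<in> feats X" "\<forall>x\<in>A. \<bar>f x - g x\<bar> < e" ..
  then show ?thesis by (intro that) auto
qed

lemma feats_subset_closure: "f \<in> feats X \<Longrightarrow> f \<in> feats_closure X"
  unfolding closure_approx using feats_extensional by (auto intro!: bexI[of _ f])

lemma feats_closure_lipschitz:
  assumes "g \<in> feats_closure X" "x \<in> pts X" "y \<in> pts X"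
  shows "\<bar>g x - g y\<bar> \<le> gds_dist X x y"
proof (rule field_le_epsilon)
  fix e :: real assume "0 < e"
  then obtain f where f: "f \<in> feats X" "\<And>z. z \<in> {x, y} \<Longrightarrow> \<bar>f z - g z\<bar> < e / 2"
    using feats_closure_approx[OF assms(1), of "{x, y}" "e / 2"] assms by auto
  show "\<bar>g x - g y\<bar> \<le> gds_dist X x y + e"
    using f(2)[of x] f(2)[of y] feats_lipschitz[OF f(1) assms(2,3)] by (simp add: abs_real_def split: if_splits)
qed

end

text \<open>Separability gives the nontrivial inclusion: the products of balls with radius
  \<open>1 / Suc k\<close> around dense sequences form a countable base, so an open set is a
  countable union of measurable rectangles. This reconciles the Borel algebra in
  \<open>couplings\<close> with the product algebra on which joint laws are built.\<close>

lemma sets_borel_of_prod: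
  fixes X :: "'a gds_data" and Y :: "'b gds_data"
  assumes "geometric_data_set X" "geometric_data_set Y"
  shows "sets (borel_of (prod_topology (gds_topology X) (gds_topology Y))) = sets (msr X \<Otimes>\<^sub>M msr Y)"
proof -
  interpret X: gds X using assms by unfold_locales
  interpret Y: gds Y using assms by unfold_locales
  let ?T = "prod_topology (gds_topology X) (gds_topology Y)"
  show ?thesis
  proof (rule antisym)
    obtain u :: "nat \<Rightarrow> 'a" where u: "range u \<subseteq> pts X" "\<And>x e. x \<in> pts X \<Longrightarrow> 0 < e \<Longrightarrow> \<exists>n. gds_dist X x (u n) < e"
      using X.dense_seq by blast
    obtain v :: "nat \<Rightarrow> 'b" where v: "range v \<subseteq> pts Y" "\<And>x e. x \<in> pts Y \<Longrightarrow> 0 < e \<Longrightarrow> \<exists>n. gds_dist Y x (v n) < e"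
      using Y.dense_seq by blast
    define R where "R = (\<lambda>(m, n, k). X.met.mball (u m) (1 / Suc k) \<times> Y.met.mball (v n) (1 / Suc k))"
    have R: "R i \<in> sets (msr X \<Otimes>\<^sub>M msr Y)" for i
      unfolding R_def by (cases i) auto
    have "U \<in> sets (msr X \<Otimes>\<^sub>M msr Y)" if U: "openin ?T U" for U
    proof -
      have "\<exists>i. z \<in> R i \<and> R i \<subseteq> U" if z: "z \<in> U" for z
      proof -
        obtain x y where xy: "z = (x, y)" by (cases z)
        obtain A B where AB: "openin (gds_topology X) A" "openin (gds_topology Y) B" "x \<in> A" "y \<in> B"
            "A \<times> B \<subseteq> U"
          using U z unfolding openin_prod_topology_alt xy by meson
        obtain a where a: "a > 0" "X.met.mball x a \<subseteq> A"
          using AB X.met.openin_mtopology unfolding X.topology_eq by meson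
        obtain b where b: "b > 0" "Y.met.mball y b \<subseteq> B"
          using AB Y.met.openin_mtopology unfolding Y.topology_eq by meson
        have x: "x \<in> pts X" using AB openin_subset X.topspace_eq by blast
        have y: "y \<in> pts Y" using AB openin_subset Y.topspace_eq by blast
        obtain k where k: "1 / Suc k < min a b / 2"
          using a b nat_approx_posE[of "min a b / 2"] by auto
        obtain m where m: "gds_dist X x (u m) < 1 / Suc k" using u(2)[OF x] by fastforce
        obtain n where n: "gds_dist Y y (v n) < 1 / Suc k" using v(2)[OF y] by fastforce
        have um: "u m \<in> pts X" and vn: "v n \<in> pts Y" using u v by auto
        have 1: "X.met.mball (u m) (1 / Suc k) \<subseteq> A"
        proof
          fix x' assume x': "x' \<in> X.met.mball (u m) (1 / Suc k)"
          then have "gds_dist X x x' < a"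
            using X.met.triangle[of x "u m" x'] x um m k by auto
          then show "x' \<in> A" using a x x' by auto
        qed
        have 2: "Y.met.mball (v n) (1 / Suc k) \<subseteq> B"
        proof
          fix x' assume x': "x' \<in> Y.met.mball (v n) (1 / Suc k)"
          then have "gds_dist Y y x' < b"
            using Y.met.triangle[of y "v n" x'] y vn n k by auto
          then show "x' \<in> B" using b y x' by auto
        qed
        have "z \<in> R (m, n, k)"
          using m n x y um vn by (auto simp: R_def xy X.met.commute Y.met.commute)
        moreover have "R (m, n, k) \<subseteq> U" using 1 2 AB by (auto simp: R_def)
        ultimately show ?thesis by blast
      qed
      then have "U = (\<Union>i\<in>{i. R i \<subseteq> U}. R i)" by blast
      moreover have "(\<Union>i\<in>{i. R i \<subseteq> U}. R i) \<in> sets (msr X \<Otimes>\<^sub>M msr Y)"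
        by (rule sets.countable_UN') (auto simp: R)
      ultimately show ?thesis by simp
    qed
    then have "Collect (openin ?T) \<subseteq> sets (msr X \<Otimes>\<^sub>M msr Y)" by blast
    moreover have "topspace ?T = space (msr X \<Otimes>\<^sub>M msr Y)"
      by (simp add: X.space_msr Y.space_msr space_pair_measure X.topspace_eq Y.topspace_eq)
    ultimately show "sets (borel_of ?T) \<subseteq> sets (msr X \<Otimes>\<^sub>M msr Y)"
      unfolding sets_borel_of by (simp add: sets.sigma_sets_subset)
  next
    have [measurable]: "fst \<in> borel_of ?T \<rightarrow>\<^sub>M msr X" "snd \<in> borel_of ?T \<rightarrow>\<^sub>M msr Y"
      using continuous_map_measurable_borel_of[OF continuous_map_fst]
        continuous_map_measurable_borel_of[OF continuous_map_snd]
      by (auto simp: measurable_cong_sets[OF refl X.sets_msr] measurable_cong_sets[OF refl Y.sets_msr])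
    have "(\<lambda>z. (fst z, snd z)) \<in> borel_of ?T \<rightarrow>\<^sub>M (msr X \<Otimes>\<^sub>M msr Y)"
      by measurable
    moreover have "space (borel_of ?T) = space (msr X \<Otimes>\<^sub>M msr Y)"
      by (simp add: space_borel_of space_pair_measure X.space_msr Y.space_msr X.topspace_eq Y.topspace_eq)
    ultimately show "sets (msr X \<Otimes>\<^sub>M msr Y) \<subseteq> sets (borel_of ?T)"
      using sets.sets_into_space by (fastforce simp: measurable_def Int_absorb2)
  qed
qed

section \<open>The box distance is a metric up to isomorphism\<close>

text \<open>The infimum before its conversion to a real number, where the lattice rules of
  \<open>ennreal\<close> apply.\<close>

definition box_inf :: "'a gds_data \<Rightarrow> 'b gds_data \<Rightarrow> ennreal" where
  "box_inf X Y = (INF (\<pi>, S) \<in> couplings X Y \<times>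
         {S. closedin (prod_topology (gds_topology X) (gds_topology Y)) S}.
       max (1 - emeasure \<pi> S)
           (2 * hausdorff_of (dist_sup_on S) ((\<lambda>f. f \<circ> fst) ` feats X) ((\<lambda>g. g \<circ> snd) ` feats Y)))"

lemma box_dist_eq: "box_dist X Y = enn2real (box_inf X Y)"
  by (simp add: box_dist_def box_inf_def)

text \<open>Couplings may be given by random variables on any probability space. The coupling is
  then their joint law, and the closed set is the closure of the image of \<open>E\<close>; the
  image itself need not be measurable. Passing to the closure is free, because features are
  continuous and the bound on their difference is a closed condition.\<close>

lemma box_infI:
  fixes X :: "'a gds_data" and Y :: "'b gds_data" and \<Omega> :: "'c measure"
  assumes X: "geometric_data_set X" and Y: "geometric_data_set Y" and \<Omega>: "prob_space \<Omega>"
    and \<phi>: "\<phi> \<in> \<Omega> \<rightarrow>\<^sub>M msr X" "distr \<Omega> (msr X) \<phi> = msr X"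
    and \<psi>: "\<psi> \<in> \<Omega> \<rightarrow>\<^sub>M msr Y" "distr \<Omega> (msr Y) \<psi> = msr Y"
    and E: "E \<in> sets \<Omega>" "measure \<Omega> E \<ge> 1 - e" and e: "0 \<le> e"
    and fg: "\<And>f. f \<in> feats X \<Longrightarrow> \<exists>g\<in>feats Y. \<forall>\<omega>\<in>E. \<bar>f (\<phi> \<omega>) - g (\<psi> \<omega>)\<bar> \<le> e / 2"
    and gf: "\<And>g. g \<in> feats Y \<Longrightarrow> \<exists>f\<in>feats X. \<forall>\<omega>\<in>E. \<bar>f (\<phi> \<omega>) - g (\<psi> \<omega>)\<bar> \<le> e / 2"
  shows "box_inf X Y \<le> ennreal e"
proof -
  interpret X: gds X using X by unfold_locales
  interpret Y: gds Y using Y by unfold_locales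
  interpret \<Omega>: prob_space \<Omega> by fact
  let ?T = "prod_topology (gds_topology X) (gds_topology Y)"
  define h where "h = (\<lambda>\<omega>. (\<phi> \<omega>, \<psi> \<omega>))"
  define \<pi> where "\<pi> = distr \<Omega> (borel_of ?T) h"
  define S where "S = ?T closure_of (h ` E)"
  have h[measurable]: "h \<in> \<Omega> \<rightarrow>\<^sub>M borel_of ?T"
    unfolding h_def measurable_cong_sets[OF refl sets_borel_of_prod[OF X Y]]
    using \<phi>(1) \<psi>(1) by measurable
  have hT: "h ` E \<subseteq> topspace ?T"
  proof (rule image_subsetI)
    fix \<omega> assume "\<omega> \<in> E"
    then have "h \<omega> \<in> space (borel_of ?T)"
      using sets.sets_into_space[OF E(1)] measurable_space[OF h] by blast
    then show "h \<omega> \<in> topspace ?T" by (simp only: space_borel_of)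
  qed
  have fst: "fst \<in> borel_of ?T \<rightarrow>\<^sub>M msr X" and snd: "snd \<in> borel_of ?T \<rightarrow>\<^sub>M msr Y"
    using continuous_map_measurable_borel_of[OF continuous_map_fst]
      continuous_map_measurable_borel_of[OF continuous_map_snd]
    by (auto simp: measurable_cong_sets[OF refl X.sets_msr] measurable_cong_sets[OF refl Y.sets_msr])
  have "\<pi> \<in> couplings X Y"
    unfolding couplings_def \<pi>_def
    using \<Omega>.prob_space_distr[OF h] \<phi>(2) \<psi>(2)
    by (simp add: distr_distr[OF fst h] distr_distr[OF snd h]) (simp add: h_def comp_def)
  moreover have clS: "closedin ?T S" by (simp add: S_def)
  moreover have "1 - emeasure \<pi> S \<le> ennreal e"
  proof -
    have S: "S \<in> sets (borel_of ?T)"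
    proof -
      have "topspace ?T - S \<in> sets (borel_of ?T)"
        using clS by (auto simp: sets_borel_of closedin_def)
      then have "space (borel_of ?T) - (topspace ?T - S) \<in> sets (borel_of ?T)" by blast
      moreover have "space (borel_of ?T) - (topspace ?T - S) = S"
        using closedin_subset[OF clS] by (auto simp: space_borel_of)
      ultimately show ?thesis by simp
    qed
    have "E \<subseteq> h -` S \<inter> space \<Omega>"
      using closure_of_subset[OF hT] sets.sets_into_space[OF E(1)] by (auto simp: S_def)
    then have "emeasure \<Omega> E \<le> emeasure \<Omega> (h -` S \<inter> space \<Omega>)"
      using measurable_sets[OF h S] by (rule emeasure_mono)
    also have "\<dots> = emeasure \<pi> S"
      unfolding \<pi>_def by (rule emeasure_distr[symmetric, OF h S])
    finally have "ennreal (1 - e) \<le> emeasure \<pi> S"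
      using E(2) unfolding \<Omega>.emeasure_eq_measure by (meson ennreal_leI order_trans)
    then have "1 - emeasure \<pi> S \<le> 1 - ennreal (1 - e)"
      by (rule ennreal_minus_mono[OF order_refl])
    also have "\<dots> \<le> ennreal e"
      using e ennreal_1[symmetric] by (cases "e \<le> 1") (auto simp: ennreal_minus ennreal_neg simp flip: ennreal_1 intro!: ennreal_leI)
    finally show ?thesis .
  qed
  moreover have "2 * hausdorff_of (dist_sup_on S) ((\<lambda>f. f \<circ> fst) ` feats X) ((\<lambda>g. g \<circ> snd) ` feats Y)
      \<le> ennreal e"
  proof -
    have S: "dist_sup_on S (f \<circ> fst) (g \<circ> snd) \<le> ennreal (e / 2)"
      if f: "f \<in> feats X" and g: "g \<in> feats Y" and *: "\<forall>\<omega>\<in>E. \<bar>f (\<phi> \<omega>) - g (\<psi> \<omega>)\<bar> \<le> e / 2" for f g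
    proof -
      let ?C = "{z \<in> topspace ?T. \<bar>f (fst z) - g (snd z)\<bar> \<in> {..e / 2}}"
      have "continuous_map ?T euclideanreal (\<lambda>z. \<bar>f (fst z) - g (snd z)\<bar>)"
        using X.feats_continuous[OF f] Y.feats_continuous[OF g]
        by (intro continuous_map_real_abs continuous_map_diff)
           (auto intro: continuous_map_compose[OF continuous_map_fst, unfolded comp_def]
             continuous_map_compose[OF continuous_map_snd, unfolded comp_def])
      then have "closedin ?T ?C"
        by (rule closedin_continuous_map_preimage) simp
      moreover have "h ` E \<subseteq> ?C"
      proof (rule image_subsetI)
        fix \<omega> assume \<omega>: "\<omega> \<in> E"
        have "h \<omega> \<in> topspace ?T" using hT \<omega> by blast
        moreover have "\<bar>f (\<phi> \<omega>) - g (\<psi> \<omega>)\<bar> \<le> e / 2" using * \<omega> by blast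
        ultimately show "h \<omega> \<in> ?C" by (simp add: h_def)
      qed
      ultimately have "S \<subseteq> ?C" unfolding S_def by (rule closure_of_minimal[rotated])
      then show ?thesis
        unfolding dist_sup_on_def by (intro SUP_least ennreal_leI) auto
    qed
    have "hausdorff_of (dist_sup_on S) ((\<lambda>f. f \<circ> fst) ` feats X) ((\<lambda>g. g \<circ> snd) ` feats Y) \<le> ennreal (e / 2)"
      unfolding hausdorff_of_def image_image
    proof (intro max.boundedI SUP_least)
      fix f assume f: "f \<in> feats X"
      then obtain g where g: "g \<in> feats Y" "\<forall>\<omega>\<in>E. \<bar>f (\<phi> \<omega>) - g (\<psi> \<omega>)\<bar> \<le> e / 2"
        using fg by blast
      show "(INF g\<in>feats Y. dist_sup_on S (f \<circ> fst) (g \<circ> snd)) \<le> ennreal (e / 2)"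
        by (rule INF_lower2[OF g(1)]) (rule S[OF f g])
    next
      fix g assume g: "g \<in> feats Y"
      then obtain f where f: "f \<in> feats X" "\<forall>\<omega>\<in>E. \<bar>f (\<phi> \<omega>) - g (\<psi> \<omega>)\<bar> \<le> e / 2"
        using gf by blast
      show "(INF f\<in>feats X. dist_sup_on S (f \<circ> fst) (g \<circ> snd)) \<le> ennreal (e / 2)"
        by (rule INF_lower2[OF f(1)]) (rule S[OF f(1) g f(2)])
    qed
    then have "2 * hausdorff_of (dist_sup_on S) ((\<lambda>f. f \<circ> fst) ` feats X) ((\<lambda>g. g \<circ> snd) ` feats Y)
        \<le> 2 * ennreal (e / 2)"
      by (rule mult_left_mono) simp
    also have "\<dots> = ennreal e"
      using e by (simp add: ennreal_mult[symmetric] flip: ennreal_numeral)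
    finally show ?thesis .
  qed
  ultimately show ?thesis
    unfolding box_inf_def by (intro INF_lower2[of "(\<pi>, S)"]) auto
qed

lemma box_distI:
  fixes X :: "'a gds_data" and Y :: "'b gds_data" and \<Omega> :: "'c measure"
  assumes "geometric_data_set X" "geometric_data_set Y" "prob_space \<Omega>"
    "\<phi> \<in> \<Omega> \<rightarrow>\<^sub>M msr X" "distr \<Omega> (msr X) \<phi> = msr X"
    "\<psi> \<in> \<Omega> \<rightarrow>\<^sub>M msr Y" "distr \<Omega> (msr Y) \<psi> = msr Y"
    "E \<in> sets \<Omega>" "measure \<Omega> E \<ge> 1 - e" "0 \<le> e"
    "\<And>f. f \<in> feats X \<Longrightarrow> \<exists>g\<in>feats Y. \<forall>\<omega>\<in>E. \<bar>f (\<phi> \<omega>) - g (\<psi> \<omega>)\<bar> \<le> e / 2"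
    "\<And>g. g \<in> feats Y \<Longrightarrow> \<exists>f\<in>feats X. \<forall>\<omega>\<in>E. \<bar>f (\<phi> \<omega>) - g (\<psi> \<omega>)\<bar> \<le> e / 2"
  shows "box_dist X Y \<le> e"
  using enn2real_mono[OF box_infI[OF assms]] \<open>0 \<le> e\<close> by (simp add: box_dist_eq)

text \<open>The empty event satisfies every bound on features vacuously. The resulting finiteness
  links \<open>box_inf\<close> to its real value.\<close>

lemma box_inf_le_1:
  assumes X: "geometric_data_set X" and Y: "geometric_data_set Y"
  shows "box_inf X Y \<le> 1"
proof -
  interpret X: gds X using X by unfold_locales
  interpret Y: gds Y using Y by unfold_locales
  interpret P: pair_prob_space "msr X" "msr Y" by unfold_locales
  have "box_inf X Y \<le> ennreal 1"
    by (rule box_infI[where \<Omega> = "msr X \<Otimes>\<^sub>M msr Y" and \<phi> = fst and \<psi> = snd and E = "{}"])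
       (use X Y X.feats_nonempty Y.feats_nonempty distr_pair_marginals[OF X.pr.prob_space_axioms Y.pr.prob_space_axioms] in
         \<open>auto intro: P.prob_space_axioms\<close>)
  then show ?thesis by simp
qed

text \<open>What a box distance below \<open>e\<close> provides: strict inequalities turn the infima
  of the Hausdorff distance into actual partners of features. The set \<open>S\<close> is only
  required to be measurable, and \<open>e / 2\<close> reflects the factor 2 in the box
  distance.\<close>

definition box_coupling :: "'a gds_data \<Rightarrow> 'b gds_data \<Rightarrow> real \<Rightarrow> ('a \<times> 'b) measure \<Rightarrow> ('a \<times> 'b) set \<Rightarrow> bool"
  where "box_coupling X Y e \<pi> S \<longleftrightarrow> prob_space \<pi> \<and>
    fst \<in> \<pi> \<rightarrow>\<^sub>M msr X \<and> distr \<pi> (msr X) fst = msr X \<and>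
    snd \<in> \<pi> \<rightarrow>\<^sub>M msr Y \<and> distr \<pi> (msr Y) snd = msr Y \<and>
    S \<in> sets \<pi> \<and> S \<subseteq> pts X \<times> pts Y \<and> measure \<pi> S > 1 - e \<and>
    (\<forall>f\<in>feats X. \<exists>g\<in>feats Y. \<forall>z\<in>S. \<bar>f (fst z) - g (snd z)\<bar> \<le> e / 2) \<and>
    (\<forall>g\<in>feats Y. \<exists>f\<in>feats X. \<forall>z\<in>S. \<bar>f (fst z) - g (snd z)\<bar> \<le> e / 2)"

lemma ex_box_coupling:
  fixes X :: "'a gds_data" and Y :: "'b gds_data"
  assumes X: "geometric_data_set X" and Y: "geometric_data_set Y" and e: "box_dist X Y < e"
  shows "\<exists>\<pi> S. box_coupling X Y e \<pi> S"
proof -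
  interpret X: gds X using X by unfold_locales
  interpret Y: gds Y using Y by unfold_locales
  let ?T = "prod_topology (gds_topology X) (gds_topology Y)"
  have e0: "e > 0"
    using e enn2real_nonneg[of "box_inf X Y"] unfolding box_dist_eq by linarith
  \<comment> \<open>Since \<open>enn2real\<close> maps the top element to 0, the strict bound lifts
    back to \<open>ennreal\<close> only after finiteness is known.\<close>
  have "box_inf X Y < \<top>" using box_inf_le_1[OF X Y] by (rule order_le_less_trans) simp
  then have "box_inf X Y < ennreal e"
    using e unfolding box_dist_eq by (metis e0 ennreal_enn2real ennreal_less_iff enn2real_nonneg)
  then obtain \<pi> S where \<pi>: "\<pi> \<in> couplings X Y" and S: "closedin ?T S"
    and lt: "1 - emeasure \<pi> S < ennreal e"
      "2 * hausdorff_of (dist_sup_on S) ((\<lambda>f. f \<circ> fst) ` feats X) ((\<lambda>g. g \<circ> snd) ` feats Y) < ennreal e"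
    unfolding box_inf_def INF_less_iff by auto
  interpret \<pi>: prob_space \<pi> using \<pi> by (simp add: couplings_def)
  have sets: "sets \<pi> = sets (borel_of ?T)" using \<pi> by (simp add: couplings_def)
  have fst: "fst \<in> \<pi> \<rightarrow>\<^sub>M msr X" and snd: "snd \<in> \<pi> \<rightarrow>\<^sub>M msr Y"
    using continuous_map_measurable_borel_of[OF continuous_map_fst]
      continuous_map_measurable_borel_of[OF continuous_map_snd]
    by (auto simp: measurable_cong_sets[OF sets X.sets_msr] measurable_cong_sets[OF sets Y.sets_msr])
  have Ssub: "S \<subseteq> pts X \<times> pts Y"
    using closedin_subset[OF S] by (simp add: X.topspace_eq Y.topspace_eq)
  have Sm: "S \<in> sets \<pi>"
  proof -
    have "topspace ?T - S \<in> sets \<pi>"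
      using S by (auto simp: sets sets_borel_of closedin_def)
    then have "space \<pi> - (topspace ?T - S) \<in> sets \<pi>" by blast
    moreover have "space \<pi> - (topspace ?T - S) = S"
      using closedin_subset[OF S] sets_eq_imp_space_eq[OF sets] by (auto simp: space_borel_of)
    ultimately show ?thesis by simp
  qed
  have m: "measure \<pi> S > 1 - e"
  proof -
    have "ennreal (1 - measure \<pi> S) < ennreal e"
      using lt(1) by (simp add: \<pi>.emeasure_eq_measure ennreal_minus flip: ennreal_1)
    then show ?thesis by (simp add: ennreal_less_iff)
  qed
  have H: "hausdorff_of (dist_sup_on S) ((\<lambda>f. f \<circ> fst) ` feats X) ((\<lambda>g. g \<circ> snd) ` feats Y) < ennreal (e / 2)"
  proof (rule ccontr)
    assume "\<not> ?thesis"
    then have "2 * ennreal (e / 2) \<le> 2 * hausdorff_of (dist_sup_on S) ((\<lambda>f. f \<circ> fst) ` feats X) ((\<lambda>g. g \<circ> snd) ` feats Y)"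
      by (intro mult_left_mono) auto
    moreover have "2 * ennreal (e / 2) = ennreal e"
      using e0 by (simp add: ennreal_mult[symmetric] flip: ennreal_numeral)
    ultimately show False using lt(2) by simp
  qed
  have D: "\<forall>z\<in>S. \<bar>f (fst z) - g (snd z)\<bar> \<le> e / 2"
    if "dist_sup_on S (f \<circ> fst) (g \<circ> snd) < ennreal (e / 2)" for f :: "'a \<Rightarrow> real" and g :: "'b \<Rightarrow> real"
  proof
    fix z assume "z \<in> S"
    then have "ennreal \<bar>f (fst z) - g (snd z)\<bar> \<le> dist_sup_on S (f \<circ> fst) (g \<circ> snd)"
      unfolding dist_sup_on_def by (auto intro: SUP_upper2)
    then have "ennreal \<bar>f (fst z) - g (snd z)\<bar> < ennreal (e / 2)"
      using that by (rule order_le_less_trans)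
    then show "\<bar>f (fst z) - g (snd z)\<bar> \<le> e / 2"
      by (simp add: ennreal_less_iff)
  qed
  have 1: "\<exists>g\<in>feats Y. \<forall>z\<in>S. \<bar>f (fst z) - g (snd z)\<bar> \<le> e / 2" if f: "f \<in> feats X" for f
  proof -
    have "(INF g\<in>feats Y. dist_sup_on S (f \<circ> fst) (g \<circ> snd))
        \<le> (SUP f\<in>feats X. INF g\<in>feats Y. dist_sup_on S (f \<circ> fst) (g \<circ> snd))"
      using f by (rule SUP_upper)
    also have "\<dots> < ennreal (e / 2)" using H by (simp add: hausdorff_of_def image_image)
    finally show ?thesis unfolding INF_less_iff using D by blast
  qed
  have 2: "\<exists>f\<in>feats X. \<forall>z\<in>S. \<bar>f (fst z) - g (snd z)\<bar> \<le> e / 2" if g: "g \<in> feats Y" for g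
  proof -
    have "(INF f\<in>feats X. dist_sup_on S (f \<circ> fst) (g \<circ> snd))
        \<le> (SUP g\<in>feats Y. INF f\<in>feats X. dist_sup_on S (f \<circ> fst) (g \<circ> snd))"
      using g by (rule SUP_upper)
    also have "\<dots> < ennreal (e / 2)" using H by (simp add: hausdorff_of_def image_image)
    finally show ?thesis unfolding INF_less_iff using D by blast
  qed
  have "box_coupling X Y e \<pi> S"
    using \<pi> \<pi>.prob_space_axioms fst snd Sm Ssub m 1 2
    unfolding box_coupling_def couplings_def by blast
  then show ?thesis by blast
qed

lemma box_dist_nonneg: "0 \<le> box_dist X Y"
  by (simp add: box_dist_def)

lemma box_dist_refl:
  assumes X: "geometric_data_set X"
  shows "box_dist X X = 0"
proof -
  interpret X: gds X using X by unfold_locales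
  have "box_dist X X \<le> 0"
    by (rule box_distI[OF X X X.pr.prob_space_axioms, of id id "space (msr X)"])
       (auto simp: X.pr.prob_space distr_id id_def)
  then show ?thesis using box_dist_nonneg[of X X] by simp
qed

lemma box_dist_commute:
  assumes X: "geometric_data_set X" and Y: "geometric_data_set Y"
  shows "box_dist X Y = box_dist Y X"
proof -
  have "box_dist Y X \<le> box_dist X Y" if X: "geometric_data_set X" and Y: "geometric_data_set Y"
    for X :: "'c gds_data" and Y :: "'d gds_data"
  proof (rule dense_ge)
    fix e assume e: "box_dist X Y < e"
    then have "e \<ge> 0" using box_dist_nonneg[of X Y] by simp
    obtain \<pi> S where "box_coupling X Y e \<pi> S"
      using ex_box_coupling[OF X Y e] by blast
    note \<pi> = this[unfolded box_coupling_def]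
    show "box_dist Y X \<le> e"
      by (rule box_distI[OF Y X, of \<pi> snd fst S])
         (use \<pi> \<open>e \<ge> 0\<close> in \<open>auto simp: abs_minus_commute\<close>)
  qed
  from this[OF X Y] this[OF Y X] show ?thesis by simp
qed

lemma box_dist_triangle:
  fixes X :: "'a gds_data" and Y :: "'b gds_data" and Z :: "'c gds_data"
  assumes X: "geometric_data_set X" and Y: "geometric_data_set Y" and Z: "geometric_data_set Z"
  shows "box_dist X Z \<le> box_dist X Y + box_dist Y Z"
proof (rule field_le_epsilon)
  fix d :: real assume d: "0 < d"
  interpret X: gds X using X by unfold_locales
  interpret Y: gds Y using Y by unfold_locales
  interpret Z: gds Z using Z by unfold_locales
  \<comment> \<open>One third of the slack goes to each of the two couplings and one to the gluing.
    Cells of radius \<open>e / 4\<close> keep two points of a common cell within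
    \<open>e / 2\<close>, which the factor 2 in the box distance turns into
    \<open>e\<close>.\<close>
  define e where "e = d / 3"
  define a where "a = box_dist X Y + e"
  define b where "b = box_dist Y Z + e"
  have e: "e > 0" and ab: "box_dist X Y < a" "box_dist Y Z < b" "a \<ge> 0" "b \<ge> 0"
    using d box_dist_nonneg[of X Y] box_dist_nonneg[of Y Z] by (auto simp: e_def a_def b_def)
  obtain \<pi> S where "box_coupling X Y a \<pi> S"
    using ex_box_coupling[OF X Y ab(1)] by blast
  note \<pi> = this[unfolded box_coupling_def]
  obtain \<rho> T where "box_coupling Y Z b \<rho> T"
    using ex_box_coupling[OF Y Z ab(2)] by blast
  note \<rho> = this[unfolded box_coupling_def]
  obtain r :: "'b \<Rightarrow> nat" and w :: "nat \<Rightarrow> 'b" where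
    r: "r \<in> msr Y \<rightarrow>\<^sub>M count_space UNIV" and w: "range w \<subseteq> pts Y" and
    rw: "\<And>x. x \<in> pts Y \<Longrightarrow> gds_dist Y x (w (r x)) < e / 4"
    using Y.net_index[of "e / 4"] e by auto
  have m[measurable]: "fst \<in> \<pi> \<rightarrow>\<^sub>M msr X" "snd \<in> \<pi> \<rightarrow>\<^sub>M msr Y" "fst \<in> \<rho> \<rightarrow>\<^sub>M msr Y" "snd \<in> \<rho> \<rightarrow>\<^sub>M msr Z"
    "r \<in> msr Y \<rightarrow>\<^sub>M count_space UNIV"
    using \<pi> \<rho> r by auto
  have [measurable]: "S \<in> sets \<pi>" "T \<in> sets \<rho>" using \<pi> \<rho> by auto
  interpret \<pi>: prob_space \<pi> using \<pi> by blast
  interpret \<rho>: prob_space \<rho> using \<rho> by blast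
  have "distr \<pi> (count_space UNIV) (r \<circ> snd) = distr (distr \<pi> (msr Y) snd) (count_space UNIV) r"
    by (rule distr_distr[symmetric]) auto
  also have "\<dots> = distr (distr \<rho> (msr Y) fst) (count_space UNIV) r" using \<pi> \<rho> by simp
  also have "\<dots> = distr \<rho> (count_space UNIV) (r \<circ> fst)"
    by (rule distr_distr) auto
  finally have eq: "distr \<pi> (count_space UNIV) (r \<circ> snd) = distr \<rho> (count_space UNIV) (r \<circ> fst)" .
  have rs: "r \<circ> snd \<in> \<pi> \<rightarrow>\<^sub>M count_space UNIV" "r \<circ> fst \<in> \<rho> \<rightarrow>\<^sub>M count_space UNIV"
    by (rule measurable_comp[OF m(2) r] measurable_comp[OF m(3) r])+
  obtain \<Omega> where \<Omega>: "sets \<Omega> = sets (\<pi> \<Otimes>\<^sub>M \<rho>)" "prob_space \<Omega>" "distr \<Omega> \<pi> fst = \<pi>"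
    "distr \<Omega> \<rho> snd = \<rho>" "AE z in \<Omega>. (r \<circ> snd) (fst z) = (r \<circ> fst) (snd z)"
    using glue_index[OF \<pi>.prob_space_axioms \<rho>.prob_space_axioms rs eq] by blast
  interpret \<Omega>: prob_space \<Omega> by fact
  have [measurable]: "fst \<in> \<Omega> \<rightarrow>\<^sub>M \<pi>" "snd \<in> \<Omega> \<rightarrow>\<^sub>M \<rho>"
    by (simp_all add: measurable_cong_sets[OF \<Omega>(1) refl])
  define E where "E = {z \<in> space \<Omega>. fst z \<in> S \<and> snd z \<in> T \<and> r (snd (fst z)) = r (fst (snd z))}"
  have E[measurable]: "E \<in> sets \<Omega>" unfolding E_def by measurable
  have "measure \<Omega> E = measure \<Omega> ({z \<in> space \<Omega>. fst z \<in> S} \<inter> {z \<in> space \<Omega>. snd z \<in> T})"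
    unfolding E_def using \<Omega>(5) by (intro \<Omega>.finite_measure_eq_AE) auto
  also have "\<dots> \<ge> \<Omega>.prob {z \<in> space \<Omega>. fst z \<in> S} + \<Omega>.prob {z \<in> space \<Omega>. snd z \<in> T} - 1"
    by (rule \<Omega>.prob_Int_ge) auto
  also have "\<Omega>.prob {z \<in> space \<Omega>. fst z \<in> S} = measure (distr \<Omega> \<pi> fst) S"
    by (subst measure_distr) (auto intro!: arg_cong[where f = \<Omega>.prob])
  also have "\<Omega>.prob {z \<in> space \<Omega>. snd z \<in> T} = measure (distr \<Omega> \<rho> snd) T"
    by (subst measure_distr) (auto intro!: arg_cong[where f = \<Omega>.prob])
  finally have PE: "measure \<Omega> E \<ge> 1 - (a + b)"
    using \<pi> \<rho> \<Omega>(3,4) by simp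
  have close: "\<bar>g (snd (fst z)) - g (fst (snd z))\<bar> \<le> e / 2" if z: "z \<in> E" and g: "g \<in> feats Y" for z g
  proof -
    have y: "snd (fst z) \<in> pts Y" "fst (snd z) \<in> pts Y"
      using z \<pi> \<rho> by (auto simp: E_def)
    have wY: "w (r (snd (fst z))) \<in> pts Y" using w by auto
    then have "gds_dist Y (snd (fst z)) (fst (snd z)) \<le> e / 4 + e / 4"
      using Y.met.triangle[OF y(1) wY y(2)] rw[OF y(1)] rw[OF y(2)] z
      by (simp add: E_def Y.met.commute[of _ "fst (snd z)"])
    then show ?thesis using Y.feats_lipschitz[OF g y] by simp
  qed
  have "box_dist X Z \<le> a + b + e"
  proof (rule box_distI[OF X Z \<Omega>(2), of "fst \<circ> fst" "snd \<circ> snd" E])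
    show "fst \<circ> fst \<in> \<Omega> \<rightarrow>\<^sub>M msr X" "snd \<circ> snd \<in> \<Omega> \<rightarrow>\<^sub>M msr Z" by auto
    show "distr \<Omega> (msr X) (fst \<circ> fst) = msr X"
      using distr_distr[of fst \<pi> "msr X" fst \<Omega>] \<pi> \<Omega> by simp
    show "distr \<Omega> (msr Z) (snd \<circ> snd) = msr Z"
      using distr_distr[of snd \<rho> "msr Z" snd \<Omega>] \<rho> \<Omega> by simp
    show "E \<in> sets \<Omega>" "1 - (a + b + e) \<le> measure \<Omega> E" "0 \<le> a + b + e"
      using PE e ab by auto
  next
    fix f assume "f \<in> feats X"
    then obtain g where g: "g \<in> feats Y" "\<forall>z\<in>S. \<bar>f (fst z) - g (snd z)\<bar> \<le> a / 2" using \<pi> by blast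
    then obtain h where h: "h \<in> feats Z" "\<forall>z\<in>T. \<bar>g (fst z) - h (snd z)\<bar> \<le> b / 2" using \<rho> by blast
    have "\<bar>f (fst (fst z)) - h (snd (snd z))\<bar> \<le> (a + b + e) / 2" if z: "z \<in> E" for z
    proof -
      have "\<bar>f (fst (fst z)) - g (snd (fst z))\<bar> \<le> a / 2" "\<bar>g (fst (snd z)) - h (snd (snd z))\<bar> \<le> b / 2"
        using z g h by (auto simp: E_def)
      then show ?thesis using close[OF z g(1)] by argo
    qed
    then show "\<exists>h\<in>feats Z. \<forall>z\<in>E. \<bar>f ((fst \<circ> fst) z) - h ((snd \<circ> snd) z)\<bar> \<le> (a + b + e) / 2"
      unfolding comp_def using h(1) by blast
  next
    fix h assume "h \<in> feats Z"
    then obtain g where h: "g \<in> feats Y" "\<forall>z\<in>T. \<bar>g (fst z) - h (snd z)\<bar> \<le> b / 2" using \<rho> by blast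
    then obtain f where g: "f \<in> feats X" "\<forall>z\<in>S. \<bar>f (fst z) - g (snd z)\<bar> \<le> a / 2" using \<pi> by blast
    have "\<bar>f (fst (fst z)) - h (snd (snd z))\<bar> \<le> (a + b + e) / 2" if z: "z \<in> E" for z
    proof -
      have "\<bar>f (fst (fst z)) - g (snd (fst z))\<bar> \<le> a / 2" "\<bar>g (fst (snd z)) - h (snd (snd z))\<bar> \<le> b / 2"
        using z g h by (auto simp: E_def)
      then show ?thesis using close[OF z h(1)] by argo
    qed
    then show "\<exists>f\<in>feats X. \<forall>z\<in>E. \<bar>f ((fst \<circ> fst) z) - h ((snd \<circ> snd) z)\<bar> \<le> (a + b + e) / 2"
      unfolding comp_def using g(1) by blast
  qed
  also have "a + b + e = box_dist X Y + box_dist Y Z + d" by (simp add: a_def b_def e_def)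
  finally show "box_dist X Z \<le> box_dist X Y + box_dist Y Z + d" .
qed

text \<open>Pointwise approximation of a feature in the closure is uniform on a set with a finite net,
  and such sets carry almost all of the mass.\<close>

lemma gds_iso_imp_box_dist_0:
  fixes X :: "'a gds_data" and Y :: "'b gds_data"
  assumes X: "geometric_data_set X" and Y: "geometric_data_set Y" and iso: "gds_iso X Y"
  shows "box_dist X Y = 0"
proof -
  interpret X: gds X using X by unfold_locales
  interpret Y: gds Y using Y by unfold_locales
  obtain \<phi> where \<phi>[measurable]: "\<phi> \<in> msr X \<rightarrow>\<^sub>M msr Y" and d\<phi>: "distr (msr X) (msr Y) \<phi> = msr Y"
    and cl: "(\<lambda>g. compose (pts X) g \<phi>) ` feats_closure Y = feats_closure X"
    using iso unfolding gds_iso_def by blast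
  have \<phi>Y: "\<phi> x \<in> pts Y" if "x \<in> pts X" for x
    using measurable_space[OF \<phi>] that by (simp add: X.space_msr Y.space_msr)
  have "box_dist X Y \<le> 0 + d" if d: "0 < d" for d
  proof -
    \<comment> \<open>Three errors below \<open>e\<close> have to stay within
      \<open>d / 2\<close>.\<close>
    define e where "e = d / 6"
    have e: "e > 0" using d by (simp add: e_def)
    obtain r :: "'a \<Rightarrow> nat" and w :: "nat \<Rightarrow> 'a" where
      r[measurable]: "r \<in> msr X \<rightarrow>\<^sub>M count_space UNIV" and w: "range w \<subseteq> pts X" and
      rw: "\<And>x. x \<in> pts X \<Longrightarrow> gds_dist X x (w (r x)) < e"
      using X.net_index[OF e] by auto
    obtain s :: "'b \<Rightarrow> nat" and v :: "nat \<Rightarrow> 'b" where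
      s[measurable]: "s \<in> msr Y \<rightarrow>\<^sub>M count_space UNIV" and v: "range v \<subseteq> pts Y" and
      sv: "\<And>x. x \<in> pts Y \<Longrightarrow> gds_dist Y x (v (s x)) < e"
      using Y.net_index[OF e] by auto
    \<comment> \<open>One tail bound for the maximum controls the net of \<open>X\<close> and the
      pulled back net of \<open>Y\<close>, so on \<open>E\<close> finitely many centres serve for
      both directions.\<close>
    define t where "t = (\<lambda>x. max (r x) (s (\<phi> x)))"
    have t[measurable]: "t \<in> msr X \<rightarrow>\<^sub>M count_space UNIV"
      unfolding t_def
      by (rule measurable_compose_countable[where f = "\<lambda>i x. max i (s (\<phi> x))" and g = r]) measurable
    obtain k where k: "X.pr.prob {x \<in> space (msr X). t x < k} > 1 - e"
      using X.pr.index_tail[OF t e] by auto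
    define E where "E = {x \<in> space (msr X). t x < k}"
    have "box_dist X Y \<le> d"
    proof (rule box_distI[OF X Y X.pr.prob_space_axioms, of id \<phi> E])
      show "E \<in> sets (msr X)" unfolding E_def by measurable
      show "1 - d \<le> measure (msr X) E" "0 \<le> d"
        using k e by (auto simp: E_def e_def)
    next
      fix f assume f: "f \<in> feats X"
      then have "f \<in> feats_closure X" by (rule X.feats_subset_closure)
      then obtain g where g: "g \<in> feats_closure Y" "f = compose (pts X) g \<phi>" using cl by blast
      obtain g' where g': "g' \<in> feats Y" "\<And>y. y \<in> v ` {..<k} \<Longrightarrow> \<bar>g' y - g y\<bar> < e"
        using Y.feats_closure_approx[OF g(1), of "v ` {..<k}" e] v e by blast
      have "\<bar>f x - g' (\<phi> x)\<bar> \<le> d / 2" if x: "x \<in> E" for x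
      proof -
        have xX: "x \<in> pts X" using x by (simp add: E_def X.space_msr)
        let ?v = "v (s (\<phi> x))"
        have vY: "?v \<in> pts Y" using v by auto
        have "\<bar>g' ?v - g ?v\<bar> < e" using x g'(2) by (simp add: E_def t_def)
        moreover have "\<bar>g (\<phi> x) - g ?v\<bar> < e"
          using Y.feats_closure_lipschitz[OF g(1) \<phi>Y[OF xX] vY] sv[OF \<phi>Y[OF xX]] by linarith
        moreover have "\<bar>g' (\<phi> x) - g' ?v\<bar> < e"
          using Y.feats_lipschitz[OF g'(1) \<phi>Y[OF xX] vY] sv[OF \<phi>Y[OF xX]] by linarith
        ultimately show ?thesis
          using xX by (simp add: g(2) compose_def e_def abs_real_def split: if_splits)
      qed
      then show "\<exists>g\<in>feats Y. \<forall>x\<in>E. \<bar>f (id x) - g (\<phi> x)\<bar> \<le> d / 2" using g'(1) by auto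
    next
      fix g assume g: "g \<in> feats Y"
      then have "g \<in> feats_closure Y" by (rule Y.feats_subset_closure)
      then have f: "compose (pts X) g \<phi> \<in> feats_closure X" using cl by blast
      obtain f' where f': "f' \<in> feats X" "\<And>y. y \<in> w ` {..<k} \<Longrightarrow> \<bar>f' y - compose (pts X) g \<phi> y\<bar> < e"
        using X.feats_closure_approx[OF f, of "w ` {..<k}" e] w e by blast
      have "\<bar>f' x - g (\<phi> x)\<bar> \<le> d / 2" if x: "x \<in> E" for x
      proof -
        have xX: "x \<in> pts X" using x by (simp add: E_def X.space_msr)
        let ?w = "w (r x)"
        have wX: "?w \<in> pts X" using w by auto
        have "\<bar>f' ?w - compose (pts X) g \<phi> ?w\<bar> < e" using x f'(2) by (simp add: E_def t_def)
        moreover have "\<bar>compose (pts X) g \<phi> x - compose (pts X) g \<phi> ?w\<bar> < e"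
          using X.feats_closure_lipschitz[OF f xX wX] rw[OF xX] by linarith
        moreover have "\<bar>f' x - f' ?w\<bar> < e"
          using X.feats_lipschitz[OF f'(1) xX wX] rw[OF xX] by linarith
        ultimately show ?thesis
          using xX wX by (simp add: compose_def e_def abs_real_def split: if_splits)
      qed
      then show "\<exists>f\<in>feats X. \<forall>x\<in>E. \<bar>f (id x) - g (\<phi> x)\<bar> \<le> d / 2" using f'(1) by auto
    qed (auto simp: d\<phi> distr_id id_def)
    then show ?thesis by simp
  qed
  then have "box_dist X Y \<le> 0" by (rule field_le_epsilon)
  then show ?thesis using box_dist_nonneg[of X Y] by simp
qed

section \<open>From vanishing box distance to an isomorphism\<close>

lemma box_coupling_mono:
  assumes "box_coupling X Y e \<pi> S" "e \<le> e'"
  shows "box_coupling X Y e' \<pi> S"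
proof -
  have "e / 2 \<le> e' / 2" using assms(2) by simp
  then show ?thesis
    using assms unfolding box_coupling_def
    by (meson diff_left_mono order_le_less_trans order_trans)
qed

text \<open>Matched features differ by at most \<open>e / 2\<close> at each of the two pairs, and
  the metric is the supremum over the features.\<close>

lemma box_coupling_dist:
  assumes X: "geometric_data_set X" and Y: "geometric_data_set Y" and \<pi>: "box_coupling X Y e \<pi> S"
    and z: "z \<in> S" "z' \<in> S"
  shows "\<bar>gds_dist X (fst z) (fst z') - gds_dist Y (snd z) (snd z')\<bar> \<le> e"
proof -
  interpret X: gds X using X by unfold_locales
  interpret Y: gds Y using Y by unfold_locales
  have S: "S \<subseteq> pts X \<times> pts Y" and
    fg: "\<And>f. f \<in> feats X \<Longrightarrow> \<exists>g\<in>feats Y. \<forall>z\<in>S. \<bar>f (fst z) - g (snd z)\<bar> \<le> e / 2" and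
    gf: "\<And>g. g \<in> feats Y \<Longrightarrow> \<exists>f\<in>feats X. \<forall>z\<in>S. \<bar>f (fst z) - g (snd z)\<bar> \<le> e / 2"
    using \<pi> by (auto simp: box_coupling_def)
  have p: "fst z \<in> pts X" "fst z' \<in> pts X" "snd z \<in> pts Y" "snd z' \<in> pts Y"
    using S z by auto
  have "gds_dist X (fst z) (fst z') \<le> gds_dist Y (snd z) (snd z') + e"
  proof (rule X.gds_dist_least[OF p(1,2)])
    fix f assume "f \<in> feats X"
    then obtain g where g: "g \<in> feats Y" "\<forall>z\<in>S. \<bar>f (fst z) - g (snd z)\<bar> \<le> e / 2" using fg by blast
    have "\<bar>f (fst z) - g (snd z)\<bar> \<le> e / 2" "\<bar>f (fst z') - g (snd z')\<bar> \<le> e / 2" using g z by auto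
    then show "\<bar>f (fst z) - f (fst z')\<bar> \<le> gds_dist Y (snd z) (snd z') + e"
      using Y.feats_lipschitz[OF g(1) p(3,4)] by argo
  qed
  moreover have "gds_dist Y (snd z) (snd z') \<le> gds_dist X (fst z) (fst z') + e"
  proof (rule Y.gds_dist_least[OF p(3,4)])
    fix g assume "g \<in> feats Y"
    then obtain f where f: "f \<in> feats X" "\<forall>z\<in>S. \<bar>f (fst z) - g (snd z)\<bar> \<le> e / 2" using gf by blast
    have "\<bar>f (fst z) - g (snd z)\<bar> \<le> e / 2" "\<bar>f (fst z') - g (snd z')\<bar> \<le> e / 2" using f z by auto
    then show "\<bar>g (snd z) - g (snd z')\<bar> \<le> gds_dist X (fst z) (fst z') + e"
      using X.feats_lipschitz[OF f(1) p(1,2)] by argo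
  qed
  ultimately show ?thesis by linarith
qed

text \<open>The coupling carries \<open>A\<close> into \<open>B\<close> except outside
  \<open>S\<close>, and that part has mass below \<open>e\<close>. With \<open>B\<close> empty it
  shows that \<open>S\<close> meets every set of mass at least \<open>e\<close>.\<close>

lemma box_coupling_measure:
  assumes \<pi>: "box_coupling X Y e \<pi> S"
    and A: "A \<in> sets (msr X)" and B: "B \<in> sets (msr Y)"
    and AB: "\<And>z. z \<in> S \<Longrightarrow> fst z \<in> A \<Longrightarrow> snd z \<in> B"
  shows "measure (msr X) A - e \<le> measure (msr Y) B"
proof -
  note \<pi>' = \<pi>[unfolded box_coupling_def]
  interpret \<pi>: prob_space \<pi> using \<pi>' by blast
  have [measurable]: "fst \<in> \<pi> \<rightarrow>\<^sub>M msr X" "snd \<in> \<pi> \<rightarrow>\<^sub>M msr Y" "S \<in> sets \<pi>" "A \<in> sets (msr X)" "B \<in> sets (msr Y)"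
    using \<pi>' A B by auto
  have "measure (msr X) A = measure (distr \<pi> (msr X) fst) A" using \<pi>' by simp
  also have "\<dots> = measure \<pi> (fst -` A \<inter> space \<pi>)" by (rule measure_distr) auto
  finally have "measure (msr X) A + (1 - e) - 1 \<le> \<pi>.prob (fst -` A \<inter> space \<pi>) + \<pi>.prob S - 1"
    using \<pi>' by simp
  also have "\<dots> \<le> \<pi>.prob ((fst -` A \<inter> space \<pi>) \<inter> S)"
    by (rule \<pi>.prob_Int_ge) auto
  also have "\<dots> \<le> \<pi>.prob (snd -` B \<inter> space \<pi>)"
    by (rule \<pi>.finite_measure_mono) (use AB in auto)
  also have "\<dots> = measure (distr \<pi> (msr Y) snd) B" by (rule measure_distr[symmetric]) auto
  also have "\<dots> = measure (msr Y) B" using \<pi>' by simp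
  finally show ?thesis by simp
qed

text \<open>The points matched to neighbours of a fixed point have neighbourhoods of mass bounded below,
  hence form a totally bounded set; Tychonoff's theorem then yields a cluster point of the matchings.\<close>

lemma box_dist_0_matching:
  fixes X :: "'a gds_data" and Y :: "'b gds_data"
  assumes X: "geometric_data_set X" and Y: "geometric_data_set Y" and 0: "box_dist X Y = 0"
  shows "\<exists>\<phi>\<in>pts X \<rightarrow> pts Y. \<forall>A r. finite A \<and> A \<subseteq> pts X \<and> 0 < r \<longrightarrow>
    (\<exists>\<pi> S. box_coupling X Y r \<pi> S \<and>
      (\<forall>x\<in>A. \<exists>z\<in>S. gds_dist X x (fst z) < r \<and> gds_dist Y (snd z) (\<phi> x) < r))"
proof -
  interpret X: gds X using X by unfold_locales
  interpret Y: gds Y using Y by unfold_locales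
  define e :: "nat \<Rightarrow> real" where "e n = 1 / real (Suc n)" for n
  have e: "e n > 0" for n by (simp add: e_def)
  have e_small: "\<forall>\<^sub>F n in sequentially. e n < r" if "r > 0" for r
    unfolding e_def using order_tendstoD(2)[OF lim_1_over_n that]
    using LIMSEQ_inverse_real_of_nat that by (auto dest: order_tendstoD(2) simp: inverse_eq_divide)
  have "\<exists>\<pi> S. box_coupling X Y (e n) \<pi> S" for n
    by (rule ex_box_coupling[OF X Y]) (simp add: 0 e)
  then obtain \<pi> S where \<pi>: "\<And>n. box_coupling X Y (e n) (\<pi> n) (S n)" by metis
  have Ssub: "S n \<subseteq> pts X \<times> pts Y" for n
    using \<pi>[of n] by (simp add: box_coupling_def)
  have Sne: "S n \<noteq> {}" for n
  proof
    assume "S n = {}"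
    then have "0 > 1 - e n" using \<pi>[of n] by (simp add: box_coupling_def)
    then show False by (simp add: e_def)
  qed
  \<comment> \<open>An almost nearest matched pair to \<open>x\<close>; the slack \<open>e n\<close>
    is there because the infimum need not be attained.\<close>
  have "\<exists>z\<in>S n. \<forall>z'\<in>S n. gds_dist X x (fst z) \<le> gds_dist X x (fst z') + e n" for n x
  proof -
    let ?D = "(\<lambda>z. gds_dist X x (fst z)) ` S n"
    have "Inf ?D < Inf ?D + e n" using e[of n] by simp
    then obtain t where t: "t \<in> ?D" "t < Inf ?D + e n"
      using cInf_lessD[of ?D] Sne[of n] by blast
    have bdd: "bdd_below ?D" by (intro bdd_belowI[of _ 0]) auto
    obtain z where z: "z \<in> S n" "t = gds_dist X x (fst z)" using t by blast
    have "gds_dist X x (fst z) \<le> gds_dist X x (fst z') + e n" if "z' \<in> S n" for z'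
      using cInf_lower[OF _ bdd, of "gds_dist X x (fst z')"] that t z by auto
    then show ?thesis using z by blast
  qed
  then obtain Z where ZS: "\<And>n x. Z n x \<in> S n" and
    Zmin: "\<And>n x z'. z' \<in> S n \<Longrightarrow> gds_dist X x (fst (Z n x)) \<le> gds_dist X x (fst z') + e n"
    by metis
  have ZY: "snd (Z n x) \<in> pts Y" and ZX: "fst (Z n x) \<in> pts X" for n x
    using Ssub[of n] ZS[of n x] by auto
  \<comment> \<open>By full support every ball around \<open>x\<close> eventually has mass above
    \<open>e n\<close>, so it cannot be missed by \<open>S n\<close>.\<close>
  have close: "\<forall>\<^sub>F n in sequentially. gds_dist X x (fst (Z n x)) < r" if x: "x \<in> pts X" and r: "r > 0" for x r
  proof -
    let ?B = "X.met.mball x (r / 2)"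
    have c: "measure (msr X) ?B > 0"
      using x r by (intro X.measure_mball_pos) auto
    have "\<forall>\<^sub>F n in sequentially. e n < measure (msr X) ?B \<and> e n < r / 2"
      using e_small[OF c] e_small[of "r / 2"] r by (simp add: eventually_conj)
    then show ?thesis
    proof eventually_elim
      case (elim n)
      have "\<exists>z\<in>S n. fst z \<in> ?B"
      proof (rule ccontr)
        assume "\<not> ?thesis"
        then have "measure (msr X) ?B - e n \<le> measure (msr Y) {}"
          by (intro box_coupling_measure[OF \<pi>]) auto
        then show False using elim by simp
      qed
      then obtain z where "z \<in> S n" "gds_dist X x (fst z) < r / 2" by auto
      then show ?case using Zmin[of z n x] elim by linarith
    qed
  qed
  define K where "K x = Y.met.mtopology closure_of range (\<lambda>n. snd (Z n x))" for x
  have tb: "Y.met.mtotally_bounded (range (\<lambda>n. snd (Z n x)))" if x: "x \<in> pts X" for x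
    unfolding Y.met.mtotally_bounded_def
  proof (intro allI impI)
    fix r :: real assume r: "r > 0"
    \<comment> \<open>Any two points within \<open>4 * \<rho>\<close> of one centre are within
      \<open>r\<close>. The 4 consists of 2 for two points near \<open>x\<close>, 1 for the
      distortion of the coupling and 1 for the net.\<close>
    define \<rho> where "\<rho> = r / 8"
    have \<rho>: "\<rho> > 0" using r by (simp add: \<rho>_def)
    let ?B = "X.met.mball x \<rho>"
    define c where "c = measure (msr X) ?B"
    have c: "c > 0"
      unfolding c_def using x \<rho> by (rule X.measure_mball_pos)
    have "\<forall>\<^sub>F n in sequentially. e n < c / 2 \<and> e n < \<rho> \<and> gds_dist X x (fst (Z n x)) < \<rho>"
      using e_small[of "c / 2"] e_small[OF \<rho>] close[OF x \<rho>] c by (simp add: eventually_conj)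
    then obtain N where N: "\<And>n. n \<ge> N \<Longrightarrow> e n < c / 2 \<and> e n < \<rho> \<and> gds_dist X x (fst (Z n x)) < \<rho>"
      by (auto simp: eventually_sequentially)
    obtain s :: "'b \<Rightarrow> nat" and v :: "nat \<Rightarrow> 'b" where
      s[measurable]: "s \<in> msr Y \<rightarrow>\<^sub>M count_space UNIV" and v: "range v \<subseteq> pts Y" and
      sv: "\<And>y. y \<in> pts Y \<Longrightarrow> gds_dist Y y (v (s y)) < \<rho>"
      using Y.net_index[OF \<rho>] by auto
    obtain k where k: "Y.pr.prob {y \<in> space (msr Y). s y < k} > 1 - c / 2"
      using Y.pr.index_tail[OF s, of "c / 2"] c by auto
    \<comment> \<open>The ball around the matched point has mass above \<open>c / 2\<close>, whereas
      the cells of index at least \<open>k\<close> together have less. Hence the ball meets one of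
      the first \<open>k\<close> cells.\<close>
    have near: "\<exists>i<k. gds_dist Y (snd (Z n x)) (v i) < 4 * \<rho>" if n: "n \<ge> N" for n
    proof -
      let ?C = "Y.met.mball (snd (Z n x)) (3 * \<rho>)"
      have "measure (msr X) ?B - e n \<le> measure (msr Y) ?C"
      proof (rule box_coupling_measure[OF \<pi>])
        fix z assume z: "z \<in> S n" "fst z \<in> ?B"
        have zp: "fst z \<in> pts X" "snd z \<in> pts Y" using z Ssub[of n] by auto
        have "gds_dist X (fst (Z n x)) (fst z) < 2 * \<rho>"
          using X.met.triangle[OF ZX x zp(1), of n x] N[OF n] z by (auto simp: X.met.commute)
        then have "gds_dist Y (snd (Z n x)) (snd z) < 3 * \<rho>"
          using box_coupling_dist[OF X Y \<pi> ZS z(1), of x] N[OF n] by linarith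
        then show "snd z \<in> ?C" using zp ZY by simp
      qed auto
      then have "c / 2 < measure (msr Y) ?C" using N[OF n] by (simp add: c_def)
      moreover have "Y.pr.prob (?C \<inter> {y \<in> space (msr Y). s y < k}) \<ge>
          measure (msr Y) ?C + Y.pr.prob {y \<in> space (msr Y). s y < k} - 1"
        by (rule Y.pr.prob_Int_ge) auto
      ultimately have "Y.pr.prob (?C \<inter> {y \<in> space (msr Y). s y < k}) > 0" using k by linarith
      then have "?C \<inter> {y \<in> space (msr Y). s y < k} \<noteq> {}" by auto
      then obtain y where y: "y \<in> ?C" "s y < k" by blast
      have yp: "y \<in> pts Y" "v (s y) \<in> pts Y" using y v by auto
      have "gds_dist Y (snd (Z n x)) (v (s y)) < 4 * \<rho>"
        using Y.met.triangle[OF ZY yp, of n x] y sv[OF yp(1)] by simp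
      then show ?thesis using y by blast
    qed
    \<comment> \<open>Total boundedness asks for centres in the set itself, so each centre
      \<open>v i\<close> near some matched point is traded for such a point. The indices below
      \<open>N\<close>, where \<open>near\<close> gives nothing, are added one by one.\<close>
    define t where "t i = (SOME n. gds_dist Y (snd (Z n x)) (v i) < 4 * \<rho>)" for i
    define J where "J = t ` {..<k} \<union> {..<N}"
    have "\<exists>m\<in>J. gds_dist Y (snd (Z m x)) (snd (Z n x)) < r" for n
    proof (cases "n < N")
      case True
      then have "n \<in> J" by (simp add: J_def)
      moreover have "gds_dist Y (snd (Z n x)) (snd (Z n x)) < r" using ZY r by simp
      ultimately show ?thesis by blast
    next
      case False
      then obtain i where i: "i < k" "gds_dist Y (snd (Z n x)) (v i) < 4 * \<rho>" using near[of n] by auto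
      have "gds_dist Y (snd (Z (t i) x)) (v i) < 4 * \<rho>" unfolding t_def
        by (rule someI[where P = "\<lambda>n. gds_dist Y (snd (Z n x)) (v i) < 4 * \<rho>", OF i(2)])
      moreover have "v i \<in> pts Y" using v by auto
      ultimately have "gds_dist Y (snd (Z (t i) x)) (snd (Z n x)) < r"
        using Y.met.triangle[OF ZY \<open>v i \<in> pts Y\<close> ZY, of "t i" x n x] i(2)
        by (simp add: Y.met.commute[of "v i"] \<rho>_def)
      then show ?thesis using i by (auto simp: J_def)
    qed
    moreover have "finite J" by (simp add: J_def)
    ultimately show "\<exists>K. finite K \<and> K \<subseteq> range (\<lambda>n. snd (Z n x)) \<and>
        range (\<lambda>n. snd (Z n x)) \<subseteq> (\<Union>y\<in>K. Y.met.mball y r)"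
      using ZY by (intro exI[of _ "(\<lambda>n. snd (Z n x)) ` J"]) fastforce
  qed
  have Kc: "compactin Y.met.mtopology (K x)" if "x \<in> pts X" for x
    using tb[OF that] Y.met.mtotally_bounded_eq_compact_closure_of[OF Y.mcomplete] by (simp add: K_def)
  have ZK: "snd (Z n x) \<in> K x" for n x
    unfolding K_def using closure_of_subset[of "range (\<lambda>n. snd (Z n x))" Y.met.mtopology] ZY by auto
  let ?P = "product_topology (\<lambda>_. Y.met.mtopology) (pts X)"
  let ?Q = "subtopology ?P (PiE (pts X) K)"
  have "compact_space ?Q"
    using Kc by (intro compact_space_subtopology) (simp add: compactin_PiE)
  \<comment> \<open>The closures of the tails are nested, closed and nonempty in a compact space,
    and any common point is a cluster point. There may be uncountably many factors, so cluster
    points stand in for limits of subsequences.\<close>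
  moreover define C where "C n = ?Q closure_of ((\<lambda>m. restrict (\<lambda>x. snd (Z m x)) (pts X)) ` {n..})" for n
  have in_Q: "restrict (\<lambda>x. snd (Z m x)) (pts X) \<in> topspace ?Q" for m
    using ZK ZY by auto
  have "C n \<noteq> {}" for n
    using closure_of_subset[of "(\<lambda>m. restrict (\<lambda>x. snd (Z m x)) (pts X)) ` {n..}" ?Q] in_Q
    unfolding C_def by blast
  moreover have "closedin ?Q (C n)" for n by (simp add: C_def)
  moreover have "decseq C"
    unfolding C_def decseq_def by (intro allI impI closure_of_mono image_mono) auto
  ultimately have "(\<Inter>n. C n) \<noteq> {}"
    by (intro compact_space_imp_nest[of ?Q C])
  then obtain \<phi> where "\<phi> \<in> (\<Inter>n. C n)" by blast
  then have \<phi>: "\<phi> \<in> C n" for n by blast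
  have \<phi>Q: "\<phi> \<in> topspace ?Q" using \<phi>[of 0] unfolding C_def in_closure_of by blast
  then have \<phi>Y: "\<phi> x \<in> pts Y" if "x \<in> pts X" for x using that by (auto simp: PiE_iff)
  have "\<exists>\<pi> S. box_coupling X Y r \<pi> S \<and>
      (\<forall>x\<in>A. \<exists>z\<in>S. gds_dist X x (fst z) < r \<and> gds_dist Y (snd z) (\<phi> x) < r)"
    if A: "finite A" "A \<subseteq> pts X" and r: "r > 0" for A r
  proof -
    have "\<forall>\<^sub>F n in sequentially. e n < r \<and> (\<forall>x\<in>A. gds_dist X x (fst (Z n x)) < r)"
      using e_small[OF r] close r A by (auto simp: eventually_conj_iff eventually_ball_finite_distrib)
    then obtain N where N: "\<And>n. n \<ge> N \<Longrightarrow> e n < r \<and> (\<forall>x\<in>A. gds_dist X x (fst (Z n x)) < r)"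
      by (auto simp: eventually_sequentially)
    define U where "U = (PiE (pts X) (\<lambda>x. if x \<in> A then Y.met.mball (\<phi> x) r else pts Y)) \<inter> PiE (pts X) K"
    have "{i \<in> pts X. (if i \<in> A then Y.met.mball (\<phi> i) r else pts Y) \<noteq> topspace Y.met.mtopology} \<subseteq> A" by auto
    then have "openin ?P (PiE (pts X) (\<lambda>x. if x \<in> A then Y.met.mball (\<phi> x) r else pts Y))"
      unfolding openin_PiE_gen using A(1) by (auto intro: finite_subset)
    then have "openin ?Q U" unfolding U_def by (intro openin_subtopology_Int)
    moreover have "\<phi> \<in> U" using \<phi>Q \<phi>Y r A by (auto simp: U_def PiE_iff)
    ultimately obtain n where n: "n \<ge> N" "restrict (\<lambda>x. snd (Z n x)) (pts X) \<in> U"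
      using \<phi>[of N] unfolding C_def in_closure_of by blast
    have "gds_dist Y (snd (Z n x)) (\<phi> x) < r" if "x \<in> A" for x
      using n(2) that A(2) by (auto simp: U_def PiE_iff Y.met.commute dest!: bspec[of _ _ x] split: if_splits)
    moreover have "box_coupling X Y r (\<pi> n) (S n)"
      using box_coupling_mono[OF \<pi>] N[OF n(1)] by force
    ultimately show ?thesis using ZS N[OF n(1)] by blast
  qed
  then show ?thesis using \<phi>Y by (intro bexI[of _ \<phi>]) auto
qed

text \<open>Whatever concerns finitely many points up to an arbitrary error can be read off a single
  coupling. This yields at once that \<open>\<phi>\<close> is an isometry and that it identifies the
  feature closures. The measure is reduced to this situation by exhausting open sets with finitely
  many balls, and surjectivity follows from full support and completeness.\<close>

lemma box_dist_0_imp_gds_iso: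
  fixes X :: "'a gds_data" and Y :: "'b gds_data"
  assumes X: "geometric_data_set X" and Y: "geometric_data_set Y" and 0: "box_dist X Y = 0"
  shows "gds_iso X Y"
proof -
  interpret X: gds X using X by unfold_locales
  interpret Y: gds Y using Y by unfold_locales
  obtain \<phi> where \<phi>: "\<phi> \<in> pts X \<rightarrow> pts Y" and match0: "\<forall>A r. finite A \<and> A \<subseteq> pts X \<and> 0 < r \<longrightarrow>
    (\<exists>\<pi> S. box_coupling X Y r \<pi> S \<and>
      (\<forall>x\<in>A. \<exists>z\<in>S. gds_dist X x (fst z) < r \<and> gds_dist Y (snd z) (\<phi> x) < r))"
    using box_dist_0_matching[OF X Y 0] ..
  have match: "\<exists>\<pi> S. box_coupling X Y r \<pi> S \<and>
      (\<forall>x\<in>A. \<exists>z\<in>S. gds_dist X x (fst z) < r \<and> gds_dist Y (snd z) (\<phi> x) < r)"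
    if "finite A" "A \<subseteq> pts X" "0 < r" for A r
    using match0 that by simp
  have \<phi>Y: "\<phi> x \<in> pts Y" if "x \<in> pts X" for x using \<phi> that by blast
  have iso: "gds_dist Y (\<phi> x) (\<phi> x') = gds_dist X x x'" if x: "x \<in> pts X" "x' \<in> pts X" for x x'
  proof -
    have "\<bar>gds_dist Y (\<phi> x) (\<phi> x') - gds_dist X x x'\<bar> \<le> 0 + d" if d: "d > 0" for d
    proof -
      \<comment> \<open>The coupling distorts by \<open>r\<close>, and moving both points to matched
        ones costs \<open>2 * r\<close> on each side.\<close>
      define r where "r = d / 5"
      have r: "r > 0" using d by (simp add: r_def)
      obtain \<pi> S where \<pi>: "box_coupling X Y r \<pi> S"
        and S: "\<forall>x\<in>{x, x'}. \<exists>z\<in>S. gds_dist X x (fst z) < r \<and> gds_dist Y (snd z) (\<phi> x) < r"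
        using match[of "{x, x'}" r] r x by auto
      obtain z where z: "z \<in> S" "gds_dist X x (fst z) < r" "gds_dist Y (snd z) (\<phi> x) < r" using S by auto
      obtain z' where z': "z' \<in> S" "gds_dist X x' (fst z') < r" "gds_dist Y (snd z') (\<phi> x') < r" using S by auto
      have p: "fst z \<in> pts X" "fst z' \<in> pts X" "snd z \<in> pts Y" "snd z' \<in> pts Y"
        using \<pi> z z' by (auto simp: box_coupling_def)
      note q = \<phi>Y[OF x(1)] \<phi>Y[OF x(2)]
      have "\<bar>gds_dist X (fst z) (fst z') - gds_dist Y (snd z) (snd z')\<bar> \<le> r"
        by (rule box_coupling_dist[OF X Y \<pi> z(1) z'(1)])
      moreover have "\<bar>gds_dist X x x' - gds_dist X (fst z) (fst z')\<bar> \<le> 2 * r"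
        using X.met.triangle[OF x(1) p(1) x(2)] X.met.triangle[OF p(1,2) x(2)]
          X.met.triangle[OF p(1) x(1) p(2)] X.met.triangle[OF x p(2)] z z'
        by (simp add: X.met.commute[of "fst z" x] X.met.commute[of "fst z'" x'])
      moreover have "\<bar>gds_dist Y (\<phi> x) (\<phi> x') - gds_dist Y (snd z) (snd z')\<bar> \<le> 2 * r"
        using Y.met.triangle[OF q(1) p(3) q(2)] Y.met.triangle[OF p(3,4) q(2)]
          Y.met.triangle[OF p(3) q(1) p(4)] Y.met.triangle[OF q p(4)] z z'
        by (simp add: Y.met.commute[of "\<phi> x" "snd z"] Y.met.commute[of "\<phi> x'" "snd z'"])
      ultimately show ?thesis unfolding r_def by argo
    qed
    then have "\<bar>gds_dist Y (\<phi> x) (\<phi> x') - gds_dist X x x'\<bar> \<le> 0" by (rule field_le_epsilon)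
    then show ?thesis by simp
  qed
  have cont: "continuous_map (gds_topology X) (gds_topology Y) \<phi>"
    unfolding X.topology_eq Y.topology_eq
      Metric_space.metric_continuous_map[OF X.met.Metric_space_axioms Y.met.Metric_space_axioms]
    using \<phi> iso by (metis funcset_image)
  have \<phi>m[measurable]: "\<phi> \<in> msr X \<rightarrow>\<^sub>M msr Y"
    using continuous_map_measurable_borel_of[OF cont]
    by (simp add: measurable_cong_sets[OF X.sets_msr Y.sets_msr])
  define \<nu> where "\<nu> = distr (msr X) (msr Y) \<phi>"
  interpret \<nu>: prob_space \<nu> unfolding \<nu>_def by (rule X.pr.prob_space_distr[OF \<phi>m])
  have sets_\<nu>: "sets \<nu> = sets (msr Y)" by (simp add: \<nu>_def)
  have space_\<nu>: "space \<nu> = pts Y" by (simp add: \<nu>_def Y.space_msr)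
  \<comment> \<open>Up to mass \<open>d / 2\<close> the preimage of \<open>U\<close> is covered by
    finitely many balls around points \<open>w i\<close> such that the ball of twice the radius
    around \<open>\<phi> (w i)\<close> lies in \<open>U\<close>. The doubling leaves room for the
    error of a coupling.\<close>
  have \<nu>_le: "measure \<nu> U \<le> measure (msr Y) U" if U: "openin (gds_topology Y) U" for U
  proof (rule field_le_epsilon)
    fix d :: real assume d: "d > 0"
    obtain w :: "nat \<Rightarrow> 'a" where w: "range w \<subseteq> pts X"
      "\<And>x e. x \<in> pts X \<Longrightarrow> 0 < e \<Longrightarrow> \<exists>n. gds_dist X x (w n) < e"
      by (rule X.dense_seq) blast
    define I where "I = {(i, k). Y.met.mball (\<phi> (w i)) (2 / Suc k) \<subseteq> U}"
    define B where "B = (\<lambda>(i, k :: nat). X.met.mball (w i) (1 / Suc k))"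
    define F where "F n = (\<lambda>m. prod_decode m) ` {..<n} \<inter> I" for n
    define V where "V n = (\<Union>p\<in>F n. B p)" for n
    have [measurable]: "B p \<in> sets (msr X)" for p by (cases p) (simp add: B_def)
    have Um[measurable]: "U \<in> sets (msr Y)" using U by (rule Y.openin_sets)
    have Fin: "finite (F n)" for n by (simp add: F_def)
    have [measurable]: "V n \<in> sets (msr X)" for n unfolding V_def using Fin by (intro sets.finite_UN) auto
    have cover: "\<phi> -` U \<inter> space (msr X) \<subseteq> (\<Union>n. V n)"
    proof
      fix x assume "x \<in> \<phi> -` U \<inter> space (msr X)"
      then have x: "x \<in> pts X" "\<phi> x \<in> U" by (auto simp: X.space_msr)
      obtain a where a: "a > 0" "Y.met.mball (\<phi> x) a \<subseteq> U"
        using U x Y.met.openin_mtopology unfolding Y.topology_eq by meson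
      obtain k where k: "1 / real (Suc k) < a / 3"
        using a nat_approx_posE[of "a / 3"] by auto
      obtain i where i: "gds_dist X x (w i) < 1 / real (Suc k)"
        using w(2)[OF x(1), of "1 / real (Suc k)"] by auto
      have wi: "w i \<in> pts X" using w by auto
      have "Y.met.mball (\<phi> (w i)) (2 / Suc k) \<subseteq> Y.met.mball (\<phi> x) a"
      proof
        fix y assume y: "y \<in> Y.met.mball (\<phi> (w i)) (2 / Suc k)"
        then have "gds_dist Y (\<phi> (w i)) y < 2 * (1 / real (Suc k))" by simp
        then have "gds_dist Y (\<phi> x) y < a"
          using y Y.met.triangle[OF \<phi>Y[OF x(1)] \<phi>Y[OF wi], of y] i k iso[OF x(1) wi] by simp
        then show "y \<in> Y.met.mball (\<phi> x) a" using y \<phi>Y x by simp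
      qed
      then have "(i, k) \<in> F (Suc (prod_encode (i, k)))"
        using a by (auto simp: F_def I_def intro!: image_eqI[of _ _ "prod_encode (i, k)"])
      moreover have "x \<in> B (i, k)" using i x wi by (simp add: B_def X.met.commute)
      ultimately show "x \<in> (\<Union>n. V n)" unfolding V_def by blast
    qed
    have "incseq V"
      by (auto simp: incseq_def V_def F_def) force
    then have "(\<lambda>n. X.pr.prob (V n)) \<longlonglongrightarrow> X.pr.prob (\<Union>n. V n)"
      by (intro X.pr.finite_Lim_measure_incseq) auto
    moreover have "X.pr.prob (\<Union>n. V n) > X.pr.prob (\<Union>n. V n) - d / 2" using d by simp
    ultimately have "\<forall>\<^sub>F n in sequentially. X.pr.prob (V n) > X.pr.prob (\<Union>n. V n) - d / 2"
      by (rule order_tendstoD)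
    then obtain n where n: "X.pr.prob (V n) > X.pr.prob (\<Union>n. V n) - d / 2"
      by (auto simp: eventually_sequentially)
    \<comment> \<open>The error on the way from \<open>fst z\<close> to \<open>snd z\<close> is
      \<open>3 * r\<close>: two moves to the matched pair near \<open>w i\<close> and one
      distortion. It has to fit into the spare radius \<open>1 / Suc k\<close> of every ball in
      \<open>F n\<close>.\<close>
    define r where "r = Min (insert (d / 2) ((\<lambda>p. 1 / (3 * real (Suc (snd p)))) ` F n))"
    have r: "r > 0" unfolding r_def using d Fin by auto
    have rd: "r \<le> d / 2" unfolding r_def using Fin by (intro Min_le) auto
    have rF: "3 * r \<le> 1 / real (Suc k)" if "(i, k) \<in> F n" for i k
    proof -
      have "r \<le> 1 / (3 * real (Suc k))" unfolding r_def using Fin that by (intro Min_le) force+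
      then show ?thesis by (simp add: field_simps)
    qed
    obtain \<pi> S where \<pi>: "box_coupling X Y r \<pi> S"
      and S: "\<And>i k. (i, k) \<in> F n \<Longrightarrow> \<exists>z\<in>S. gds_dist X (w i) (fst z) < r \<and> gds_dist Y (snd z) (\<phi> (w i)) < r"
    proof -
      have "finite (w ` fst ` F n)" "w ` fst ` F n \<subseteq> pts X" using Fin w by auto
      from match[OF this r] show ?thesis using that by force
    qed
    have "measure (msr X) (V n) - r \<le> measure (msr Y) U"
    proof (rule box_coupling_measure[OF \<pi>])
      fix z assume z: "z \<in> S" "fst z \<in> V n"
      then obtain i k where ik: "(i, k) \<in> F n" "fst z \<in> X.met.mball (w i) (1 / Suc k)"
        by (auto simp: V_def B_def)
      obtain z' where z': "z' \<in> S" "gds_dist X (w i) (fst z') < r" "gds_dist Y (snd z') (\<phi> (w i)) < r"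
        using S[OF ik(1)] by auto
      have p: "fst z \<in> pts X" "fst z' \<in> pts X" "snd z \<in> pts Y" "snd z' \<in> pts Y" "w i \<in> pts X"
        using \<pi> z z' w by (auto simp: box_coupling_def)
      have "\<bar>gds_dist X (fst z') (fst z) - gds_dist Y (snd z') (snd z)\<bar> \<le> r"
        by (rule box_coupling_dist[OF X Y \<pi> z'(1) z(1)])
      moreover have "gds_dist X (fst z') (fst z) < r + 1 / Suc k"
        using X.met.triangle[OF p(2,5,1)] z' ik(2) by (simp add: X.met.commute)
      moreover have "gds_dist Y (\<phi> (w i)) (snd z) \<le> r + gds_dist Y (snd z') (snd z)"
        using Y.met.triangle[OF \<phi>Y[OF p(5)] p(4,3)] z' by (simp add: Y.met.commute[of "\<phi> (w i)" "snd z'"])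
      ultimately have "gds_dist Y (\<phi> (w i)) (snd z) < 1 / Suc k + 3 * r" by argo
      also have "\<dots> \<le> 2 / Suc k" using rF[OF ik(1)] by simp
      finally have "snd z \<in> Y.met.mball (\<phi> (w i)) (2 / Suc k)" using p \<phi>Y by simp
      then show "snd z \<in> U" using ik(1) by (auto simp: F_def I_def)
    qed auto
    moreover have "measure \<nu> U = X.pr.prob (\<phi> -` U \<inter> space (msr X))"
      unfolding \<nu>_def by (rule measure_distr) auto
    moreover have "\<dots> \<le> X.pr.prob (\<Union>n. V n)"
      using cover by (intro X.pr.finite_measure_mono) auto
    ultimately show "measure \<nu> U \<le> measure (msr Y) U + d" using n rd by linarith
  qed
  \<comment> \<open>Both measures have total mass 1, so the inequality for open sets reverses for
    closed ones. Open sets are increasing unions of the closed sets \<open>C k\<close>.\<close>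
  have \<nu>_eq: "measure \<nu> U = measure (msr Y) U" if U: "openin (gds_topology Y) U" for U
  proof (rule antisym[OF \<nu>_le[OF U]])
    have Usub: "U \<subseteq> pts Y" using openin_subset[OF U] by (simp add: Y.topspace_eq)
    define C where "C k = {y \<in> pts Y. Y.met.mball y (1 / Suc k) \<subseteq> U}" for k :: nat
    have opn: "openin (gds_topology Y) (pts Y - C k)" for k
    proof -
      have "pts Y - C k = (\<Union>y\<in>pts Y - U. Y.met.mball y (1 / Suc k))"
        by (auto simp: C_def Y.met.commute)
      then show ?thesis by (auto simp: Y.topology_eq)
    qed
    have Cm: "C k \<in> sets (msr Y)" for k
    proof -
      have "pts Y - (pts Y - C k) \<in> sets (msr Y)"
        using Y.openin_sets[OF opn] sets.top[of "msr Y"] by (auto simp: Y.space_msr)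
      moreover have "pts Y - (pts Y - C k) = C k" by (auto simp: C_def)
      ultimately show ?thesis by simp
    qed
    have le: "measure (msr Y) (C k) \<le> measure \<nu> (C k)" for k
      using \<nu>_le[OF opn[of k]] \<nu>.prob_compl[of "C k"] Y.pr.prob_compl[of "C k"] Cm[of k]
      by (simp add: sets_\<nu> space_\<nu> Y.space_msr)
    have inc: "incseq C"
    proof (rule incseq_SucI, rule subsetI)
      fix k y assume "y \<in> C k"
      moreover have "Y.met.mball y (1 / Suc (Suc k)) \<subseteq> Y.met.mball y (1 / Suc k)"
        by (rule Y.met.mball_subset_concentric) (simp add: field_simps)
      ultimately show "y \<in> C (Suc k)" by (auto simp: C_def)
    qed
    have un: "(\<Union>k. C k) = U"
    proof
      show "(\<Union>k. C k) \<subseteq> U"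
        using Y.met.centre_in_mball_iff by (fastforce simp: C_def)
      show "U \<subseteq> (\<Union>k. C k)"
      proof
        fix y assume y: "y \<in> U"
        then obtain a where a: "a > 0" "Y.met.mball y a \<subseteq> U"
          using U Y.met.openin_mtopology unfolding Y.topology_eq by meson
        obtain k where k: "1 / real (Suc k) < a"
          using a nat_approx_posE[of "a"] by auto
        have "Y.met.mball y (1 / Suc k) \<subseteq> Y.met.mball y a"
          by (rule Y.met.mball_subset_concentric) (use k in simp)
        then show "y \<in> (\<Union>k. C k)" using a y Usub by (auto simp: C_def)
      qed
    qed
    have "(\<lambda>k. measure (msr Y) (C k)) \<longlonglongrightarrow> measure (msr Y) U"
      unfolding un[symmetric] using inc Cm by (intro Y.pr.finite_Lim_measure_incseq) auto
    moreover have "(\<lambda>k. measure \<nu> (C k)) \<longlonglongrightarrow> measure \<nu> U"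
      unfolding un[symmetric] using inc Cm by (intro \<nu>.finite_Lim_measure_incseq) (auto simp: sets_\<nu>)
    ultimately show "measure (msr Y) U \<le> measure \<nu> U"
      using le by (intro LIMSEQ_le) auto
  qed
  have \<nu>Y: "\<nu> = msr Y"
  proof (rule measure_eqI_generator_eq[where E = "{U. openin (gds_topology Y) U}" and \<Omega> = "pts Y" and A = "\<lambda>_. pts Y"])
    show "Int_stable {U. openin (gds_topology Y) U}" by (auto simp: Int_stable_def)
    show "{U. openin (gds_topology Y) U} \<subseteq> Pow (pts Y)"
      using openin_subset Y.topspace_eq by blast
    show "emeasure \<nu> U = emeasure (msr Y) U" if "U \<in> {U. openin (gds_topology Y) U}" for U
      using that \<nu>_eq by (simp add: \<nu>.emeasure_eq_measure Y.pr.emeasure_eq_measure)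
    show "sets \<nu> = sigma_sets (pts Y) {U. openin (gds_topology Y) U}"
      "sets (msr Y) = sigma_sets (pts Y) {U. openin (gds_topology Y) U}"
      by (simp_all add: sets_\<nu> Y.sets_msr sets_borel_of Y.topspace_eq)
    show "range (\<lambda>_. pts Y) \<subseteq> {U. openin (gds_topology Y) U}"
      using openin_topspace[of "gds_topology Y"] by (auto simp: Y.topspace_eq)
  qed auto
  \<comment> \<open>As \<open>\<nu>\<close> has full support, the image of \<open>\<phi>\<close> is
    dense. The isometry pulls a sequence of images converging to \<open>y\<close> back to a Cauchy
    sequence, which converges by completeness of \<open>X\<close>.\<close>
  have surj: "\<exists>x\<in>pts X. \<phi> x = y" if y: "y \<in> pts Y" for y
  proof -
    have "\<exists>x\<in>pts X. gds_dist Y (\<phi> x) y < 1 / Suc n" for n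
    proof (rule ccontr)
      assume "\<not> ?thesis"
      then have "\<phi> -` Y.met.mball y (1 / Suc n) \<inter> space (msr X) = {}"
        by (auto simp: X.space_msr Y.met.commute)
      moreover have "measure \<nu> (Y.met.mball y (1 / Suc n)) =
          X.pr.prob (\<phi> -` Y.met.mball y (1 / Suc n) \<inter> space (msr X))"
        unfolding \<nu>_def by (rule measure_distr) auto
      ultimately have "measure (msr Y) (Y.met.mball y (1 / Suc n)) = 0" by (simp add: \<nu>Y)
      then show False using Y.measure_mball_pos[OF y, of "1 / Suc n"] by simp
    qed
    then obtain x where x: "\<And>n. x n \<in> pts X" "\<And>n. gds_dist Y (\<phi> (x n)) y < 1 / Suc n" by metis
    have lim: "limitin Y.met.mtopology (\<lambda>n. \<phi> (x n)) y sequentially"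
      unfolding Y.met.limit_metric_sequentially
    proof (intro conjI y allI impI)
      fix a :: real assume "a > 0"
      then obtain N where N: "1 / real (Suc N) < a" using nat_approx_posE by blast
      have "gds_dist Y (\<phi> (x n)) y < a" if "n \<ge> N" for n
      proof -
        have "1 / real (Suc n) \<le> 1 / real (Suc N)" using that by (simp add: field_simps)
        then show ?thesis using x(2)[of n] N by linarith
      qed
      then show "\<exists>N. \<forall>n\<ge>N. \<phi> (x n) \<in> pts Y \<and> gds_dist Y (\<phi> (x n)) y < a" using x \<phi>Y by blast
    qed
    then have "Y.met.MCauchy (\<lambda>n. \<phi> (x n))"
      by (rule Y.met.convergent_imp_MCauchy[rotated]) (use x \<phi>Y in auto)
    then have "X.met.MCauchy x"
      using x(1) by (auto simp: Y.met.MCauchy_def X.met.MCauchy_def iso)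
    then obtain l where l: "limitin X.met.mtopology x l sequentially"
      using X.mcomplete X.met.mcomplete_def by blast
    then have "limitin Y.met.mtopology (\<phi> \<circ> x) (\<phi> l) sequentially"
      using continuous_map_limit[OF cont] by (simp add: X.topology_eq Y.topology_eq)
    then have "\<phi> l = y"
      using Y.met.limitin_metric_unique[OF _ lim, of "\<phi> l"] by (simp add: comp_def)
    moreover have "l \<in> pts X" using l X.met.limitin_mspace by blast
    ultimately show ?thesis by blast
  qed
  have close: "\<bar>f x - g (\<phi> x)\<bar> < 3 * r"
    if "x \<in> A" and A: "A \<subseteq> pts X" and \<pi>: "box_coupling X Y r \<pi> S"
      and S: "\<forall>x\<in>A. \<exists>z\<in>S. gds_dist X x (fst z) < r \<and> gds_dist Y (snd z) (\<phi> x) < r"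
      and f: "f \<in> feats X" and g: "g \<in> feats Y" and fg: "\<forall>z\<in>S. \<bar>f (fst z) - g (snd z)\<bar> \<le> r / 2"
    for A x f g r \<pi> S
  proof -
    have x: "x \<in> pts X" using that by blast
    obtain z where z: "z \<in> S" "gds_dist X x (fst z) < r" "gds_dist Y (snd z) (\<phi> x) < r"
      using S \<open>x \<in> A\<close> by blast
    have p: "fst z \<in> pts X" "snd z \<in> pts Y" using \<pi> z by (auto simp: box_coupling_def)
    have "\<bar>f x - f (fst z)\<bar> < r" using X.feats_lipschitz[OF f x p(1)] z by simp
    moreover have "\<bar>g (snd z) - g (\<phi> x)\<bar> < r" using Y.feats_lipschitz[OF g p(2) \<phi>Y[OF x]] z by simp
    moreover have "\<bar>f (fst z) - g (snd z)\<bar> \<le> r / 2" using fg z by blast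
    ultimately show ?thesis by argo
  qed
  have "(\<lambda>g. compose (pts X) g \<phi>) ` feats_closure Y = feats_closure X"
  proof (intro equalityI subsetI)
    fix f assume "f \<in> (\<lambda>g. compose (pts X) g \<phi>) ` feats_closure Y"
    then obtain g where g: "g \<in> feats_closure Y" "f = compose (pts X) g \<phi>" by blast
    show "f \<in> feats_closure X"
      unfolding X.closure_approx
    proof (intro conjI allI impI)
      show "f \<in> extensional (pts X)" by (simp add: g)
      fix A and e :: real assume "finite A \<and> A \<subseteq> pts X \<and> 0 < e"
      then have A: "finite A" "A \<subseteq> pts X" and e: "0 < e / 4" by auto
      obtain g' where g': "g' \<in> feats Y" "\<And>y. y \<in> \<phi> ` A \<Longrightarrow> \<bar>g' y - g y\<bar> < e / 4"
        using Y.feats_closure_approx[OF g(1), of "\<phi> ` A" "e / 4"] A e \<phi> by blast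
      obtain \<pi> S where \<pi>: "box_coupling X Y (e / 4) \<pi> S"
        and S: "\<forall>x\<in>A. \<exists>z\<in>S. gds_dist X x (fst z) < e / 4 \<and> gds_dist Y (snd z) (\<phi> x) < e / 4"
        using match[OF A e] by blast
      obtain f' where f': "f' \<in> feats X" "\<forall>z\<in>S. \<bar>f' (fst z) - g' (snd z)\<bar> \<le> e / 4 / 2"
        using \<pi> g'(1) unfolding box_coupling_def by blast
      have "\<bar>f' x - f x\<bar> < e" if x: "x \<in> A" for x
      proof -
        have "\<bar>g' (\<phi> x) - g (\<phi> x)\<bar> < e / 4" using g'(2) x by blast
        moreover have "f x = g (\<phi> x)" using x A by (auto simp: g compose_def)
        ultimately show ?thesis using close[OF x A(2) \<pi> S f'(1) g'(1) f'(2)] by argo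
      qed
      then show "\<exists>f'\<in>feats X. \<forall>x\<in>A. \<bar>f' x - f x\<bar> < e" using f' by blast
    qed
  next
    fix f assume f: "f \<in> feats_closure X"
    define \<psi> where "\<psi> = inv_into (pts X) \<phi>"
    have \<psi>: "\<phi> (\<psi> y) = y" "\<psi> y \<in> pts X" if "y \<in> pts Y" for y
      using surj[OF that] unfolding \<psi>_def by (metis f_inv_into_f image_eqI, metis inv_into_into image_eqI)
    have inj: "\<psi> (\<phi> x) = x" if "x \<in> pts X" for x
      using \<psi>[OF \<phi>Y[OF that]] iso[of "\<psi> (\<phi> x)" x] that \<phi>Y[OF that] X.met.zero Y.met.zero by metis
    define g where "g = restrict (f \<circ> \<psi>) (pts Y)"
    have "f = compose (pts X) g \<phi>"
      using X.feats_closure_extensional[OF f] inj \<phi>Y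
      by (auto simp: g_def compose_def fun_eq_iff extensional_def)
    moreover have "g \<in> feats_closure Y"
      unfolding Y.closure_approx
    proof (intro conjI allI impI)
      show "g \<in> extensional (pts Y)" by (simp add: g_def)
      fix B and e :: real assume "finite B \<and> B \<subseteq> pts Y \<and> 0 < e"
      then have B: "finite B" "B \<subseteq> pts Y" and e: "0 < e / 4" by auto
      have A: "finite (\<psi> ` B)" "\<psi> ` B \<subseteq> pts X" using B \<psi> by auto
      obtain f' where f': "f' \<in> feats X" "\<And>x. x \<in> \<psi> ` B \<Longrightarrow> \<bar>f' x - f x\<bar> < e / 4"
        using X.feats_closure_approx[OF f A e] by blast
      obtain \<pi> S where \<pi>: "box_coupling X Y (e / 4) \<pi> S"
        and S: "\<forall>x\<in>\<psi> ` B. \<exists>z\<in>S. gds_dist X x (fst z) < e / 4 \<and> gds_dist Y (snd z) (\<phi> x) < e / 4"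
        using match[OF A e] by blast
      obtain g' where g': "g' \<in> feats Y" "\<forall>z\<in>S. \<bar>f' (fst z) - g' (snd z)\<bar> \<le> e / 4 / 2"
        using \<pi> f'(1) unfolding box_coupling_def by blast
      have "\<bar>g' y - g y\<bar> < e" if y: "y \<in> B" for y
      proof -
        have yY: "y \<in> pts Y" using y B by blast
        have "\<bar>f' (\<psi> y) - f (\<psi> y)\<bar> < e / 4" using f'(2) y by blast
        moreover have "g y = f (\<psi> y)" using yY by (simp add: g_def)
        moreover have "\<bar>f' (\<psi> y) - g' y\<bar> < 3 * (e / 4)"
          using close[OF imageI[OF y, of \<psi>] A(2) \<pi> S f'(1) g'(1) g'(2)] \<psi>[OF yY] by simp
        ultimately show ?thesis by argo
      qed
      then show "\<exists>g'\<in>feats Y. \<forall>x\<in>B. \<bar>g' x - g x\<bar> < e" using g' by blast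
    qed
    ultimately show "f \<in> (\<lambda>g. compose (pts X) g \<phi>) ` feats_closure Y" by blast
  qed
  then show ?thesis
    unfolding gds_iso_def using \<phi>m \<nu>Y[unfolded \<nu>_def] by blast
qed

lemma gds_iso_iff_box_dist_0:
  assumes "geometric_data_set X" "geometric_data_set Y"
  shows "gds_iso X Y \<longleftrightarrow> box_dist X Y = 0"
  using assms gds_iso_imp_box_dist_0 box_dist_0_imp_gds_iso by blast

section \<open>Separability\<close>

text \<open>An atom cannot be cut into smaller sets. An independent uniform variable makes it
  possible to retain any prescribed fraction of the mass of a cell.\<close>

abbreviation unit_uniform :: "real measure" where
  "unit_uniform \<equiv> uniform_measure lborel {0..1}"

lemma prob_space_unit_uniform: "prob_space unit_uniform"
  by (rule prob_space_uniform_measure) auto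

lemma measure_unit_uniform_atMost:
  assumes "0 \<le> t" "t \<le> 1"
  shows "emeasure unit_uniform {..t} = ennreal t"
proof -
  have "{0..1} \<inter> {..t} = {0..t}" using assms by auto
  then show ?thesis using assms by (simp add: divide_ennreal flip: ennreal_1)
qed

text \<open>Thinning the cell \<open>i\<close>, that is, sending a random part of it to the waste index 0, gives its
  index \<open>Suc i\<close> the exact mass \<open>c i\<close>.\<close>

lemma (in prob_space) thinned_index:
  fixes r :: "'a \<Rightarrow> nat" and c :: "nat \<Rightarrow> real"
  assumes r[measurable]: "r \<in> M \<rightarrow>\<^sub>M count_space UNIV"
    and c: "\<And>i. 0 \<le> c i" "\<And>i. c i \<le> prob {x \<in> space M. r x = i}"
  shows "\<exists>R\<in>M \<Otimes>\<^sub>M unit_uniform \<rightarrow>\<^sub>M count_space UNIV.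
    (\<forall>z i. R z = Suc i \<longrightarrow> r (fst z) = i \<and> i < k) \<and>
    (\<forall>i<k. measure (M \<Otimes>\<^sub>M unit_uniform) {z \<in> space (M \<Otimes>\<^sub>M unit_uniform). R z = Suc i} = c i) \<and>
    measure (M \<Otimes>\<^sub>M unit_uniform) {z \<in> space (M \<Otimes>\<^sub>M unit_uniform). R z = 0} = 1 - (\<Sum>i<k. c i)"
proof -
  let ?U = unit_uniform
  let ?P = "M \<Otimes>\<^sub>M ?U"
  interpret U: prob_space ?U by (rule prob_space_unit_uniform)
  interpret P: pair_prob_space M ?U by unfold_locales
  define m where "m i = prob {x \<in> space M. r x = i}" for i
  \<comment> \<open>The fraction of cell \<open>i\<close> to be retained. For \<open>m i = 0\<close>
    also \<open>c i = 0\<close>, and division by zero gives the fraction 0.\<close>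
  define \<rho> where "\<rho> i = c i / m i" for i
  have \<rho>: "0 \<le> \<rho> i" "\<rho> i \<le> 1" "m i * \<rho> i = c i" for i
    using c[of i] by (auto simp: \<rho>_def m_def divide_le_eq)
  define R where "R z = (if r (fst z) < k \<and> snd z \<le> \<rho> (r (fst z)) then Suc (r (fst z)) else 0)" for z
  have [measurable]: "\<rho> \<in> count_space UNIV \<rightarrow>\<^sub>M borel" by simp
  have [measurable]: "R \<in> ?P \<rightarrow>\<^sub>M count_space UNIV"
    unfolding R_def by measurable
  have Z: "{z \<in> space ?P. R z = j} \<in> sets ?P" for j by measurable
  have Ri: "r (fst z) = i \<and> i < k" if "R z = Suc i" for z i
    using that by (auto simp: R_def split: if_splits)
  have mi: "measure ?P {z \<in> space ?P. R z = Suc i} = c i" if "i < k" for i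
  proof -
    have "{z \<in> space ?P. R z = Suc i} = {x \<in> space M. r x = i} \<times> {..\<rho> i}"
      using that by (auto simp: R_def space_pair_measure split: if_splits)
    then have "emeasure ?P {z \<in> space ?P. R z = Suc i} = ennreal (m i) * ennreal (\<rho> i)"
      using measure_unit_uniform_atMost[OF \<rho>(1,2)]
      by (simp add: U.emeasure_pair_measure_Times emeasure_eq_measure m_def)
    also have "\<dots> = ennreal (c i)"
      using \<rho>[of i] by (simp add: ennreal_mult[symmetric] m_def)
    finally show ?thesis using c(1) by (simp add: P.emeasure_eq_measure)
  qed
  have "measure ?P {z \<in> space ?P. R z = 0} = 1 - measure ?P (\<Union>i<k. {z \<in> space ?P. R z = Suc i})"
  proof -
    have "{z \<in> space ?P. R z = 0} = space ?P - (\<Union>i<k. {z \<in> space ?P. R z = Suc i})"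
    proof (rule set_eqI)
      fix z
      show "z \<in> {z \<in> space ?P. R z = 0} \<longleftrightarrow> z \<in> space ?P - (\<Union>i<k. {z \<in> space ?P. R z = Suc i})"
        by (cases "R z") (use Ri[of z] in auto)
    qed
    then show ?thesis by (simp only:) (rule P.prob_compl, measurable)
  qed
  also have "measure ?P (\<Union>i<k. {z \<in> space ?P. R z = Suc i}) = (\<Sum>i<k. measure ?P {z \<in> space ?P. R z = Suc i})"
  proof (rule P.finite_measure_finite_Union)
    show "(\<lambda>i. {z \<in> space ?P. R z = Suc i}) ` {..<k} \<subseteq> P.events" using Z by blast
  qed (auto simp: disjoint_family_on_def)
  also have "\<dots> = (\<Sum>i<k. c i)" by (rule sum.cong) (auto simp: mi)
  finally show ?thesis using Ri mi by (intro bexI[of _ R]) auto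
qed

text \<open>Stated for representatives over any point type, because the limit data set consists of
  functions rather than real numbers.\<close>

definition gds_data_K :: "'a gds_data set" where
  "gds_data_K = {X. geometric_data_set X \<and> (\<forall>f\<in>feats X. \<forall>x\<in>pts X. f x \<in> {-1/2..1/2})}"

text \<open>Masses and feature values enter only through roundings, which range over a countable set.\<close>

lemma box_dist_le_if_same_type:
  fixes X :: "'a gds_data" and Y :: "'b gds_data" and r :: "'a \<Rightarrow> nat" and s :: "'b \<Rightarrow> nat"
  assumes X: "geometric_data_set X" and Y: "geometric_data_set Y" and e: "0 < e"
    and r[measurable]: "r \<in> msr X \<rightarrow>\<^sub>M count_space UNIV" and w: "range w \<subseteq> pts X"
    and rw: "\<And>x. x \<in> pts X \<Longrightarrow> gds_dist X x (w (r x)) < e"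
    and kr: "measure (msr X) {x \<in> space (msr X). r x < k} > 1 - e"
    and s[measurable]: "s \<in> msr Y \<rightarrow>\<^sub>M count_space UNIV" and v: "range v \<subseteq> pts Y"
    and sv: "\<And>y. y \<in> pts Y \<Longrightarrow> gds_dist Y y (v (s y)) < e"
    and L: "L > 0" "real k / e \<le> L"
    and weights: "\<And>i. i < k \<Longrightarrow> \<lfloor>measure (msr X) {x \<in> space (msr X). r x = i} * L\<rfloor> =
      \<lfloor>measure (msr Y) {y \<in> space (msr Y). s y = i} * L\<rfloor>"
    and features: "(\<lambda>f. map (\<lambda>i. \<lfloor>f (w i) / e\<rfloor>) [0..<k]) ` feats X = (\<lambda>f. map (\<lambda>i. \<lfloor>f (v i) / e\<rfloor>) [0..<k]) ` feats Y"
  shows "box_dist X Y \<le> 6 * e"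
proof -
  interpret X: gds X using X by unfold_locales
  interpret Y: gds Y using Y by unfold_locales
  let ?U = unit_uniform
  interpret U: prob_space ?U by (rule prob_space_unit_uniform)
  interpret PX: pair_prob_space "msr X" ?U by unfold_locales
  interpret PY: pair_prob_space "msr Y" ?U by unfold_locales
  let ?MX = "msr X \<Otimes>\<^sub>M ?U" and ?MY = "msr Y \<Otimes>\<^sub>M ?U"
  define m where "m i = measure (msr X) {x \<in> space (msr X). r x = i}" for i
  \<comment> \<open>Both masses rounded down to the same multiple of \<open>1 / L\<close>, so that
    both cells can be thinned to it. Over \<open>k\<close> cells this loses at most
    \<open>k / L\<close>, which is at most \<open>e\<close>.\<close>
  define c where "c i = (if i < k then \<lfloor>m i * L\<rfloor> / L else 0)" for i
  have fl: "real_of_int \<lfloor>t * L\<rfloor> / L \<le> t" "0 \<le> t \<Longrightarrow> 0 \<le> real_of_int \<lfloor>t * L\<rfloor> / L"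
    "t - 1 / L \<le> real_of_int \<lfloor>t * L\<rfloor> / L" for t
    using L by (auto simp: pos_divide_le_eq pos_le_divide_eq left_diff_distrib)
  have c0: "0 \<le> c i" for i unfolding c_def m_def using fl by auto
  have cX: "c i \<le> measure (msr X) {x \<in> space (msr X). r x = i}" for i
    unfolding c_def m_def using fl by auto
  have cY: "c i \<le> measure (msr Y) {y \<in> space (msr Y). s y = i}" for i
    unfolding c_def m_def using fl weights by auto
  obtain R where R[measurable]: "R \<in> ?MX \<rightarrow>\<^sub>M count_space UNIV"
    and R': "(\<forall>z i. R z = Suc i \<longrightarrow> r (fst z) = i \<and> i < k) \<and>
      (\<forall>i<k. measure ?MX {z \<in> space ?MX. R z = Suc i} = c i) \<and>
      measure ?MX {z \<in> space ?MX. R z = 0} = 1 - (\<Sum>i<k. c i)"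
    using X.pr.thinned_index[OF r c0 cX, of k] ..
  obtain T where T[measurable]: "T \<in> ?MY \<rightarrow>\<^sub>M count_space UNIV"
    and T': "(\<forall>z i. T z = Suc i \<longrightarrow> s (fst z) = i \<and> i < k) \<and>
      (\<forall>i<k. measure ?MY {z \<in> space ?MY. T z = Suc i} = c i) \<and>
      measure ?MY {z \<in> space ?MY. T z = 0} = 1 - (\<Sum>i<k. c i)"
    using Y.pr.thinned_index[OF s c0 cY, of k] ..
  have "distr ?MX (count_space UNIV) R = distr ?MY (count_space UNIV) T"
  proof (rule measure_eqI_countable[of _ UNIV])
    fix j :: nat
    have "measure ?MX {z \<in> space ?MX. R z = j} = measure ?MY {z \<in> space ?MY. T z = j}"
    proof (cases j)
      case 0
      then show ?thesis using R' T' by simp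
    next
      case (Suc i)
      show ?thesis
      proof (cases "i < k")
        case True
        then show ?thesis using R' T' Suc by simp
      next
        case False
        then have "{z \<in> space ?MX. R z = j} = {}" "{z \<in> space ?MY. T z = j} = {}"
          using R' T' Suc by auto
        then show ?thesis by (simp only: measure_empty)
      qed
    qed
    moreover have "R -` {j} \<inter> space ?MX = {z \<in> space ?MX. R z = j}" "T -` {j} \<inter> space ?MY = {z \<in> space ?MY. T z = j}"
      by auto
    ultimately show "emeasure (distr ?MX (count_space UNIV) R) {j} = emeasure (distr ?MY (count_space UNIV) T) {j}"
      by (simp add: emeasure_distr PX.emeasure_eq_measure PY.emeasure_eq_measure)
  qed auto
  from glue_index[OF PX.prob_space_axioms PY.prob_space_axioms R T this]
  obtain \<Omega> where \<Omega>: "sets \<Omega> = sets (?MX \<Otimes>\<^sub>M ?MY)" "prob_space \<Omega>" "distr \<Omega> ?MX fst = ?MX"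
    "distr \<Omega> ?MY snd = ?MY" "AE z in \<Omega>. R (fst z) = T (snd z)"
    by blast
  interpret \<Omega>: prob_space \<Omega> by fact
  have mf[measurable]: "fst \<in> \<Omega> \<rightarrow>\<^sub>M ?MX" and ms[measurable]: "snd \<in> \<Omega> \<rightarrow>\<^sub>M ?MY"
    by (simp_all add: measurable_cong_sets[OF \<Omega>(1) refl])
  \<comment> \<open>A common index 0 carries no information about the cells and counts as a
    mismatch.\<close>
  define E where "E = {z \<in> space \<Omega>. R (fst z) \<noteq> 0 \<and> R (fst z) = T (snd z)}"
  have E[measurable]: "E \<in> sets \<Omega>" unfolding E_def by measurable
  \<comment> \<open>One \<open>e\<close> is the mass of the cells from \<open>k\<close> on, the
    other is the loss by rounding.\<close>
  have PE: "\<Omega>.prob E \<ge> 1 - 2 * e"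
  proof -
    define Z where "Z = {z \<in> space ?MX. R z = 0}"
    have Z: "Z \<in> sets ?MX" unfolding Z_def by measurable
    have "(\<Sum>i<k. m i) = X.pr.prob (\<Union>i<k. {x \<in> space (msr X). r x = i})"
      unfolding m_def by (rule X.pr.finite_measure_finite_Union[symmetric]) (auto simp: disjoint_family_on_def)
    also have "(\<Union>i<k. {x \<in> space (msr X). r x = i}) = {x \<in> space (msr X). r x < k}" by auto
    finally have "1 - e < (\<Sum>i<k. m i)" using kr by simp
    moreover have "(\<Sum>i<k. m i) \<le> (\<Sum>i<k. c i + 1 / L)"
    proof (rule sum_mono)
      fix i assume "i \<in> {..<k}"
      then show "m i \<le> c i + 1 / L" using fl(3)[of "m i"] by (simp add: c_def)
    qed
    moreover have "(\<Sum>i<k. c i + 1 / L) = (\<Sum>i<k. c i) + k / L"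
      by (simp add: sum.distrib)
    moreover have "k / L \<le> e" using L e by (simp add: divide_le_eq mult.commute pos_divide_le_eq)
    ultimately have "1 - 2 * e \<le> 1 - measure ?MX Z" using R' by (simp add: Z_def)
    also have "measure ?MX Z = measure (distr \<Omega> ?MX fst) Z"
      by (simp add: \<Omega>)
    also have "\<dots> = \<Omega>.prob (fst -` Z \<inter> space \<Omega>)"
      by (rule measure_distr[OF mf Z])
    also have "1 - \<dots> = \<Omega>.prob (space \<Omega> - (fst -` Z \<inter> space \<Omega>))"
      by (rule \<Omega>.prob_compl[symmetric, OF measurable_sets[OF mf Z]])
    also have "\<dots> = \<Omega>.prob E"
      using \<Omega>(5) measurable_space[OF mf] measurable_sets[OF mf Z]
      by (intro \<Omega>.finite_measure_eq_AE) (auto simp: E_def Z_def)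
    finally show ?thesis .
  qed
  \<comment> \<open>One \<open>e\<close> for the rounding of the features at the centres and one for
    each of the two cell radii; the factor 2 in the box distance makes it
    \<open>6 * e\<close>.\<close>
  have near: "\<bar>f (fst (fst z)) - g (fst (snd z))\<bar> \<le> 3 * e"
    if z: "z \<in> E" and f: "f \<in> feats X" and g: "g \<in> feats Y"
      and fg: "map (\<lambda>i. \<lfloor>f (w i) / e\<rfloor>) [0..<k] = map (\<lambda>i. \<lfloor>g (v i) / e\<rfloor>) [0..<k]" for z f g
  proof -
    obtain i where i: "R (fst z) = Suc i" "T (snd z) = Suc i"
      using z by (cases "R (fst z)") (auto simp: E_def)
    have i': "r (fst (fst z)) = i" "s (fst (snd z)) = i" "i < k" using R' T' i by blast+
    have zs: "z \<in> space \<Omega>" using z by (simp add: E_def)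
    have p: "fst (fst z) \<in> pts X" "fst (snd z) \<in> pts Y" "w i \<in> pts X" "v i \<in> pts Y"
      using measurable_space[OF mf zs] measurable_space[OF ms zs] w v
      by (auto simp: space_pair_measure X.space_msr Y.space_msr)
    have "\<lfloor>f (w i) / e\<rfloor> = \<lfloor>g (v i) / e\<rfloor>" using fg i'(3) by (simp add: map_eq_conv)
    then have "\<bar>f (w i) / e - g (v i) / e\<bar> < 1" by linarith
    then have "\<bar>f (w i) - g (v i)\<bar> < e"
      using e by (simp add: diff_divide_distrib[symmetric] abs_divide)
    moreover have "\<bar>f (fst (fst z)) - f (w i)\<bar> < e"
      using X.feats_lipschitz[OF f p(1,3)] rw[OF p(1)] i' by simp
    moreover have "\<bar>g (fst (snd z)) - g (v i)\<bar> < e"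
      using Y.feats_lipschitz[OF g p(2,4)] sv[OF p(2)] i' by simp
    ultimately show ?thesis by argo
  qed
  show ?thesis
  proof (rule box_distI[OF X Y \<Omega>(2), of "fst \<circ> fst" "fst \<circ> snd" E])
    show "fst \<circ> fst \<in> \<Omega> \<rightarrow>\<^sub>M msr X" "fst \<circ> snd \<in> \<Omega> \<rightarrow>\<^sub>M msr Y"
      by (rule measurable_comp[OF mf measurable_fst] measurable_comp[OF ms measurable_fst])+
    show "distr \<Omega> (msr X) (fst \<circ> fst) = msr X"
      using distr_distr[OF measurable_fst mf] distr_pair_marginals(1)[OF X.pr.prob_space_axioms U.prob_space_axioms]
      by (simp add: \<Omega>)
    show "distr \<Omega> (msr Y) (fst \<circ> snd) = msr Y"
      using distr_distr[OF measurable_fst ms] distr_pair_marginals(1)[OF Y.pr.prob_space_axioms U.prob_space_axioms]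
      by (simp add: \<Omega>)
    show "E \<in> sets \<Omega>" "1 - 6 * e \<le> \<Omega>.prob E" "0 \<le> 6 * e" using PE e by auto
  next
    fix f assume f: "f \<in> feats X"
    then obtain g where g: "g \<in> feats Y" "map (\<lambda>i. \<lfloor>f (w i) / e\<rfloor>) [0..<k] = map (\<lambda>i. \<lfloor>g (v i) / e\<rfloor>) [0..<k]"
      using features by blast
    then show "\<exists>g\<in>feats Y. \<forall>z\<in>E. \<bar>f ((fst \<circ> fst) z) - g ((fst \<circ> snd) z)\<bar> \<le> 6 * e / 2"
      using near[OF _ f g] by (intro bexI[OF _ g(1)]) simp
  next
    fix g assume g: "g \<in> feats Y"
    then obtain f where f: "f \<in> feats X" "map (\<lambda>i. \<lfloor>f (w i) / e\<rfloor>) [0..<k] = map (\<lambda>i. \<lfloor>g (v i) / e\<rfloor>) [0..<k]"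
      using features by (metis (no_types, lifting) image_iff)
    then show "\<exists>f\<in>feats X. \<forall>z\<in>E. \<bar>f ((fst \<circ> fst) z) - g ((fst \<circ> snd) z)\<bar> \<le> 6 * e / 2"
      using near[OF _ f(1) g f(2)] by (intro bexI[OF _ f(1)]) simp
  qed
qed

text \<open>The invariant \<open>t X\<close> takes countably many values: a number of cells, a list
  of integers and a set of integer lists that is finite because the features are bounded. One data
  set for each value that occurs forms the net.\<close>

lemma countable_box_net:
  assumes e: "0 < (e :: real)"
  shows "\<exists>C \<subseteq> gds_data_K :: 'a gds_data set. countable C \<and> (\<forall>X\<in>(gds_data_K :: 'a gds_data set). \<exists>Y\<in>C. box_dist X Y \<le> e)"
proof -
  define \<eta> where "\<eta> = e / 6"
  have \<eta>: "\<eta> > 0" using e by (simp add: \<eta>_def)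
  define good where "good X r w k \<longleftrightarrow> r \<in> msr X \<rightarrow>\<^sub>M count_space UNIV \<and> range w \<subseteq> pts X \<and>
     (\<forall>x\<in>pts X. gds_dist X x (w (r x)) < \<eta>) \<and> measure (msr X) {x \<in> space (msr X). r x < k} > 1 - \<eta>"
    for X :: "'a gds_data" and r :: "'a \<Rightarrow> nat" and w and k
  have "\<exists>r w k. good X r w k" if X: "X \<in> gds_data_K" for X
  proof -
    interpret X: gds X using X by unfold_locales (simp add: gds_data_K_def)
    obtain r :: "'a \<Rightarrow> nat" and w :: "nat \<Rightarrow> 'a" where
      r: "r \<in> msr X \<rightarrow>\<^sub>M count_space UNIV" "range w \<subseteq> pts X"
      "\<And>x. x \<in> pts X \<Longrightarrow> gds_dist X x (w (r x)) < \<eta>"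
      using X.net_index[OF \<eta>] by auto
    obtain k where k: "X.pr.prob {x \<in> space (msr X). r x < k} > 1 - \<eta>"
      using X.pr.index_tail[OF r(1) \<eta>] by auto
    have "good X r w k" using r k by (simp add: good_def)
    then show ?thesis by blast
  qed
  then obtain r w k where g: "\<And>X. X \<in> gds_data_K \<Longrightarrow> good X (r X) (w X) (k X)" by metis
  \<comment> \<open>The added 1 keeps the scale positive for \<open>k = 0\<close>.\<close>
  define L :: "nat \<Rightarrow> real" where "L k = k / \<eta> + 1" for k
  have L: "L k > 0" "k / \<eta> \<le> L k" for k using \<eta> by (auto simp: L_def add_nonneg_pos)
  define t where "t X = (k X,
      map (\<lambda>i. \<lfloor>measure (msr X) {x \<in> space (msr X). r X x = i} * L (k X)\<rfloor>) [0..<k X],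
      (\<lambda>f. map (\<lambda>i. \<lfloor>f (w X i) / \<eta>\<rfloor>) [0..<k X]) ` feats X)" for X
  have close: "box_dist X Y \<le> e" if X: "X \<in> gds_data_K" and Y: "Y \<in> gds_data_K" and XY: "t X = t Y" for X Y
  proof -
    have kk: "k X = k Y" using XY by (simp add: t_def)
    have "map (\<lambda>i. \<lfloor>measure (msr X) {x \<in> space (msr X). r X x = i} * L (k X)\<rfloor>) [0..<k X] =
        map (\<lambda>i. \<lfloor>measure (msr Y) {x \<in> space (msr Y). r Y x = i} * L (k X)\<rfloor>) [0..<k X]"
      using XY unfolding t_def prod.inject kk by blast
    note lists = this[unfolded map_eq_conv]
    have "box_dist X Y \<le> 6 * \<eta>"
    proof (rule box_dist_le_if_same_type[of X Y \<eta> "r X" "w X" "k X" "r Y" "w Y" "L (k X)"])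
      show "\<lfloor>measure (msr X) {x \<in> space (msr X). r X x = i} * L (k X)\<rfloor> =
        \<lfloor>measure (msr Y) {y \<in> space (msr Y). r Y y = i} * L (k X)\<rfloor>" if "i < k X" for i
        using lists that by auto
      show "(\<lambda>f. map (\<lambda>i. \<lfloor>f (w X i) / \<eta>\<rfloor>) [0..<k X]) ` feats X = (\<lambda>f. map (\<lambda>i. \<lfloor>f (w Y i) / \<eta>\<rfloor>) [0..<k X]) ` feats Y"
        using XY unfolding t_def prod.inject kk by blast
    qed (use X Y g[OF X] g[OF Y] \<eta> L kk in \<open>auto simp: gds_data_K_def good_def\<close>)
    then show ?thesis by (simp add: \<eta>_def)
  qed
  have "t X \<in> UNIV \<times> UNIV \<times> {A. finite A}" if X: "X \<in> gds_data_K" for X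
  proof -
    let ?I = "{\<lfloor>- 1 / 2 / \<eta>\<rfloor>..\<lfloor>1 / 2 / \<eta>\<rfloor>}"
    have wX: "w X i \<in> pts X" for i using g[OF X] by (auto simp: good_def)
    have "\<lfloor>f (w X i) / \<eta>\<rfloor> \<in> ?I" if "f \<in> feats X" for f i
    proof -
      have "- 1 / 2 \<le> f (w X i)" "f (w X i) \<le> 1 / 2" using X that wX by (auto simp: gds_data_K_def)
      then have "- 1 / 2 / \<eta> \<le> f (w X i) / \<eta>" "f (w X i) / \<eta> \<le> 1 / 2 / \<eta>"
        using \<eta> by (intro divide_right_mono; simp)+
      then show ?thesis by (simp add: floor_mono)
    qed
    then have "(\<lambda>f. map (\<lambda>i. \<lfloor>f (w X i) / \<eta>\<rfloor>) [0..<k X]) ` feats X \<subseteq> {xs. set xs \<subseteq> ?I \<and> length xs = k X}"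
      by auto
    moreover have "finite {xs. set xs \<subseteq> ?I \<and> length xs = k X}" by (rule finite_lists_length_eq) simp
    ultimately show ?thesis by (simp add: t_def finite_subset)
  qed
  then have "t ` gds_data_K \<subseteq> UNIV \<times> UNIV \<times> {A. finite A}" by blast
  moreover have "countable (UNIV \<times> UNIV \<times> {A. finite A} :: (nat \<times> int list \<times> int list set) set)"
    by (intro countable_SIGMA countable_Collect_finite) auto
  ultimately have cnt: "countable (t ` gds_data_K)" by (rule countable_subset)
  define C where "C = inv_into gds_data_K t ` t ` gds_data_K"
  have "countable C" unfolding C_def using cnt by (rule countable_image)
  moreover have "C \<subseteq> gds_data_K" unfolding C_def using inv_into_into[of _ t gds_data_K] by blast
  moreover have "\<exists>Y\<in>C. box_dist X Y \<le> e" if X: "X \<in> gds_data_K" for X :: "'a gds_data"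
  proof -
    let ?Y = "inv_into gds_data_K t (t X)"
    have "?Y \<in> gds_data_K" "t ?Y = t X"
      using X by (auto intro: inv_into_into f_inv_into_f)
    then show ?thesis using close[OF X, of ?Y] X unfolding C_def by auto
  qed
  ultimately show ?thesis by blast
qed

section \<open>Limits of Cauchy sequences\<close>

text \<open>The coordinate \<open>(n, i)\<close> of the product space is the state after step \<open>n\<close> of a chain that is
  in state \<open>i\<close> before this step.\<close>

lemma ex_markov_chain:
  fixes Q :: "nat \<Rightarrow> (nat \<times> nat) measure"
  assumes Q: "\<And>n. prob_space (Q n)" and sets_Q: "\<And>n. sets (Q n) = UNIV"
    and comp: "\<And>n. distr (Q n) (count_space UNIV) snd = distr (Q (Suc n)) (count_space UNIV) fst"
  shows "\<exists>(\<Omega> :: (nat \<times> nat \<Rightarrow> nat) measure) z. prob_space \<Omega> \<and>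
    (\<forall>n. z n \<in> \<Omega> \<rightarrow>\<^sub>M count_space UNIV) \<and>
    (\<forall>n. distr \<Omega> (count_space UNIV) (\<lambda>\<omega>. (z n \<omega>, z (Suc n) \<omega>)) = Q n)"
proof -
  have space_Q: "space (Q n) = UNIV" for n
    using sets_eq_imp_space_eq[of "Q n" "count_space UNIV"] sets_Q[of n] by simp
  have mQ: "f \<in> Q n \<rightarrow>\<^sub>M count_space UNIV" for f :: "nat \<times> nat \<Rightarrow> 'c" and n
    by (simp add: measurable_def sets_Q space_Q)
  have Q_fin: "emeasure (Q n) B < \<top>" for n B
    using finite_measure.emeasure_finite[of "Q n" B] prob_space.finite_measure[OF Q]
    by (auto simp: top.not_eq_extremum)
  define R where "R n i = {p :: nat \<times> nat. fst p = i}" for n i :: nat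
  \<comment> \<open>The conditional law of the second state given that the first is
    \<open>i\<close>. For a state of mass 0 any probability measure on \<open>nat\<close> would do;
    the first marginal is one at hand.\<close>
  define c where "c n i = (if emeasure (Q n) (R n i) = 0 then distr (Q n) (count_space UNIV) fst
     else distr (uniform_measure (Q n) (R n i)) (count_space UNIV) snd)" for n i
  have mU: "snd \<in> uniform_measure (Q n) (R n i) \<rightarrow>\<^sub>M count_space UNIV" for n i
    by (simp add: measurable_def sets_Q space_Q)
  have c_prob: "prob_space (c n i)" for n i
    using Q_fin[of n "R n i"]
    by (auto simp: c_def intro!: prob_space.prob_space_distr Q mQ mU prob_space_uniform_measure)
  have c_joint: "emeasure (Q n) (R n i) * emeasure (c n i) {j} = emeasure (Q n) {(i, j)}" for n i j
  proof (cases "emeasure (Q n) (R n i) = 0")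
    case True
    have "emeasure (Q n) {(i, j)} \<le> emeasure (Q n) (R n i)"
      by (rule emeasure_mono) (auto simp: R_def sets_Q)
    then show ?thesis using True by simp
  next
    case False
    have "snd -` {j} \<inter> space (uniform_measure (Q n) (R n i)) = {p. snd p = j}" by (auto simp: space_Q)
    then have "emeasure (c n i) {j} = emeasure (uniform_measure (Q n) (R n i)) {p. snd p = j}"
      using False by (simp add: c_def emeasure_distr[OF mU])
    also have "\<dots> = emeasure (Q n) (R n i \<inter> {p. snd p = j}) / emeasure (Q n) (R n i)"
      by (simp add: sets_Q)
    also have "R n i \<inter> {p. snd p = j} = {(i, j)}" by (auto simp: R_def)
    finally show ?thesis
      using False Q_fin[of n "R n i"] ennreal_mult_divide_eq[of "emeasure (Q n) (R n i)" "emeasure (Q n) {(i, j)}"]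
      by (simp add: ennreal_times_divide mult.commute less_top)
  qed
  \<comment> \<open>Step 0 draws the initial state from the first marginal of \<open>Q 0\<close>,
    whatever the previous state, and step \<open>Suc n\<close> uses the transitions of
    \<open>Q n\<close>. So \<open>y 0\<close> is a dummy constant and the chain is
    \<open>y (Suc n)\<close>.\<close>
  define k where "k p = (case fst p of 0 \<Rightarrow> distr (Q 0) (count_space UNIV) fst | Suc n \<Rightarrow> c n (snd p))"
    for p :: "nat \<times> nat"
  have k_prob: "prob_space (k p)" for p
    by (auto simp: k_def c_prob intro!: prob_space.prob_space_distr Q mQ split: nat.split)
  have sets_k: "sets (k p) = UNIV" for p
    by (auto simp: k_def c_def split: nat.split)
  have space_k: "space (k p) = UNIV" for p
    using sets_eq_imp_space_eq[of "k p" "count_space UNIV"] sets_k[of p] by simp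
  define S where "S = PiM UNIV k"
  interpret S: product_prob_space k UNIV
    by (rule product_prob_spaceI) (rule k_prob)
  have S_prob: "prob_space S" unfolding S_def by (rule prob_space_PiM) (rule k_prob)
  have space_S: "space S = UNIV" by (simp add: S_def space_PiM space_k PiE_UNIV_domain)
  have mS: "(\<lambda>\<omega>. \<omega> p) \<in> S \<rightarrow>\<^sub>M count_space UNIV" for p
    using measurable_component_singleton[of p UNIV k] sets_k[of p]
    by (simp add: S_def measurable_cong_sets[of _ _ "k p" "count_space UNIV"])
  define y :: "nat \<Rightarrow> (nat \<times> nat \<Rightarrow> nat) \<Rightarrow> nat" where "y = rec_nat (\<lambda>\<omega>. 0) (\<lambda>n f \<omega>. \<omega> (n, f \<omega>))"
  have y0: "y 0 \<omega> = 0" and yS: "y (Suc n) \<omega> = \<omega> (n, y n \<omega>)" for n and \<omega> :: "nat \<times> nat \<Rightarrow> nat"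
    by (simp_all add: y_def)
  have my: "y n \<in> S \<rightarrow>\<^sub>M count_space UNIV" for n
  proof (induction n)
    case 0
    have "y 0 = (\<lambda>_. 0)" by (simp add: fun_eq_iff y0)
    then show ?case by simp
  next
    case (Suc n)
    have "y (Suc n) = (\<lambda>\<omega>. \<omega> (n, y n \<omega>))" by (simp add: fun_eq_iff yS)
    then show ?case
      using measurable_compose_countable[where f = "\<lambda>i \<omega>. \<omega> (n, i)", OF mS Suc] by simp
  qed
  have cyl: "{\<omega>. \<forall>p\<in>J. \<omega> p \<in> B p} \<in> sets S" if "finite J" for J and B :: "nat \<times> nat \<Rightarrow> nat set"
    using that
  proof (induction J)
    case empty
    show ?case using sets.top[of S] by (simp add: space_S)
  next
    case (insert p J)
    have "{\<omega>. \<forall>p\<in>insert p J. \<omega> p \<in> B p} = (\<lambda>\<omega>. \<omega> p) -` B p \<inter> space S \<inter> {\<omega>. \<forall>p\<in>J. \<omega> p \<in> B p}"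
      by (auto simp: space_S)
    then show ?case using measurable_sets[OF mS, of "B p" p] insert by auto
  qed
  have ysets: "{\<omega>. y n \<omega> = i} \<in> sets S" for n i
    using measurable_sets[OF my, of "{i}" n] by (simp add: space_S vimage_def)
  \<comment> \<open>The state \<open>y n\<close> reads only coordinates of earlier steps and is
    therefore independent of those in \<open>J\<close>. The arbitrary cylinder is what carries the
    induction: for each value \<open>l\<close> of the previous state, the coordinate
    \<open>(n, l)\<close> is added to it.\<close>
  have past: "emeasure S {\<omega>. y n \<omega> = i \<and> (\<forall>p\<in>J. \<omega> p \<in> B p)} =
      emeasure S {\<omega>. y n \<omega> = i} * (\<Prod>p\<in>J. emeasure (k p) (B p))"
    if "finite J" "J \<subseteq> {p. n \<le> fst p}" for n i J and B :: "nat \<times> nat \<Rightarrow> nat set"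
    using that
  proof (induction n arbitrary: i J B)
    case 0
    have "emeasure S {\<omega>\<in>space S. \<forall>p\<in>J. \<omega> p \<in> B p} = (\<Prod>p\<in>J. emeasure (k p) (B p))"
      unfolding S_def using 0 by (intro S.emeasure_PiM_Collect) (auto simp: sets_k)
    then show ?case
      using prob_space.emeasure_space_1[OF S_prob] by (cases "i = 0") (auto simp: y0 space_S)
  next
    case (Suc n)
    have step: "emeasure S {\<omega>. y (Suc n) \<omega> = i \<and> (\<forall>p\<in>J. \<omega> p \<in> B p)} =
        (\<Sum>l. emeasure S {\<omega>. y n \<omega> = l} * emeasure (k (n, l)) {i}) * (\<Prod>p\<in>J. emeasure (k p) (B p))"
      if J: "finite J" "J \<subseteq> {p. Suc n \<le> fst p}" for J B
    proof -
      define D where "D l = {\<omega>. y n \<omega> = l \<and> (\<forall>p\<in>insert (n, l) J. \<omega> p \<in> (B((n, l) := {i})) p)}" for l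
      have notin: "(n, l) \<notin> J" for l using J by auto
      have upd: "(B((n, l) := {i})) p = B p" if "p \<in> J" for p l using notin that by auto
      have D_eq: "D l = {\<omega>. y n \<omega> = l \<and> \<omega> (n, l) = i \<and> (\<forall>p\<in>J. \<omega> p \<in> B p)}" for l
        using upd by (auto simp: D_def)
      have "D l = {\<omega>. y n \<omega> = l} \<inter> {\<omega>. \<forall>p\<in>insert (n, l) J. \<omega> p \<in> (B((n, l) := {i})) p}" for l
        by (auto simp: D_def)
      then have D_sets: "D l \<in> sets S" for l
        using ysets[of n l] cyl[of "insert (n, l) J" "B((n, l) := {i})"] J(1) by simp
      have "{\<omega>. y (Suc n) \<omega> = i \<and> (\<forall>p\<in>J. \<omega> p \<in> B p)} = (\<Union>l. D l)"
        by (auto simp: D_eq yS)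
      then have "emeasure S {\<omega>. y (Suc n) \<omega> = i \<and> (\<forall>p\<in>J. \<omega> p \<in> B p)} = (\<Sum>l. emeasure S (D l))"
        using D_sets by (subst suminf_emeasure) (auto simp: disjoint_family_on_def D_eq)
      also have "\<dots> = (\<Sum>l. emeasure S {\<omega>. y n \<omega> = l} * emeasure (k (n, l)) {i} * (\<Prod>p\<in>J. emeasure (k p) (B p)))"
      proof (rule suminf_cong)
        fix l
        have "emeasure S (D l) = emeasure S {\<omega>. y n \<omega> = l} *
            (\<Prod>p\<in>insert (n, l) J. emeasure (k p) ((B((n, l) := {i})) p))"
          unfolding D_def using J by (intro Suc.IH) auto
        also have "(\<Prod>p\<in>insert (n, l) J. emeasure (k p) ((B((n, l) := {i})) p)) =
            emeasure (k (n, l)) {i} * (\<Prod>p\<in>J. emeasure (k p) ((B((n, l) := {i})) p))"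
          using J notin by simp
        also have "(\<Prod>p\<in>J. emeasure (k p) ((B((n, l) := {i})) p)) = (\<Prod>p\<in>J. emeasure (k p) (B p))"
          by (rule prod.cong) (simp_all only: upd)
        finally show "emeasure S (D l) = emeasure S {\<omega>. y n \<omega> = l} * emeasure (k (n, l)) {i} * (\<Prod>p\<in>J. emeasure (k p) (B p))"
          by (simp add: mult.assoc)
      qed
      finally show ?thesis by (simp add: ennreal_suminf_multc)
    qed
    show ?case
      using step[OF Suc.prems, of B] step[of "{}" B] by simp
  qed
  have joint: "emeasure S {\<omega>. y n \<omega> = i \<and> y (Suc n) \<omega> = j} = emeasure S {\<omega>. y n \<omega> = i} * emeasure (k (n, i)) {j}"
    for n i j
  proof -
    have "{\<omega>. y n \<omega> = i \<and> y (Suc n) \<omega> = j} = {\<omega>. y n \<omega> = i \<and> (\<forall>p\<in>{(n, i)}. \<omega> p \<in> {j})}"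
      by (auto simp: yS)
    then show ?thesis using past[of "{(n, i)}" n i "\<lambda>_. {j}"] by simp
  qed
  have total: "emeasure S {\<omega>. y (Suc n) \<omega> = j} = (\<Sum>i. emeasure S {\<omega>. y n \<omega> = i \<and> y (Suc n) \<omega> = j})" for n j
  proof -
    have "{\<omega>. y n \<omega> = i \<and> y (Suc n) \<omega> = j} \<in> sets S" for i
    proof -
      have "{\<omega>. y n \<omega> = i \<and> y (Suc n) \<omega> = j} = {\<omega>. y n \<omega> = i} \<inter> {\<omega>. y (Suc n) \<omega> = j}" by auto
      then show ?thesis using ysets[of n i] ysets[of "Suc n" j] by simp
    qed
    then show ?thesis
      by (subst suminf_emeasure) (auto simp: disjoint_family_on_def intro!: arg_cong[where f = "emeasure S"])
  qed
  \<comment> \<open>The hypothesis \<open>comp\<close> enters here: the second marginal of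
    \<open>Q n\<close> becomes the first one of \<open>Q (Suc n)\<close>.\<close>
  have marginal: "emeasure S {\<omega>. y (Suc n) \<omega> = i} = emeasure (Q n) (R n i)" for n i
  proof (induction n arbitrary: i)
    case 0
    have "emeasure S {\<omega>. y (Suc 0) \<omega> = i} = emeasure S {\<omega>. y 0 \<omega> = 0 \<and> y (Suc 0) \<omega> = i}"
      by (simp add: y0)
    also have "\<dots> = emeasure S {\<omega>. y 0 \<omega> = 0} * emeasure (k (0, 0)) {i}" by (rule joint)
    also have "emeasure S {\<omega>. y 0 \<omega> = 0} = 1"
      using prob_space.emeasure_space_1[OF S_prob] by (simp add: y0 space_S)
    also have "1 * emeasure (k (0, 0)) {i} = emeasure (Q 0) (R 0 i)"
      by (simp add: k_def emeasure_distr[OF mQ] space_Q R_def vimage_def)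
    finally show ?case .
  next
    case (Suc n)
    have "emeasure S {\<omega>. y (Suc (Suc n)) \<omega> = i} = (\<Sum>l. emeasure (Q n) {(l, i)})"
      unfolding total[of "Suc n"] joint Suc by (simp add: k_def c_joint)
    also have "\<dots> = emeasure (Q n) (\<Union>l. {(l, i)})"
      by (rule suminf_emeasure) (auto simp: sets_Q disjoint_family_on_def)
    also have "(\<Union>l. {(l, i)}) = snd -` {i} \<inter> space (Q n)" by (auto simp: space_Q)
    also have "emeasure (Q n) \<dots> = emeasure (distr (Q n) (count_space UNIV) snd) {i}"
      by (rule emeasure_distr[symmetric, OF mQ]) simp
    also have "\<dots> = emeasure (Q (Suc n)) (R (Suc n) i)"
      unfolding comp by (simp add: emeasure_distr[OF mQ] space_Q R_def vimage_def)
    finally show ?case .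
  qed
  have "distr S (count_space UNIV) (\<lambda>\<omega>. (y (Suc n) \<omega>, y (Suc (Suc n)) \<omega>)) = Q n" for n
  proof (rule measure_eqI_countable[of _ UNIV])
    have m: "(\<lambda>\<omega>. (y (Suc n) \<omega>, y (Suc (Suc n)) \<omega>)) \<in> S \<rightarrow>\<^sub>M count_space UNIV"
      using measurable_Pair[OF my[of "Suc n"] my[of "Suc (Suc n)"]]
      by (simp add: pair_measure_countable)
    fix p :: "nat \<times> nat" assume "p \<in> UNIV"
    obtain i j where p: "p = (i, j)" by (cases p)
    have "emeasure (distr S (count_space UNIV) (\<lambda>\<omega>. (y (Suc n) \<omega>, y (Suc (Suc n)) \<omega>))) {p} =
        emeasure S {\<omega>. y (Suc n) \<omega> = i \<and> y (Suc (Suc n)) \<omega> = j}"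
      by (subst emeasure_distr[OF m]) (auto simp: p space_S intro!: arg_cong[where f = "emeasure S"])
    also have "\<dots> = emeasure (Q n) {p}"
      by (simp only: joint marginal) (simp add: k_def c_joint p)
    finally show "emeasure (distr S (count_space UNIV) (\<lambda>\<omega>. (y (Suc n) \<omega>, y (Suc (Suc n)) \<omega>))) {p} = emeasure (Q n) {p}" .
  qed (auto simp: sets_Q)
  then show ?thesis
    using S_prob my by (intro exI[of _ S] exI[of _ "\<lambda>n. y (Suc n)"]) simp
qed

section \<open>Supports of measures and the data set of evaluations\<close>

definition measure_support :: "'b::metric_space measure \<Rightarrow> 'b set" where
  "measure_support \<mu> = {u. \<forall>r>0. emeasure \<mu> (ball u r) > 0}"

lemma closed_measure_support:
  fixes \<mu> :: "'b::metric_space measure"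
  assumes sets: "sets \<mu> = sets borel"
  shows "closed (measure_support \<mu>)"
proof -
  have "u \<in> measure_support \<mu>" if u: "u \<in> closure (measure_support \<mu>)" for u
    unfolding measure_support_def mem_Collect_eq
  proof (intro allI impI)
    fix r :: real assume r: "r > 0"
    then obtain v where v: "v \<in> measure_support \<mu>" "dist v u < r / 2"
      using u unfolding closure_approachable by (meson half_gt_zero)
    have "0 < emeasure \<mu> (ball v (r / 2))" using v r by (simp add: measure_support_def)
    also have "\<dots> \<le> emeasure \<mu> (ball u r)"
    proof (rule emeasure_mono)
      show "ball v (r / 2) \<subseteq> ball u r"
      proof
        fix y assume "y \<in> ball v (r / 2)"
        then show "y \<in> ball u r" using v dist_triangle[of u y v] by (simp add: dist_commute)
      qed
    qed (simp add: sets)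
    finally show "0 < emeasure \<mu> (ball u r)" .
  qed
  then have "closure (measure_support \<mu>) \<subseteq> measure_support \<mu>" by blast
  then show ?thesis by (simp add: closure_subset_eq)
qed

lemma measure_support_subset:
  fixes \<mu> :: "'b::metric_space measure"
  assumes sets: "sets \<mu> = sets borel" and C: "closed C" "emeasure \<mu> (- C) = 0"
  shows "measure_support \<mu> \<subseteq> C"
proof
  fix u assume u: "u \<in> measure_support \<mu>"
  show "u \<in> C"
  proof (rule ccontr)
    assume "u \<notin> C"
    then obtain r where r: "r > 0" "ball u r \<subseteq> - C"
      using C(1) unfolding closed_def open_contains_ball by blast
    have "emeasure \<mu> (ball u r) \<le> emeasure \<mu> (- C)"
      using r(2) C(1) by (intro emeasure_mono) (auto simp: sets)
    then show False using u r C(2) by (auto simp: measure_support_def)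
  qed
qed

text \<open>Without separability the complement of the support is merely a possibly uncountable
  union of null balls. Inside the closure of the countable set \<open>D\<close>, countably many null
  balls with centres in \<open>D\<close> suffice.\<close>

lemma emeasure_Compl_measure_support:
  fixes \<mu> :: "'b::metric_space measure"
  assumes sets: "sets \<mu> = sets borel" and D: "countable D" "emeasure \<mu> (- closure D) = 0"
  shows "emeasure \<mu> (- measure_support \<mu>) = 0"
proof -
  define I where "I = {(d, k). d \<in> D \<and> emeasure \<mu> (ball d (1 / real (Suc k))) = 0}"
  define N where "N = (\<Union>(d, k)\<in>I. ball d (1 / real (Suc k)))"
  have "I \<subseteq> D \<times> UNIV" by (auto simp: I_def)
  then have I: "countable I" by (rule countable_subset) (use D in auto)
  have "N \<in> null_sets \<mu>"
    unfolding N_def by (rule null_sets_UN'[OF I]) (auto simp: I_def null_sets_def sets)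
  moreover have "- closure D \<in> null_sets \<mu>" using D by (simp add: null_sets_def sets)
  ultimately have null: "- closure D \<union> N \<in> null_sets \<mu>" by (rule null_sets.Un[rotated])
  have "- measure_support \<mu> \<subseteq> - closure D \<union> N"
  proof
    fix u assume "u \<in> - measure_support \<mu>"
    then obtain r where r: "r > 0" "emeasure \<mu> (ball u r) = 0"
      by (auto simp: measure_support_def not_less)
    show "u \<in> - closure D \<union> N"
    proof (cases "u \<in> closure D")
      case True
      obtain k where k: "1 / real (Suc k) < r / 2" using r nat_approx_posE[of "r / 2"] by auto
      obtain d where d: "d \<in> D" "dist d u < 1 / real (Suc k)"
        using True unfolding closure_approachable
        by (metis of_nat_0_less_iff zero_less_Suc zero_less_divide_1_iff)
      have "ball d (1 / real (Suc k)) \<subseteq> ball u r"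
      proof
        fix y assume "y \<in> ball d (1 / real (Suc k))"
        then show "y \<in> ball u r" using d k dist_triangle[of u y d] by (simp add: dist_commute)
      qed
      then have "emeasure \<mu> (ball d (1 / real (Suc k))) \<le> emeasure \<mu> (ball u r)"
        by (intro emeasure_mono) (simp_all add: sets)
      then have "(d, k) \<in> I" using d r by (simp add: I_def)
      moreover have "u \<in> ball d (1 / real (Suc k))" using d by simp
      ultimately show ?thesis unfolding N_def by blast
    qed simp
  qed
  then have "emeasure \<mu> (- measure_support \<mu>) \<le> emeasure \<mu> (- closure D \<union> N)"
    using null by (intro emeasure_mono) auto
  then show ?thesis using null by auto
qed

text \<open>For a law on functions that vanish off \<open>T\<close>, the metric induced by these features is the sup
  norm distance.\<close>

definition evaluation_gds :: "'t set \<Rightarrow> ('t discrete \<Rightarrow>\<^sub>C real) measure \<Rightarrow> ('t discrete \<Rightarrow>\<^sub>C real) gds_data" where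
  "evaluation_gds T \<mu> = \<lparr>pts = measure_support \<mu>,
     feats = (\<lambda>t. restrict (\<lambda>u. apply_bcontfun u (discrete t)) (measure_support \<mu>)) ` T,
     msr = restrict_space \<mu> (measure_support \<mu>)\<rparr>"

text \<open>By \<open>dL\<close> the induced metric is the sup norm distance on the support.
  Completeness then follows from closedness of the support, separability from \<open>D\<close>, and
  full support from the definition of the support together with the null complement.\<close>

lemma geometric_data_set_evaluation_gds:
  fixes \<mu> :: "('t discrete \<Rightarrow>\<^sub>C real) measure"
  assumes \<mu>: "prob_space \<mu>" and sets: "sets \<mu> = sets borel"
    and D: "countable D" "emeasure \<mu> (- closure D) = 0"
    and T: "T \<noteq> {}" and zero: "\<And>u t. u \<in> D \<Longrightarrow> t \<notin> T \<Longrightarrow> apply_bcontfun u (discrete t) = 0"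
  shows "geometric_data_set (evaluation_gds T \<mu>)"
proof -
  interpret \<mu>: prob_space \<mu> by fact
  define P where "P = measure_support \<mu>"
  define L where "L = evaluation_gds T \<mu>"
  have ptsL: "pts L = P" and featsL: "feats L = (\<lambda>t. restrict (\<lambda>u. apply_bcontfun u (discrete t)) P) ` T"
    and msrL: "msr L = restrict_space \<mu> P"
    by (simp_all add: L_def evaluation_gds_def P_def)
  have closed: "closed P" unfolding P_def by (rule closed_measure_support[OF sets])
  then have Pm: "P \<in> sets \<mu>" by (simp add: sets)
  have sp: "space \<mu> = UNIV" using sets_eq_imp_space_eq[OF sets] by simp
  have PD: "P \<subseteq> closure D" unfolding P_def by (rule measure_support_subset[OF sets _ D(2)]) simp
  have "emeasure \<mu> (- P) = 0" unfolding P_def by (rule emeasure_Compl_measure_support[OF sets D])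
  then have P1: "emeasure \<mu> P = 1"
    using \<mu>.prob_compl[OF Pm] Pm by (simp add: sp \<mu>.emeasure_eq_measure Compl_eq_Diff_UNIV)
  \<comment> \<open>Vanishing at a coordinate is a closed condition and passes from \<open>D\<close>
    to its closure. Without it the features, indexed by \<open>T\<close>, would miss part of the sup
    norm.\<close>
  have off: "apply_bcontfun u (discrete t) = 0" if "u \<in> P" "t \<notin> T" for u t
  proof -
    have "closed (PiC {discrete t} (\<lambda>_. {0 :: real}))" by (rule closed_PiC) simp
    moreover have "D \<subseteq> PiC {discrete t} (\<lambda>_. {0})" using zero that by (auto simp: mem_PiC_iff)
    ultimately have "closure D \<subseteq> PiC {discrete t} (\<lambda>_. {0})" by (rule closure_minimal[rotated])
    then show ?thesis using that PD by (auto simp: mem_PiC_iff)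
  qed
  have coord: "\<bar>apply_bcontfun u (discrete t) - apply_bcontfun v (discrete t)\<bar> \<le> dist u v" for u v :: "'t discrete \<Rightarrow>\<^sub>C real" and t
    using dist_bounded[of u "discrete t" v] by (simp add: dist_real_def)
  have bdd: "bdd_above ((\<lambda>f. \<bar>f u - f v\<bar>) ` feats L)" if "u \<in> P" "v \<in> P" for u v
    by (rule bdd_aboveI[of _ "dist u v"]) (use coord that in \<open>auto simp: featsL\<close>)
  have dL: "gds_dist L u v = dist u v" if uv: "u \<in> P" "v \<in> P" for u v
  proof -
    have "(SUP f\<in>feats L. \<bar>f u - f v\<bar>) \<le> dist u v"
      by (rule cSUP_least) (use T coord uv in \<open>auto simp: featsL\<close>)
    moreover have "dist u v \<le> (SUP f\<in>feats L. \<bar>f u - f v\<bar>)"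
    proof (rule dist_bound)
      fix d :: "'t discrete"
      obtain t where d: "d = discrete t" by (cases d)
      show "dist (apply_bcontfun u d) (apply_bcontfun v d) \<le> (SUP f\<in>feats L. \<bar>f u - f v\<bar>)"
      proof (cases "t \<in> T")
        case True
        then have "restrict (\<lambda>u. apply_bcontfun u (discrete t)) P \<in> feats L" by (simp add: featsL)
        then show ?thesis
          using uv by (intro cSUP_upper2[OF bdd[OF uv]]) (auto simp: d dist_real_def)
      next
        case False
        obtain t' where "t' \<in> T" using T by blast
        then have "restrict (\<lambda>u. apply_bcontfun u (discrete t')) P \<in> feats L" by (simp add: featsL)
        then have "0 \<le> (SUP f\<in>feats L. \<bar>f u - f v\<bar>)"
          by (intro cSUP_upper2[OF bdd[OF uv]]) auto
        then show ?thesis using off[OF uv(1) False] off[OF uv(2) False] by (simp add: d)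
      qed
    qed
    ultimately show ?thesis using uv by (simp add: gds_dist_def ptsL)
  qed
  have d0: "gds_dist L u v = 0" if "\<not> (u \<in> P \<and> v \<in> P)" for u v
    using that by (auto simp: gds_dist_def ptsL)
  interpret Lm: Metric_space P "gds_dist L"
  proof
    show "0 \<le> gds_dist L u v" for u v by (cases "u \<in> P \<and> v \<in> P") (auto simp: dL d0)
    show "gds_dist L u v = gds_dist L v u" for u v
      by (auto simp: gds_dist_def abs_minus_commute)
    show "gds_dist L u v = 0 \<longleftrightarrow> u = v" if "u \<in> P" "v \<in> P" for u v
      using that by (simp add: dL)
    show "gds_dist L u w \<le> gds_dist L u v + gds_dist L v w" if "u \<in> P" "v \<in> P" "w \<in> P" for u v w
      using that by (simp add: dL dist_triangle)
  qed
  have topo: "gds_topology L = Lm.mtopology" by (simp add: gds_topology_def ptsL)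
  have mball: "Lm.mball u r = ball u r \<inter> P" if "u \<in> P" for u r
    using that by (auto simp: dL)
  have openin_iff: "openin Lm.mtopology U \<longleftrightarrow> (\<exists>V. open V \<and> U = P \<inter> V)" for U
  proof
    assume U: "openin Lm.mtopology U"
    then have US: "U \<subseteq> P" and ex: "\<exists>r>0. Lm.mball u r \<subseteq> U" if "u \<in> U" for u
      using that unfolding Lm.openin_mtopology by blast+
    have "\<exists>r>0. ball u r \<inter> P \<subseteq> U" if u: "u \<in> U" for u
    proof -
      have "u \<in> P" using US u by blast
      then show ?thesis using ex[OF u] by (simp only: mball)
    qed
    then obtain r where r: "\<And>u. u \<in> U \<Longrightarrow> r u > 0 \<and> ball u (r u) \<inter> P \<subseteq> U" by metis
    have "U = P \<inter> (\<Union>u\<in>U. ball u (r u))"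
    proof (intro equalityI subsetI)
      fix u assume "u \<in> U"
      then have "u \<in> P" "u \<in> ball u (r u)" using US r by auto
      then show "u \<in> P \<inter> (\<Union>u\<in>U. ball u (r u))" using \<open>u \<in> U\<close> by blast
    next
      fix u assume "u \<in> P \<inter> (\<Union>u\<in>U. ball u (r u))"
      then obtain x where "x \<in> U" "u \<in> ball x (r x) \<inter> P" by blast
      then show "u \<in> U" using r by blast
    qed
    moreover have "open (\<Union>u\<in>U. ball u (r u))" by (intro open_UN ballI open_ball)
    ultimately show "\<exists>V. open V \<and> U = P \<inter> V"
      by (intro exI[of _ "\<Union>u\<in>U. ball u (r u)"] conjI)
  next
    assume "\<exists>V. open V \<and> U = P \<inter> V"
    then obtain V where V: "open V" "U = P \<inter> V" by blast
    show "openin Lm.mtopology U"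
      unfolding Lm.openin_mtopology
    proof (intro conjI allI impI)
      fix u assume u: "u \<in> U"
      then obtain r where "r > 0" "ball u r \<subseteq> V" using V by (meson IntD2 open_contains_ball)
      then show "\<exists>r>0. Lm.mball u r \<subseteq> U" using mball[of u] u V by blast
    qed (use V in blast)
  qed
  have mcomp: "Lm.mcomplete"
    unfolding Lm.mcomplete_def
  proof (intro allI impI)
    fix \<sigma> assume \<sigma>: "Lm.MCauchy \<sigma>"
    then have r: "\<sigma> n \<in> P" for n by (auto simp: Lm.MCauchy_def)
    have "Cauchy \<sigma>" using \<sigma> r by (auto simp: Lm.MCauchy_def Cauchy_def dL)
    then obtain l where l: "\<sigma> \<longlonglongrightarrow> l" using Cauchy_convergent convergent_def by blast
    then have "l \<in> P" using closed r closed_sequentially by blast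
    moreover have "\<exists>N. \<forall>n\<ge>N. dist (\<sigma> n) l < e" if "e > 0" for e
      using l that by (simp add: lim_sequentially)
    ultimately have "limitin Lm.mtopology \<sigma> l sequentially"
      unfolding Lm.limit_metric_sequentially using r by (simp add: dL)
    then show "\<exists>x. limitin Lm.mtopology \<sigma> x sequentially" by blast
  qed
  have sep: "separable_space Lm.mtopology"
  proof -
    \<comment> \<open>The points of \<open>D\<close> need not belong to the support, so a point of
      the support is chosen from each ball around them that meets it.\<close>
    define I where "I = {(d, k). d \<in> D \<and> ball d (1 / real (Suc k)) \<inter> P \<noteq> {}}"
    have "I \<subseteq> D \<times> UNIV" by (auto simp: I_def)
    then have I: "countable I" by (rule countable_subset) (use D in auto)
    have "\<exists>u. u \<in> ball (fst i) (1 / real (Suc (snd i))) \<inter> P" if "i \<in> I" for i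
      using that by (auto simp: I_def)
    then obtain c where c: "\<And>i. i \<in> I \<Longrightarrow> c i \<in> ball (fst i) (1 / real (Suc (snd i))) \<inter> P" by metis
    have "u \<in> Lm.mtopology closure_of (c ` I)" if u: "u \<in> P" for u
      unfolding Lm.metric_closure_of mem_Collect_eq
    proof (intro conjI u allI impI)
      fix r :: real assume r: "r > 0"
      obtain k where k: "1 / real (Suc k) < r / 2" using r nat_approx_posE[of "r / 2"] by auto
      obtain d where d: "d \<in> D" "dist d u < 1 / real (Suc k)"
        using u PD unfolding closure_approachable
        by (metis of_nat_0_less_iff zero_less_Suc zero_less_divide_1_iff subsetD closure_approachable)
      then have i: "(d, k) \<in> I" using u by (auto simp: I_def)
      have "dist u (c (d, k)) < r" using c[OF i] d k dist_triangle[of u "c (d, k)" d] by (simp add: dist_commute)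
      then show "\<exists>v\<in>c ` I. v \<in> Lm.mball u r" using i c[OF i] u mball[of u r] by auto
    qed
    then have "Lm.mtopology closure_of (c ` I) = P"
      using closure_of_subset_topspace[of Lm.mtopology "c ` I"] by auto
    moreover have "c ` I \<subseteq> P" using c by auto
    ultimately show ?thesis
      unfolding separable_space_def using I by (intro exI[of _ "c ` I"]) auto
  qed
  have setsL: "sets (msr L) = sets (borel_of Lm.mtopology)"
  proof -
    have "sets (msr L) = (\<inter>) P ` sigma_sets UNIV {S. open S}"
      by (simp add: msrL sets_restrict_space sets borel_def)
    also have "\<dots> = sigma_sets P ((\<inter>) P ` {S. open S})"
      by (rule sigma_sets_Int) (use Pm in \<open>auto simp: sets borel_def\<close>)
    also have "(\<inter>) P ` {S. open S} = {U. openin Lm.mtopology U}"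
      by (auto simp: openin_iff)
    finally show ?thesis by (simp add: sets_borel_of)
  qed
  have "prob_space (msr L)" unfolding msrL by (rule prob_space_restrict_space[OF Pm P1])
  moreover have "emeasure (msr L) U > 0" if U: "openin Lm.mtopology U" "U \<noteq> {}" for U
  proof -
    obtain u where u: "u \<in> U" using U by blast
    obtain V where V: "open V" "U = P \<inter> V" using U(1) unfolding openin_iff by blast
    then have uP: "u \<in> P" and uV: "u \<in> V" using u by auto
    obtain r where r: "r > 0" "ball u r \<subseteq> V" using V(1) uV open_contains_ball by blast
    have Um: "U \<in> sets \<mu>" using Pm V by (auto simp: sets)
    have bm: "ball u r \<in> sets \<mu>" by (simp add: sets)
    have "0 < emeasure \<mu> (ball u r)" using uP r by (simp add: P_def measure_support_def)
    also have "\<dots> \<le> emeasure \<mu> (U \<union> - P)"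
      using r V Um Pm by (intro emeasure_mono) (auto simp: sets)
    also have "\<dots> \<le> emeasure \<mu> U + emeasure \<mu> (- P)"
      using Um Pm by (intro emeasure_subadditive) (auto simp: sets)
    also have "\<dots> = emeasure (msr L) U"
      using \<open>emeasure \<mu> (- P) = 0\<close> V Pm by (simp add: msrL emeasure_restrict_space sp)
    finally show ?thesis .
  qed
  ultimately have "geometric_data_set L"
    unfolding geometric_data_set_def topo ptsL
    using T bdd Lm.Metric_space_axioms mcomp sep setsL by (auto simp: featsL)
  then show ?thesis by (simp add: L_def)
qed

text \<open>Forward continuation is dependent choice, while backward continuation needs only
  finitely many choices. The induction shifts the sequence by one and prepends a single
  partner.\<close>

lemma ex_thread:
  fixes F :: "nat \<Rightarrow> 'f set" and R :: "nat \<Rightarrow> 'f \<Rightarrow> 'f \<Rightarrow> bool"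
  assumes "\<And>n f. f \<in> F n \<Longrightarrow> \<exists>g\<in>F (Suc n). R n f g"
    and "\<And>n g. g \<in> F (Suc n) \<Longrightarrow> \<exists>f\<in>F n. R n f g"
    and "f \<in> F n"
  shows "\<exists>t. (\<forall>m. t m \<in> F m \<and> R m (t m) (t (Suc m))) \<and> t n = f"
  using assms
proof (induction n arbitrary: F R f)
  case 0
  have "\<exists>t. \<forall>m. (t m \<in> F m \<and> (m = 0 \<longrightarrow> t m = f)) \<and> R m (t m) (t (Suc m))"
  proof (rule dependent_nat_choice)
    show "\<exists>x. x \<in> F 0 \<and> (0 = (0 :: nat) \<longrightarrow> x = f)" using 0(3) by blast
    fix x m assume "x \<in> F m \<and> (m = 0 \<longrightarrow> x = f)"
    then show "\<exists>y. (y \<in> F (Suc m) \<and> (Suc m = 0 \<longrightarrow> y = f)) \<and> R m x y" using 0(1)[of x m] by auto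
  qed
  then show ?case by blast
next
  case (Suc n)
  have "\<exists>t. (\<forall>m. t m \<in> F (Suc m) \<and> R (Suc m) (t m) (t (Suc m))) \<and> t n = f"
    by (rule Suc.IH) (use Suc.prems in auto)
  then obtain t where t: "\<And>m. t m \<in> F (Suc m)" "\<And>m. R (Suc m) (t m) (t (Suc m))" "t n = f" by blast
  obtain f0 where f0: "f0 \<in> F 0" "R 0 f0 (t 0)" using Suc.prems(2)[OF t(1)[of 0]] by blast
  have "case_nat f0 t m \<in> F m \<and> R m (case_nat f0 t m) (case_nat f0 t (Suc m))" for m
    by (cases m) (use t f0 in auto)
  then show ?case using t(3) by (intro exI[of _ "case_nat f0 t"]) auto
qed

text \<open>The common features of the \<open>X n\<close> and of their limit are the threads \<open>t \<in> T\<close>: sequences of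
  features, one of each \<open>X n\<close>, that agree approximately along the couplings. A Markov chain of cells
  \<open>z n\<close> glues the couplings; the evaluations of the threads at the cell centres \<open>w n (z n)\<close>
  converge uniformly almost surely, and the law of the limit is the limit data set.\<close>

lemma ex_box_limit:
  fixes X :: "nat \<Rightarrow> 'a gds_data"
  assumes XK: "\<And>n. X n \<in> gds_data_K" and close: "\<And>n. box_dist (X n) (X (Suc n)) < (1/2) ^ n"
  shows "\<exists>L :: ((nat \<Rightarrow> 'a \<Rightarrow> real) discrete \<Rightarrow>\<^sub>C real) gds_data.
    L \<in> gds_data_K \<and> (\<lambda>n. box_dist (X n) L) \<longlonglongrightarrow> 0"
proof -
  have gX: "geometric_data_set (X n)" for n using XK by (simp add: gds_data_K_def)
  interpret X: gds "X n" for n by unfold_locales (rule gX)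
  define e :: "nat \<Rightarrow> real" where "e n = (1/2) ^ n" for n
  have e: "e n > 0" "e (Suc n) = e n / 2" for n by (simp_all add: e_def)
  have "\<exists>\<pi> S. box_coupling (X n) (X (Suc n)) (e n) \<pi> S" for n
    by (rule ex_box_coupling[OF gX gX]) (simp add: close e_def)
  then obtain \<pi> S where \<pi>: "\<And>n. box_coupling (X n) (X (Suc n)) (e n) (\<pi> n) (S n)" by metis
  note \<pi>' = \<pi>[unfolded box_coupling_def]
  have "\<exists>(r :: 'a \<Rightarrow> nat) w. r \<in> msr (X n) \<rightarrow>\<^sub>M count_space UNIV \<and> range w \<subseteq> pts (X n) \<and>
      (\<forall>x\<in>pts (X n). gds_dist (X n) x (w (r x)) < e n)" for n
  proof -
    obtain r :: "'a \<Rightarrow> nat" and w :: "nat \<Rightarrow> 'a" where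
      "r \<in> msr (X n) \<rightarrow>\<^sub>M count_space UNIV" "range w \<subseteq> pts (X n)"
      "\<And>x. x \<in> pts (X n) \<Longrightarrow> gds_dist (X n) x (w (r x)) < e n"
      using X.net_index[OF e(1)[of n], of n] by auto
    then show ?thesis by blast
  qed
  then obtain r :: "nat \<Rightarrow> 'a \<Rightarrow> nat" and w where
    r: "\<And>n. r n \<in> msr (X n) \<rightarrow>\<^sub>M count_space UNIV" and w0: "\<And>n. range (w n) \<subseteq> pts (X n)"
    and rw: "\<And>n x. x \<in> pts (X n) \<Longrightarrow> gds_dist (X n) x (w n (r n x)) < e n"
    by metis
  have w: "w n i \<in> pts (X n)" for n i using w0 by auto

  \<comment> \<open>The laws of consecutive cells and their Markov chain\<close>
  have m1: "r n \<circ> fst \<in> \<pi> n \<rightarrow>\<^sub>M count_space UNIV" and m2: "r (Suc n) \<circ> snd \<in> \<pi> n \<rightarrow>\<^sub>M count_space UNIV" for n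
    by (rule measurable_comp[OF _ r], use \<pi>' in blast)+
  define Q where "Q n = distr (\<pi> n) (count_space UNIV) (\<lambda>p. (r n (fst p), r (Suc n) (snd p)))" for n
  have mQ: "(\<lambda>p. (r n (fst p), r (Suc n) (snd p))) \<in> \<pi> n \<rightarrow>\<^sub>M count_space UNIV" for n
    using measurable_Pair[OF m1 m2, of n] by (simp add: pair_measure_countable comp_def)
  have prob_\<pi>: "prob_space (\<pi> n)" for n using \<pi>' by blast
  have Q1: "distr (Q n) (count_space UNIV) fst = distr (msr (X n)) (count_space UNIV) (r n)" for n
  proof -
    have "distr (Q n) (count_space UNIV) fst = distr (\<pi> n) (count_space UNIV) (fst \<circ> (\<lambda>p. (r n (fst p), r (Suc n) (snd p))))"
      unfolding Q_def by (rule distr_distr[OF _ mQ]) simp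
    also have "\<dots> = distr (\<pi> n) (count_space UNIV) (r n \<circ> fst)" by (simp add: comp_def)
    also have "\<dots> = distr (distr (\<pi> n) (msr (X n)) fst) (count_space UNIV) (r n)"
      by (rule distr_distr[symmetric, OF r]) (use \<pi>' in blast)
    finally show ?thesis using \<pi>' by simp
  qed
  have Q2: "distr (Q n) (count_space UNIV) snd = distr (msr (X (Suc n))) (count_space UNIV) (r (Suc n))" for n
  proof -
    have "distr (Q n) (count_space UNIV) snd = distr (\<pi> n) (count_space UNIV) (snd \<circ> (\<lambda>p. (r n (fst p), r (Suc n) (snd p))))"
      unfolding Q_def by (rule distr_distr[OF _ mQ]) simp
    also have "\<dots> = distr (\<pi> n) (count_space UNIV) (r (Suc n) \<circ> snd)" by (simp add: comp_def)
    also have "\<dots> = distr (distr (\<pi> n) (msr (X (Suc n))) snd) (count_space UNIV) (r (Suc n))"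
      by (rule distr_distr[symmetric, OF r]) (use \<pi>' in blast)
    finally show ?thesis using \<pi>' by simp
  qed
  have "\<exists>(\<Omega> :: (nat \<times> nat \<Rightarrow> nat) measure) z. prob_space \<Omega> \<and>
    (\<forall>n. z n \<in> \<Omega> \<rightarrow>\<^sub>M count_space UNIV) \<and>
    (\<forall>n. distr \<Omega> (count_space UNIV) (\<lambda>\<omega>. (z n \<omega>, z (Suc n) \<omega>)) = Q n)"
  proof (rule ex_markov_chain)
    show "prob_space (Q n)" for n
      unfolding Q_def by (rule prob_space.prob_space_distr[OF prob_\<pi> mQ])
    show "sets (Q n) = UNIV" for n by (simp add: Q_def)
    show "distr (Q n) (count_space UNIV) snd = distr (Q (Suc n)) (count_space UNIV) fst" for n
      by (simp add: Q1 Q2)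
  qed
  then obtain \<Omega> :: "(nat \<times> nat \<Rightarrow> nat) measure" and z where \<Omega>: "prob_space \<Omega>"
    and z[measurable]: "\<And>n. z n \<in> \<Omega> \<rightarrow>\<^sub>M count_space UNIV"
    and zQ: "\<And>n. distr \<Omega> (count_space UNIV) (\<lambda>\<omega>. (z n \<omega>, z (Suc n) \<omega>)) = Q n"
    by blast
  interpret \<Omega>: prob_space \<Omega> by fact
  have zz: "(\<lambda>\<omega>. (z n \<omega>, z (Suc n) \<omega>)) \<in> \<Omega> \<rightarrow>\<^sub>M count_space UNIV" for n
    using measurable_Pair[OF z z, of n "Suc n"] by (simp add: pair_measure_countable)
  have z_law: "distr \<Omega> (count_space UNIV) (z n) = distr (msr (X n)) (count_space UNIV) (r n)" for n
  proof -
    have "distr (Q n) (count_space UNIV) fst = distr \<Omega> (count_space UNIV) (fst \<circ> (\<lambda>\<omega>. (z n \<omega>, z (Suc n) \<omega>)))"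
      unfolding zQ[symmetric] by (rule distr_distr[OF _ zz]) simp
    then show ?thesis by (simp add: Q1 comp_def)
  qed

  \<comment> \<open>Transitions witnessed by matched points\<close>
  define G where "G n = (\<lambda>p. (r n (fst p), r (Suc n) (snd p))) ` S n" for n
  define H where "H N = {\<omega> \<in> space \<Omega>. \<forall>n\<ge>N. (z n \<omega>, z (Suc n) \<omega>) \<in> G n}" for N
  have Gm: "{\<omega> \<in> space \<Omega>. (z n \<omega>, z (Suc n) \<omega>) \<notin> G n} \<in> sets \<Omega>" for n
    using measurable_sets[OF zz[of n], of "- G n"] by (simp add: vimage_def Int_def conj_commute)
  \<comment> \<open>Since \<open>G n\<close> is the image of \<open>S n\<close>, a pair of cells
    outside it comes only from coupled points outside \<open>S n\<close>.\<close>
  have Gprob: "\<Omega>.prob {\<omega> \<in> space \<Omega>. (z n \<omega>, z (Suc n) \<omega>) \<notin> G n} \<le> e n" for n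
  proof -
    interpret \<pi>: prob_space "\<pi> n" by (rule prob_\<pi>)
    have S: "S n \<in> sets (\<pi> n)" "measure (\<pi> n) (S n) > 1 - e n" using \<pi>'[of n] by auto
    have "\<Omega>.prob {\<omega> \<in> space \<Omega>. (z n \<omega>, z (Suc n) \<omega>) \<notin> G n} = measure (Q n) (- G n)"
      unfolding zQ[symmetric] by (subst measure_distr[OF zz]) (auto intro!: arg_cong[where f = \<Omega>.prob])
    also have "\<dots> = \<pi>.prob ((\<lambda>p. (r n (fst p), r (Suc n) (snd p))) -` (- G n) \<inter> space (\<pi> n))"
      unfolding Q_def by (rule measure_distr[OF mQ]) simp
    also have "\<dots> \<le> \<pi>.prob (space (\<pi> n) - S n)"
      by (rule \<pi>.finite_measure_mono) (use S in \<open>auto simp: G_def\<close>)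
    also have "\<dots> = 1 - \<pi>.prob (S n)" by (rule \<pi>.prob_compl[OF S(1)])
    finally show ?thesis using S(2) by simp
  qed
  have Hm[measurable]: "H N \<in> sets \<Omega>" for N
  proof -
    have "H N = space \<Omega> - (\<Union>n\<in>{N..}. {\<omega> \<in> space \<Omega>. (z n \<omega>, z (Suc n) \<omega>) \<notin> G n})"
      by (auto simp: H_def)
    then show ?thesis using Gm by auto
  qed
  \<comment> \<open>A union bound; the geometric rate sums the exceptional masses from
    \<open>N\<close> on to \<open>2 * e N\<close>.\<close>
  have Hprob: "\<Omega>.prob (H N) \<ge> 1 - 2 * e N" for N
  proof -
    let ?B = "\<lambda>k. {\<omega> \<in> space \<Omega>. (z (N + k) \<omega>, z (Suc (N + k)) \<omega>) \<notin> G (N + k)}"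
    have sums: "(\<lambda>k. e (N + k)) sums (2 * e N)"
      using sums_mult[OF geometric_sums[of "1 / 2 :: real"], of "e N"] by (simp add: e_def power_add mult.commute)
    have sm: "summable (\<lambda>k. \<Omega>.prob (?B k))"
      by (rule summable_comparison_test'[OF sums_summable[OF sums], of 0]) (use Gprob in auto)
    have "space \<Omega> - H N = (\<Union>k. ?B k)"
    proof (intro equalityI subsetI)
      fix \<omega> assume "\<omega> \<in> space \<Omega> - H N"
      then obtain n where n: "n \<ge> N" "(z n \<omega>, z (Suc n) \<omega>) \<notin> G n" "\<omega> \<in> space \<Omega>" by (auto simp: H_def)
      then have "\<omega> \<in> ?B (n - N)" by simp
      then show "\<omega> \<in> (\<Union>k. ?B k)" by blast
    next
      fix \<omega> assume "\<omega> \<in> (\<Union>k. ?B k)"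
      then obtain k where "\<omega> \<in> ?B k" by blast
      then show "\<omega> \<in> space \<Omega> - H N" using le_add1[of N k] unfolding H_def by blast
    qed
    then have "1 - \<Omega>.prob (H N) = \<Omega>.prob (\<Union>k. ?B k)" using \<Omega>.prob_compl[OF Hm, of N] by simp
    also have "\<dots> \<le> (\<Sum>k. \<Omega>.prob (?B k))"
      by (rule \<Omega>.finite_measure_subadditive_countably[OF _ sm]) (use Gm in auto)
    also have "\<dots> \<le> (\<Sum>k. e (N + k))" by (rule suminf_le[OF _ sm sums_summable[OF sums]]) (rule Gprob)
    also have "\<dots> = 2 * e N" by (rule sums_unique[symmetric, OF sums])
    finally show ?thesis by simp
  qed
  have H_mono: "H N \<subseteq> H M" if "N \<le> M" for N M using that by (auto simp: H_def)
  have H_ae: "AE \<omega> in \<Omega>. \<omega> \<in> (\<Union>N. H N)"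
  proof -
    have "1 - 2 * e N \<le> \<Omega>.prob (\<Union>N. H N)" for N
      using Hprob[of N] \<Omega>.finite_measure_mono[of "H N" "\<Union>N. H N"] by force
    moreover have "(\<lambda>N. 1 - 2 * e N) \<longlonglongrightarrow> 1 - 2 * 0"
      unfolding e_def by (intro tendsto_intros LIMSEQ_power_zero) simp
    ultimately have "1 \<le> \<Omega>.prob (\<Union>N. H N)" by (intro LIMSEQ_le_const2) auto
    then have "\<Omega>.prob (\<Union>N. H N) = 1" using \<Omega>.prob_le_1 by (simp add: antisym)
    then show ?thesis by (subst \<Omega>.AE_in_set_eq_1) auto
  qed

  \<comment> \<open>Threads of matching features\<close>
  define T where "T = {t. (\<forall>n. t n \<in> feats (X n)) \<and>
    (\<forall>n. \<forall>p\<in>S n. \<bar>t n (fst p) - t (Suc n) (snd p)\<bar> \<le> e n / 2)}"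
  have T_ex: "\<exists>t\<in>T. t n = f" if f: "f \<in> feats (X n)" for n f
  proof -
    have "\<exists>t. (\<forall>m. t m \<in> feats (X m) \<and> (\<forall>p\<in>S m. \<bar>t m (fst p) - t (Suc m) (snd p)\<bar> \<le> e m / 2)) \<and> t n = f"
      by (rule ex_thread[where R = "\<lambda>m f g. \<forall>p\<in>S m. \<bar>f (fst p) - g (snd p)\<bar> \<le> e m / 2"])
         (use \<pi>' f in blast)+
    then show ?thesis by (auto simp: T_def)
  qed
  have TF: "t n \<in> feats (X n)" if "t \<in> T" for t n using that by (simp add: T_def)
  have TK: "t n (w n i) \<in> {-1/2..1/2}" if "t \<in> T" for t n i
    using XK[of n] TF[OF that, of n] w[of n i] by (simp add: gds_data_K_def)
  obtain f0 where "f0 \<in> feats (X 0)" using X.feats_nonempty[of 0] by blast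
  then have T_ne: "T \<noteq> {}" using T_ex[of f0 0] by blast
  \<comment> \<open>The cell of \<open>X n\<close> contributes \<open>e n\<close>, the coupling
    \<open>e n / 2\<close>, and the cell of \<open>X (Suc n)\<close>, of half the radius, another
    \<open>e n / 2\<close>.\<close>
  have step: "\<bar>t n (w n i) - t (Suc n) (w (Suc n) j)\<bar> \<le> 2 * e n" if t: "t \<in> T" and ij: "(i, j) \<in> G n" for t n i j
  proof -
    obtain p where p: "p \<in> S n" "r n (fst p) = i" "r (Suc n) (snd p) = j"
      using ij by (auto simp: G_def)
    have pp: "fst p \<in> pts (X n)" "snd p \<in> pts (X (Suc n))" using \<pi>'[of n] p by auto
    have "\<bar>t n (fst p) - t n (w n i)\<bar> < e n"
      using X.feats_lipschitz[OF TF[OF t] pp(1) w[of n i]] rw[OF pp(1)] p by simp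
    moreover have "\<bar>t (Suc n) (snd p) - t (Suc n) (w (Suc n) j)\<bar> < e n / 2"
      using X.feats_lipschitz[OF TF[OF t] pp(2) w[of "Suc n" j]] rw[OF pp(2)] p by (simp add: e(2))
    moreover have "\<bar>t n (fst p) - t (Suc n) (snd p)\<bar> \<le> e n / 2" using t p(1) by (simp add: T_def)
    ultimately show ?thesis by argo
  qed

  \<comment> \<open>Cell centres as bounded functions on threads\<close>
  define b :: "nat \<Rightarrow> nat \<Rightarrow> (nat \<Rightarrow> 'a \<Rightarrow> real) discrete \<Rightarrow>\<^sub>C real" where
    "b n i = Bcontfun (\<lambda>d. if of_discrete d \<in> T then of_discrete d n (w n i) else 0)" for n i
  \<comment> \<open>Every function on a discrete type is continuous, and the range of the features
    supplies the bound, so \<open>Bcontfun\<close> really represents this function.\<close>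
  have b_apply: "apply_bcontfun (b n i) (discrete t) = (if t \<in> T then t n (w n i) else 0)" for n i t
  proof -
    have "(\<lambda>d. if of_discrete d \<in> T then of_discrete d n (w n i) else 0) \<in> bcontfun"
    proof (rule bcontfun_normI)
      show "continuous_on UNIV (\<lambda>d :: (nat \<Rightarrow> 'a \<Rightarrow> real) discrete. if of_discrete d \<in> T then of_discrete d n (w n i) else (0 :: real))"
        by (simp add: continuous_on_open_invariant open_discrete)
      show "norm (if of_discrete d \<in> T then of_discrete d n (w n i) else 0) \<le> 1 / 2" for d :: "(nat \<Rightarrow> 'a \<Rightarrow> real) discrete"
        using TK[of "of_discrete d" n i] by (auto simp: abs_le_iff)
    qed
    then show ?thesis by (simp add: b_def Bcontfun_inverse discrete_inverse)
  qed
  have b_step: "dist (b n i) (b (Suc n) j) \<le> 2 * e n" if "(i, j) \<in> G n" for n i j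
  proof (rule dist_bound)
    fix d :: "(nat \<Rightarrow> 'a \<Rightarrow> real) discrete"
    obtain t where "d = discrete t" by (cases d)
    then show "dist (apply_bcontfun (b n i) d) (apply_bcontfun (b (Suc n) j) d) \<le> 2 * e n"
      using step[OF _ that, of t] e(1)[of n] by (simp add: b_apply dist_real_def)
  qed

  \<comment> \<open>Almost sure convergence of the chain\<close>
  define A where "A n \<omega> = b n (z n \<omega>)" for n \<omega>
  have A_dist: "dist (A n \<omega>) (A (n + k) \<omega>) \<le> 4 * e n" if \<omega>: "\<omega> \<in> H n" for n k \<omega>
  proof -
    \<comment> \<open>The sharper bound makes the induction close: each jump of at most
      \<open>2 * e m\<close> is the difference of \<open>4 * e m\<close> and
      \<open>4 * e (Suc m)\<close>.\<close>
    have "dist (A n \<omega>) (A (n + k) \<omega>) \<le> 4 * (e n - e (n + k))"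
    proof (induction k)
      case (Suc k)
      have "(z (n + k) \<omega>, z (Suc (n + k)) \<omega>) \<in> G (n + k)" using \<omega> by (simp add: H_def)
      then have "dist (A (n + k) \<omega>) (A (n + Suc k) \<omega>) \<le> 2 * e (n + k)"
        using b_step by (simp add: A_def)
      then show ?case
        using Suc dist_triangle[of "A n \<omega>" "A (n + Suc k) \<omega>" "A (n + k) \<omega>"] e(2)[of "n + k"] by simp
    qed simp
    then show ?thesis using e(1)[of "n + k"] by simp
  qed
  have A_conv: "convergent (\<lambda>n. A n \<omega>)" if \<omega>: "\<omega> \<in> H N" for N \<omega>
  proof -
    have "Cauchy (\<lambda>n. A n \<omega>)"
      unfolding Cauchy_altdef
    proof (intro allI impI)
      fix c :: real assume c: "c > 0"
      have "(\<lambda>n. 4 * e n) \<longlonglongrightarrow> 4 * 0" unfolding e_def by (intro tendsto_intros LIMSEQ_power_zero) simp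
      then have "\<forall>\<^sub>F n in sequentially. 4 * e n < c" using c by (intro order_tendstoD) auto
      then have "\<forall>\<^sub>F n in sequentially. 4 * e n < c \<and> n \<ge> N" using eventually_ge_at_top by (rule eventually_conj)
      then obtain M where M: "\<And>n. n \<ge> M \<Longrightarrow> 4 * e n < c \<and> n \<ge> N" by (auto simp: eventually_sequentially)
      have "dist (A m \<omega>) (A n \<omega>) < c" if "m \<ge> M" "n > m" for m n
      proof -
        have "\<omega> \<in> H m" using H_mono[of N m] M[OF that(1)] \<omega> by blast
        then show ?thesis using A_dist[of \<omega> m "n - m"] M[OF that(1)] that by simp
      qed
      then show "\<exists>M. \<forall>m\<ge>M. \<forall>n>m. dist (A m \<omega>) (A n \<omega>) < c" by blast
    qed
    then show ?thesis by (rule Cauchy_convergent)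
  qed
  \<comment> \<open>The default \<open>b 0 0\<close> keeps \<open>\<Phi>\<close> in the closure of
    the countable set of centres also on the null event without convergence.\<close>
  define \<Phi> where "\<Phi> \<omega> = (if \<omega> \<in> (\<Union>N. H N) then lim (\<lambda>n. A n \<omega>) else b 0 0)" for \<omega>
  have A_lim: "(\<lambda>n. A n \<omega>) \<longlonglongrightarrow> \<Phi> \<omega>" if "\<omega> \<in> H N" for N \<omega>
    using A_conv[OF that] that by (auto simp: \<Phi>_def convergent_LIMSEQ_iff)
  have A_\<Phi>: "dist (A n \<omega>) (\<Phi> \<omega>) \<le> 4 * e n" if \<omega>: "\<omega> \<in> H n" for n \<omega>
  proof (rule LIMSEQ_le_const2)
    show "(\<lambda>k. dist (A n \<omega>) (A (n + k) \<omega>)) \<longlonglongrightarrow> dist (A n \<omega>) (\<Phi> \<omega>)"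
      using LIMSEQ_ignore_initial_segment[OF A_lim[OF \<omega>], of n] by (intro tendsto_intros) (simp add: add.commute)
  qed (use A_dist[OF \<omega>] in blast)
  \<comment> \<open>\<open>A n\<close> factors through a \<open>nat\<close>-valued state, so it is
    Borel measurable whether or not the target space is separable.\<close>
  have [measurable]: "A n \<in> \<Omega> \<rightarrow>\<^sub>M borel" for n
    unfolding A_def by (rule measurable_compose[OF z]) simp
  have \<Phi>m[measurable]: "\<Phi> \<in> \<Omega> \<rightarrow>\<^sub>M borel"
  proof (rule borel_measurable_LIMSEQ_metric)
    show "(\<lambda>\<omega>. if \<omega> \<in> (\<Union>N. H N) then A n \<omega> else b 0 0) \<in> \<Omega> \<rightarrow>\<^sub>M borel" for n
      by measurable
    show "(\<lambda>n. if \<omega> \<in> (\<Union>N. H N) then A n \<omega> else b 0 0) \<longlonglongrightarrow> \<Phi> \<omega>" for \<omega>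
      using A_lim[of \<omega>] by (cases "\<omega> \<in> (\<Union>N. H N)") (auto simp: \<Phi>_def)
  qed

  \<comment> \<open>The limit data set and a random point of it\<close>
  define D where "D = range (\<lambda>(n, i). b n i)"
  have D: "countable D" by (simp add: D_def)
  have \<Phi>D: "\<Phi> \<omega> \<in> closure D" for \<omega>
  proof (cases "\<omega> \<in> (\<Union>N. H N)")
    case True
    then obtain N where N: "\<omega> \<in> H N" by blast
    have "A n \<omega> \<in> D" for n unfolding A_def D_def by (rule image_eqI[of _ _ "(n, z n \<omega>)"]) auto
    then show ?thesis
      unfolding closure_sequential using A_lim[OF N] by (intro exI[of _ "\<lambda>n. A n \<omega>"]) blast
  next
    case False
    have "b 0 0 \<in> D" unfolding D_def by (rule image_eqI[of _ _ "(0, 0)"]) auto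
    then show ?thesis using False closure_subset by (auto simp: \<Phi>_def)
  qed
  define \<mu> where "\<mu> = distr \<Omega> borel \<Phi>"
  have prob_\<mu>: "prob_space \<mu>" unfolding \<mu>_def by (rule \<Omega>.prob_space_distr[OF \<Phi>m])
  have sets_\<mu>: "sets \<mu> = sets borel" by (simp add: \<mu>_def)
  have \<mu>D: "emeasure \<mu> (- closure D) = 0"
    unfolding \<mu>_def using \<Phi>D by (subst emeasure_distr[OF \<Phi>m]) (auto simp: vimage_def)
  define L where "L = evaluation_gds T \<mu>"
  define P where "P = measure_support \<mu>"
  have ptsL: "pts L = P" and featsL: "feats L = (\<lambda>t. restrict (\<lambda>u. apply_bcontfun u (discrete t)) P) ` T"
    and msrL: "msr L = restrict_space \<mu> P"
    by (simp_all add: L_def evaluation_gds_def P_def)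
  have gL: "geometric_data_set L"
    unfolding L_def
  proof (rule geometric_data_set_evaluation_gds[OF prob_\<mu> sets_\<mu> D \<mu>D T_ne])
    fix u t assume "u \<in> D" "t \<notin> T"
    then show "apply_bcontfun u (discrete t) = 0" by (auto simp: D_def b_apply)
  qed
  interpret L: gds L by unfold_locales (rule gL)
  have PD: "P \<subseteq> closure D" unfolding P_def by (rule measure_support_subset[OF sets_\<mu> _ \<mu>D]) simp
  have LK: "L \<in> gds_data_K"
  proof -
    have "apply_bcontfun u (discrete t) \<in> {-1/2..1/2}" if "t \<in> T" "u \<in> P" for t u
    proof -
      have "closed (PiC {discrete t} (\<lambda>_. {-1/2..1/2 :: real}))" by (rule closed_PiC) simp
      moreover have "D \<subseteq> PiC {discrete t} (\<lambda>_. {-1/2..1/2})"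
        using TK that by (auto simp: D_def mem_PiC_iff b_apply)
      ultimately have "closure D \<subseteq> PiC {discrete t} (\<lambda>_. {-1/2..1/2})" by (rule closure_minimal[rotated])
      then have "u \<in> PiC {discrete t} (\<lambda>_. {-1/2..1/2})" using that PD by blast
      then show ?thesis unfolding mem_PiC_iff by auto
    qed
    then show ?thesis using gL by (simp add: gds_data_K_def ptsL featsL)
  qed

  have Pm[measurable]: "P \<in> sets borel" unfolding P_def using closed_measure_support[OF sets_\<mu>] by simp
  have P_ae: "AE \<omega> in \<Omega>. \<Phi> \<omega> \<in> P"
  proof -
    have "emeasure \<mu> (- P) = 0" unfolding P_def by (rule emeasure_Compl_measure_support[OF sets_\<mu> D \<mu>D])
    then have "emeasure \<Omega> (\<Phi> -` (- P) \<inter> space \<Omega>) = 0"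
      unfolding \<mu>_def using Pm by (subst (asm) emeasure_distr[OF \<Phi>m]) auto
    then show ?thesis
      using measurable_sets[OF \<Phi>m, of "- P"] Pm by (intro AE_I[of _ _ "\<Phi> -` (- P) \<inter> space \<Omega>"]) auto
  qed
  obtain p0 where p0: "p0 \<in> P" using L.pts_nonempty ptsL by blast
  \<comment> \<open>A change on a null event that puts all values into the support, so that
    \<open>\<Psi>\<close> maps into the points of \<open>L\<close>.\<close>
  define \<Psi> where "\<Psi> \<omega> = (if \<Phi> \<omega> \<in> P then \<Phi> \<omega> else p0)" for \<omega>
  have \<Psi>b: "\<Psi> \<in> \<Omega> \<rightarrow>\<^sub>M borel" unfolding \<Psi>_def by measurable
  have \<Psi>m[measurable]: "\<Psi> \<in> \<Omega> \<rightarrow>\<^sub>M msr L"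
    unfolding msrL
  proof (rule measurable_restrict_space2)
    show "\<Psi> \<in> space \<Omega> \<rightarrow> P" using p0 by (simp add: \<Psi>_def)
    show "\<Psi> \<in> \<Omega> \<rightarrow>\<^sub>M \<mu>" using \<Psi>b by (simp add: measurable_cong_sets[OF refl sets_\<mu>])
  qed
  have \<Psi>_law: "distr \<Omega> (msr L) \<Psi> = msr L"
  proof (rule measure_eqI)
    fix B assume "B \<in> sets (distr \<Omega> (msr L) \<Psi>)"
    then have B: "B \<in> sets (msr L)" by simp
    then have B': "B \<subseteq> P" "B \<in> sets borel"
      using Pm by (auto simp: msrL sets_restrict_space sets_\<mu>)
    have "emeasure (distr \<Omega> (msr L) \<Psi>) B = emeasure \<Omega> (\<Psi> -` B \<inter> space \<Omega>)"
      by (rule emeasure_distr[OF \<Psi>m B])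
    also have "\<dots> = emeasure \<Omega> (\<Phi> -` B \<inter> space \<Omega>)"
    proof (rule emeasure_eq_AE)
      show "AE \<omega> in \<Omega>. (\<omega> \<in> \<Psi> -` B \<inter> space \<Omega>) = (\<omega> \<in> \<Phi> -` B \<inter> space \<Omega>)"
        using P_ae by eventually_elim (simp add: \<Psi>_def)
    qed (use measurable_sets[OF \<Psi>m B] measurable_sets[OF \<Phi>m B'(2)] in auto)
    also have "\<dots> = emeasure \<mu> B"
      unfolding \<mu>_def by (rule emeasure_distr[symmetric, OF \<Phi>m B'(2)])
    also have "\<dots> = emeasure (msr L) B"
      unfolding msrL using B' Pm by (intro emeasure_restrict_space[symmetric]) (auto simp: sets_\<mu>)
    finally show "emeasure (distr \<Omega> (msr L) \<Psi>) B = emeasure (msr L) B" .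
  qed simp

  \<comment> \<open>The rate of convergence to the limit\<close>
  have bound: "box_dist (X n) L \<le> 10 * e n" for n
  proof -
    \<comment> \<open>The state \<open>z n\<close> has the law of the cell of a random point of
      \<open>X n\<close>, so the chain is glued to \<open>X n\<close> along this cell.\<close>
    obtain \<Theta> where \<Theta>: "sets \<Theta> = sets (msr (X n) \<Otimes>\<^sub>M \<Omega>)" "prob_space \<Theta>" "distr \<Theta> (msr (X n)) fst = msr (X n)"
      "distr \<Theta> \<Omega> snd = \<Omega>" "AE p in \<Theta>. r n (fst p) = z n (snd p)"
      using glue_index[OF X.pr.prob_space_axioms \<Omega> r z z_law[symmetric]] by blast
    interpret \<Theta>: prob_space \<Theta> by fact
    have mf: "fst \<in> \<Theta> \<rightarrow>\<^sub>M msr (X n)" and ms[measurable]: "snd \<in> \<Theta> \<rightarrow>\<^sub>M \<Omega>"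
      by (simp_all add: measurable_cong_sets[OF \<Theta>(1) refl])
    have m3[measurable]: "(\<lambda>p. r n (fst p)) \<in> \<Theta> \<rightarrow>\<^sub>M count_space UNIV"
      by (rule measurable_compose[OF mf r])
    define E where "E = {p \<in> space \<Theta>. snd p \<in> H n \<and> r n (fst p) = z n (snd p) \<and> \<Phi> (snd p) \<in> P}"
    have Em: "E \<in> sets \<Theta>" unfolding E_def by measurable
    have "AE \<omega> in distr \<Theta> \<Omega> snd. \<Phi> \<omega> \<in> P" using P_ae by (simp only: \<Theta>(4))
    then have "AE p in \<Theta>. \<Phi> (snd p) \<in> P" by (rule AE_distrD[OF ms])
    then have "\<Theta>.prob E = \<Theta>.prob (snd -` H n \<inter> space \<Theta>)"
      using \<Theta>(5) measurable_sets[OF ms Hm, of n] Em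
      by (intro \<Theta>.finite_measure_eq_AE) (auto simp: E_def)
    also have "\<dots> = measure (distr \<Theta> \<Omega> snd) (H n)" by (rule measure_distr[symmetric, OF ms Hm])
    finally have PE: "\<Theta>.prob E \<ge> 1 - 2 * e n" using Hprob by (simp add: \<Theta>)
    \<comment> \<open>The cell costs \<open>e n\<close> and the remaining chain
      \<open>4 * e n\<close>; the factor 2 in the box distance explains the 10.\<close>
    have near: "\<bar>t n (fst p) - apply_bcontfun (\<Psi> (snd p)) (discrete t)\<bar> \<le> 10 * e n / 2"
      if p: "p \<in> E" and t: "t \<in> T" for p t
    proof -
      have ps: "p \<in> space \<Theta>" and pH: "snd p \<in> H n" and pr: "r n (fst p) = z n (snd p)" and pP: "\<Phi> (snd p) \<in> P"
        using p by (auto simp: E_def)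
      have px: "fst p \<in> pts (X n)" using measurable_space[OF mf ps] by (simp add: X.space_msr)
      have "\<bar>t n (fst p) - t n (w n (z n (snd p)))\<bar> < e n"
        using X.feats_lipschitz[OF TF[OF t] px w[of n "r n (fst p)"]] rw[OF px] by (simp flip: pr)
      moreover have "\<bar>t n (w n (z n (snd p))) - apply_bcontfun (\<Phi> (snd p)) (discrete t)\<bar> \<le> 4 * e n"
        using dist_bounded[of "A n (snd p)" "discrete t" "\<Phi> (snd p)"] A_\<Phi>[OF pH] t
        by (simp add: A_def b_apply dist_real_def)
      ultimately show ?thesis using pP by (simp add: \<Psi>_def)
    qed
    show ?thesis
    proof (rule box_distI[OF gX gL \<Theta>(2) mf \<Theta>(3), of "\<Psi> \<circ> snd" E])
      show "\<Psi> \<circ> snd \<in> \<Theta> \<rightarrow>\<^sub>M msr L" by (rule measurable_comp[OF ms \<Psi>m])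
      show "distr \<Theta> (msr L) (\<Psi> \<circ> snd) = msr L"
        using distr_distr[OF \<Psi>m ms] by (simp add: \<Theta> \<Psi>_law)
      show "E \<in> sets \<Theta>" by fact
      show "1 - 10 * e n \<le> \<Theta>.prob E" "0 \<le> 10 * e n" using PE e(1)[of n] by auto
    next
      fix f assume "f \<in> feats (X n)"
      then obtain t where t: "t \<in> T" "t n = f" using T_ex by blast
      define g where "g = restrict (\<lambda>u. apply_bcontfun u (discrete t)) P"
      have "g \<in> feats L" unfolding featsL g_def using t(1) by (rule imageI)
      moreover have "\<bar>f (fst p) - g ((\<Psi> \<circ> snd) p)\<bar> \<le> 10 * e n / 2" if "p \<in> E" for p
        using near[OF that t(1)] t(2) p0 by (simp add: g_def \<Psi>_def)
      ultimately show "\<exists>g\<in>feats L. \<forall>p\<in>E. \<bar>f (fst p) - g ((\<Psi> \<circ> snd) p)\<bar> \<le> 10 * e n / 2" by blast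
    next
      fix g assume "g \<in> feats L"
      then obtain t where t: "t \<in> T" "g = restrict (\<lambda>u. apply_bcontfun u (discrete t)) P"
        unfolding featsL by blast
      have "\<bar>t n (fst p) - g ((\<Psi> \<circ> snd) p)\<bar> \<le> 10 * e n / 2" if "p \<in> E" for p
        using near[OF that t(1)] t(2) p0 by (simp add: \<Psi>_def)
      then show "\<exists>f\<in>feats (X n). \<forall>p\<in>E. \<bar>f (fst p) - g ((\<Psi> \<circ> snd) p)\<bar> \<le> 10 * e n / 2"
        using TF[OF t(1), of n] by blast
    qed
  qed
  have "(\<lambda>n. 10 * e n) \<longlonglongrightarrow> 10 * 0" unfolding e_def by (intro tendsto_intros LIMSEQ_power_zero) simp
  then have "(\<lambda>n. box_dist (X n) L) \<longlonglongrightarrow> 0"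
    by (intro tendsto_sandwich[of "\<lambda>_. 0" "\<lambda>n. box_dist (X n) L" sequentially "\<lambda>n. 10 * e n" 0] always_eventually)
       (use bound box_dist_nonneg in auto)
  then show ?thesis using LK by blast
qed

section \<open>Isomorphism classes\<close>

text \<open>Taking values in the closed interval survives pointwise limits, and an isomorphism
  identifies the closures of the features, though not the families themselves.\<close>

lemma gds_data_K_iso:
  fixes X :: "'a gds_data" and Y :: "'b gds_data"
  assumes X: "X \<in> gds_data_K" and Y: "geometric_data_set Y" and iso: "gds_iso Y X"
  shows "Y \<in> gds_data_K"
proof -
  interpret X: gds X using X by unfold_locales (simp add: gds_data_K_def)
  interpret Y: gds Y using Y by unfold_locales
  obtain \<phi> where \<phi>: "\<phi> \<in> msr Y \<rightarrow>\<^sub>M msr X"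
    and cl: "(\<lambda>g. compose (pts Y) g \<phi>) ` feats_closure X = feats_closure Y"
    using iso unfolding gds_iso_def by blast
  have "f y \<in> {-1/2..1/2}" if f: "f \<in> feats Y" and y: "y \<in> pts Y" for f y
  proof -
    have x: "\<phi> y \<in> pts X" using measurable_space[OF \<phi>] y by (simp add: X.space_msr Y.space_msr)
    have "f \<in> feats_closure Y" using f by (rule Y.feats_subset_closure)
    then obtain g where g: "g \<in> feats_closure X" "f = compose (pts Y) g \<phi>" using cl by blast
    have "\<bar>g (\<phi> y)\<bar> \<le> 1 / 2 + d" if d: "d > 0" for d
    proof -
      obtain h where h: "h \<in> feats X" "\<And>x. x \<in> {\<phi> y} \<Longrightarrow> \<bar>h x - g x\<bar> < d"
        using X.feats_closure_approx[OF g(1), of "{\<phi> y}" d] x d by auto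
      have "h (\<phi> y) \<in> {-1/2..1/2}" using X h(1) x by (simp add: gds_data_K_def)
      then show ?thesis using h(2)[of "\<phi> y"] by (auto simp: abs_real_def split: if_splits)
    qed
    then have "\<bar>g (\<phi> y)\<bar> \<le> 1 / 2" by (rule field_le_epsilon)
    then show ?thesis using y by (auto simp: g(2) compose_def abs_le_iff)
  qed
  then show ?thesis using Y by (simp add: gds_data_K_def)
qed

lemma gds_iso_rel_iff:
  "(X, Y) \<in> gds_iso_rel \<longleftrightarrow> geometric_data_set X \<and> geometric_data_set Y \<and> box_dist X Y = 0"
  using gds_iso_iff_box_dist_0 by (auto simp: gds_iso_rel_def)

text \<open>With isomorphism read as vanishing distance, this is the equivalence relation of a
  pseudometric, and no isomorphism has to be inverted or composed.\<close>

lemma equiv_gds_iso_rel: "equiv {X. geometric_data_set X} gds_iso_rel"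
proof (rule equivI)
  show "gds_iso_rel \<subseteq> {X. geometric_data_set X} \<times> {X. geometric_data_set X}"
    by (auto simp: gds_iso_rel_def)
  show "refl_on {X. geometric_data_set X} gds_iso_rel"
    by (rule refl_onI) (simp add: gds_iso_rel_iff box_dist_refl)
  show "sym gds_iso_rel"
    by (rule symI) (simp add: gds_iso_rel_iff box_dist_commute)
  show "trans gds_iso_rel"
  proof (rule transI)
    fix X Y Z assume "(X, Y) \<in> gds_iso_rel" "(Y, Z) \<in> gds_iso_rel"
    then show "(X, Z) \<in> gds_iso_rel"
      using box_dist_triangle[of X Y Z] box_dist_nonneg[of X Z] by (auto simp: gds_iso_rel_iff)
  qed
qed

abbreviation gds_rep :: "real gds_data set \<Rightarrow> real gds_data" where
  "gds_rep C \<equiv> SOME X. X \<in> C"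

lemma gds_rep_in:
  assumes "C \<in> gds_classes"
  shows "gds_rep C \<in> C"
  using assms in_quotient_imp_non_empty[OF equiv_gds_iso_rel] unfolding gds_classes_def
  by (metis ex_in_conv someI_ex)

lemma gds_classes_gds: "C \<in> gds_classes \<Longrightarrow> X \<in> C \<Longrightarrow> geometric_data_set X"
  using in_quotient_imp_subset[OF equiv_gds_iso_rel] unfolding gds_classes_def by blast

lemma gds_classes_box_dist_0:
  assumes "C \<in> gds_classes" "X \<in> C" "Y \<in> C"
  shows "box_dist X Y = 0"
  using in_quotient_imp_in_rel[OF equiv_gds_iso_rel, of C X Y] assms
  by (simp add: gds_classes_def gds_iso_rel_iff)

lemma box_class_eq: "C \<in> gds_classes \<Longrightarrow> D \<in> gds_classes \<Longrightarrow> box_class C D = box_dist (gds_rep C) (gds_rep D)"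
  by (simp add: box_class_def)

lemma gds_classes_K_sub: "C \<in> gds_classes_K \<Longrightarrow> C \<in> gds_classes"
  by (simp add: gds_classes_K_def)

lemma gds_rep_K:
  assumes "C \<in> gds_classes_K"
  shows "gds_rep C \<in> gds_data_K"
proof -
  have C: "C \<in> gds_classes" using assms by (rule gds_classes_K_sub)
  have "\<forall>X\<in>C. \<forall>f\<in>feats X. \<forall>x\<in>pts X. f x \<in> {-1/2..1/2}"
    using assms unfolding gds_classes_K_def by blast
  then have "\<forall>f\<in>feats (gds_rep C). \<forall>x\<in>pts (gds_rep C). f x \<in> {-1/2..1/2}"
    using gds_rep_in[OF C] ..
  then show ?thesis
    using gds_classes_gds[OF C gds_rep_in[OF C]] unfolding gds_data_K_def by blast
qed

text \<open>\<open>gds_classes_K\<close> speaks about all members of a class, which makes the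
  invariance of the range condition under isomorphism necessary.\<close>

lemma class_of_gds_data_K:
  assumes X: "X \<in> gds_data_K"
  shows "gds_iso_rel `` {X} \<in> gds_classes_K" "X \<in> gds_iso_rel `` {X}"
proof -
  have gX: "geometric_data_set X" using X by (simp add: gds_data_K_def)
  then show "X \<in> gds_iso_rel `` {X}" by (simp add: gds_iso_rel_iff box_dist_refl)
  have "gds_iso_rel `` {X} \<in> gds_classes"
    unfolding gds_classes_def using gX by (intro quotientI) simp
  moreover have "Y \<in> gds_data_K" if Y: "Y \<in> gds_iso_rel `` {X}" for Y
  proof -
    have gY: "geometric_data_set Y" and "box_dist X Y = 0" using Y by (auto simp: gds_iso_rel_iff)
    then have "gds_iso Y X"
      by (simp add: gds_iso_iff_box_dist_0[OF gY gX] box_dist_commute[OF gY gX])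
    then show ?thesis by (rule gds_data_K_iso[OF X gY])
  qed
  ultimately show "gds_iso_rel `` {X} \<in> gds_classes_K"
    by (auto simp: gds_classes_K_def gds_data_K_def)
qed

lemma Metric_space_box_class: "Metric_space gds_classes_K box_class"
proof
  show "0 \<le> box_class C D" for C D
    by (simp add: box_class_def box_dist_nonneg)
  show "box_class C D = box_class D C" for C D
    using gds_rep_in gds_classes_gds by (auto simp: box_class_def intro!: box_dist_commute)
  show "box_class C D = 0 \<longleftrightarrow> C = D" if "C \<in> gds_classes_K" "D \<in> gds_classes_K" for C D
  proof -
    have C: "C \<in> gds_classes" and D: "D \<in> gds_classes" using that gds_classes_K_sub by auto
    note rep = gds_rep_in[OF C] gds_rep_in[OF D]
    have g: "geometric_data_set (gds_rep C)" "geometric_data_set (gds_rep D)"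
      using gds_classes_gds[OF C rep(1)] gds_classes_gds[OF D rep(2)] .
    have "C = D \<longleftrightarrow> (gds_rep C, gds_rep D) \<in> gds_iso_rel"
      using quotient_eq_iff[OF equiv_gds_iso_rel, of C D "gds_rep C" "gds_rep D"] C D rep
      by (simp add: gds_classes_def)
    then show ?thesis using g by (simp add: box_class_eq[OF C D] gds_iso_rel_iff)
  qed
  show "box_class C E \<le> box_class C D + box_class D E"
    if "C \<in> gds_classes_K" "D \<in> gds_classes_K" "E \<in> gds_classes_K" for C D E
    using that[THEN gds_classes_K_sub] gds_rep_in gds_classes_gds
    by (simp add: box_class_eq box_dist_triangle)
qed

lemma ex_strict_mono_ge:
  fixes N :: "nat \<Rightarrow> nat"
  shows "\<exists>s. strict_mono s \<and> (\<forall>k. N k \<le> s k)"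
proof -
  define s where "s = rec_nat (N 0) (\<lambda>k m. max (Suc m) (N (Suc k)))"
  have s: "s 0 = N 0" "s (Suc k) = max (Suc (s k)) (N (Suc k))" for k by (simp_all add: s_def)
  have "strict_mono s" by (rule strict_monoI_Suc) (simp add: s)
  moreover have "N k \<le> s k" for k by (cases k) (auto simp: s)
  ultimately show ?thesis by blast
qed

text \<open>A Cauchy sequence converges as soon as a subsequence does, so one with geometric rate
  may be extracted to meet the hypothesis of \<open>ex_box_limit\<close>. The limit found there is
  transported to a data set on real numbers before its class is formed.\<close>

lemma mcomplete_box_class: "Metric_space.mcomplete gds_classes_K box_class"
proof -
  interpret Metric_space gds_classes_K box_class by (rule Metric_space_box_class)
  show ?thesis
    unfolding mcomplete_def
  proof (intro allI impI)
    fix \<sigma> assume \<sigma>: "MCauchy \<sigma>"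
    then have \<sigma>K: "\<sigma> n \<in> gds_classes_K" for n by (auto simp: MCauchy_def)
    have "\<exists>N. \<forall>n n'. N \<le> n \<longrightarrow> N \<le> n' \<longrightarrow> box_class (\<sigma> n) (\<sigma> n') < (1/2) ^ k" for k :: nat
      using \<sigma> unfolding MCauchy_def by simp
    then obtain N where N: "\<And>k n n'. N k \<le> n \<Longrightarrow> N k \<le> n' \<Longrightarrow> box_class (\<sigma> n) (\<sigma> n') < (1/2) ^ k"
      by metis
    obtain s where s: "strict_mono s" "\<And>k. N k \<le> s k" using ex_strict_mono_ge[of N] by blast
    define X where "X n = gds_rep (\<sigma> (s n))" for n
    have XK: "X n \<in> gds_data_K" for n unfolding X_def by (rule gds_rep_K[OF \<sigma>K])
    have cl: "\<sigma> n \<in> gds_classes" for n using \<sigma>K gds_classes_K_sub by blast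
    have "box_dist (X n) (X (Suc n)) < (1/2) ^ n" for n
    proof -
      have "s n < s (Suc n)" using s(1) by (simp add: strict_mono_Suc_iff)
      then have "box_class (\<sigma> (s n)) (\<sigma> (s (Suc n))) < (1/2) ^ n"
        using s(2)[of n] by (intro N) auto
      then show ?thesis by (simp add: box_class_eq[OF cl cl] X_def)
    qed
    from ex_box_limit[OF XK this]
    obtain L :: "((nat \<Rightarrow> real \<Rightarrow> real) discrete \<Rightarrow>\<^sub>C real) gds_data" where
      LK: "L \<in> gds_data_K" and lim: "(\<lambda>n. box_dist (X n) L) \<longlonglongrightarrow> 0" by blast
    have gL: "geometric_data_set L" using LK by (simp add: gds_data_K_def)
    obtain Y :: "real gds_data" where Y: "geometric_data_set Y" "gds_iso L Y"
      using ex_gds_iso_real[OF gL] by blast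
    have LY: "box_dist L Y = 0" using Y gL by (simp add: gds_iso_iff_box_dist_0)
    then have "gds_iso Y L"
      by (simp add: gds_iso_iff_box_dist_0[OF Y(1) gL] box_dist_commute[OF Y(1) gL])
    then have YK: "Y \<in> gds_data_K" by (rule gds_data_K_iso[OF LK Y(1)])
    define C where "C = gds_iso_rel `` {Y}"
    have CK: "C \<in> gds_classes_K" and YC: "Y \<in> C" unfolding C_def using class_of_gds_data_K[OF YK] by auto
    have C: "C \<in> gds_classes" using CK by (rule gds_classes_K_sub)
    have gC: "geometric_data_set (gds_rep C)" using gds_classes_gds[OF C gds_rep_in[OF C]] .
    have le: "box_class (\<sigma> (s n)) C \<le> box_dist (X n) L" for n
    proof -
      have gX: "geometric_data_set (X n)" using XK by (simp add: gds_data_K_def)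
      have "box_class (\<sigma> (s n)) C = box_dist (X n) (gds_rep C)" by (simp add: box_class_eq[OF cl C] X_def)
      also have "\<dots> \<le> box_dist (X n) Y + box_dist Y (gds_rep C)" by (rule box_dist_triangle[OF gX Y(1) gC])
      also have "box_dist Y (gds_rep C) = 0" by (rule gds_classes_box_dist_0[OF C YC gds_rep_in[OF C]])
      also have "box_dist (X n) Y + 0 \<le> box_dist (X n) L" using box_dist_triangle[OF gX gL Y(1)] LY by simp
      finally show ?thesis .
    qed
    have "limitin mtopology (\<sigma> \<circ> s) C sequentially"
      unfolding limitin_metric
    proof (intro conjI CK allI impI)
      fix a :: real assume "a > 0"
      then have "\<forall>\<^sub>F n in sequentially. box_dist (X n) L < a" using lim by (rule order_tendstoD(2)[rotated])
      then show "\<forall>\<^sub>F n in sequentially. (\<sigma> \<circ> s) n \<in> gds_classes_K \<and> box_class ((\<sigma> \<circ> s) n) C < a"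
      proof eventually_elim
        case (elim n)
        then show ?case using le[of n] \<sigma>K by simp
      qed
    qed
    then have "limitin mtopology \<sigma> C sequentially" by (rule MCauchy_convergent_subsequence[OF \<sigma> s(1)])
    then show "\<exists>x. limitin mtopology \<sigma> x sequentially" by blast
  qed
qed

text \<open>The classes of countable nets of mesh \<open>1 / Suc n\<close> are dense; passing from a
  data set to the chosen representative of its class costs distance 0.\<close>

lemma separable_space_box_class: "separable_space (Metric_space.mtopology gds_classes_K box_class)"
proof -
  interpret Metric_space gds_classes_K box_class by (rule Metric_space_box_class)
  have "\<exists>C \<subseteq> gds_data_K :: real gds_data set. countable C \<and>
      (\<forall>X\<in>(gds_data_K :: real gds_data set). \<exists>Y\<in>C. box_dist X Y \<le> 1 / real (Suc n))" for n
    by (rule countable_box_net) simp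
  then obtain C :: "nat \<Rightarrow> real gds_data set" where C: "\<And>n. C n \<subseteq> gds_data_K" "\<And>n. countable (C n)"
    "\<And>n (X :: real gds_data). X \<in> gds_data_K \<Longrightarrow> \<exists>Y\<in>C n. box_dist X Y \<le> 1 / real (Suc n)" by metis
  define S where "S = (\<lambda>Y. gds_iso_rel `` {Y}) ` (\<Union>n. C n)"
  have S: "countable S" unfolding S_def using C(2) by (intro countable_image countable_UN) auto
  have SK: "S \<subseteq> gds_classes_K" unfolding S_def using C(1) class_of_gds_data_K(1) by blast
  have "c \<in> mtopology closure_of S" if c: "c \<in> gds_classes_K" for c
    unfolding metric_closure_of mem_Collect_eq
  proof (intro conjI c allI impI)
    fix a :: real assume "a > 0"
    then obtain n where n: "1 / real (Suc n) < a" using nat_approx_posE by blast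
    have repK: "gds_rep c \<in> gds_data_K" by (rule gds_rep_K[OF c])
    obtain Y where Y: "Y \<in> C n" "box_dist (gds_rep c) Y \<le> 1 / real (Suc n)" using C(3)[OF repK] by blast
    define E where "E = gds_iso_rel `` {Y}"
    have YK: "Y \<in> gds_data_K" using C(1) Y(1) by blast
    have EK: "E \<in> gds_classes_K" and YE: "Y \<in> E" unfolding E_def using class_of_gds_data_K[OF YK] by auto
    have E: "E \<in> gds_classes" and c': "c \<in> gds_classes" using EK c gds_classes_K_sub by auto
    have g: "geometric_data_set (gds_rep c)" "geometric_data_set Y" "geometric_data_set (gds_rep E)"
      using repK YK gds_classes_gds[OF E gds_rep_in[OF E]] by (auto simp: gds_data_K_def)
    have "box_class c E = box_dist (gds_rep c) (gds_rep E)" by (rule box_class_eq[OF c' E])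
    also have "\<dots> \<le> box_dist (gds_rep c) Y + box_dist Y (gds_rep E)" by (rule box_dist_triangle[OF g])
    also have "box_dist Y (gds_rep E) = 0" by (rule gds_classes_box_dist_0[OF E YE gds_rep_in[OF E]])
    finally have "box_class c E < a" using Y n by simp
    moreover have "E \<in> S" unfolding S_def E_def using Y(1) by blast
    ultimately show "\<exists>y\<in>S. y \<in> mball c a" using c EK by auto
  qed
  then have "mtopology closure_of S = gds_classes_K"
    using closure_of_subset_topspace[of mtopology S] by auto
  then show ?thesis
    unfolding separable_space_def using S SK by (intro exI[of _ S]) auto
qed

theorem theorem4p8:
  shows "Metric_space gds_classes_K box_class \<and>
         Metric_space.mcomplete gds_classes_K box_class \<and>
         separable_space (Metric_space.mtopology gds_classes_K box_class)"
  using Metric_space_box_class mcomplete_box_class separable_space_box_class by blast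

end
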